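(* Let $c_0>0$ be a fixed constant. Then there is a constant $C>0$, depending only on $c_0$ (in particular independent of $k$, $h$, $f$ and $\gamma$), such that the following holds. Let $k\ge 1$, let $h=1/n$ with $n$ a positive integer and $kh\le c_0$, let $f\in L^2(0,1)$, and let $\gamma=\mathbf{i}\,\gamma_{\mathrm{Im}}$ with $\gamma_{\mathrm{Im}}\in\mathbb{R}$, $\gamma_{\mathrm{Im}}<0$. Let $u\in H^2(0,1)$ be the solution of $$u''+k^2u=-f \text{ in } (0,1),\qquad u(0)=0,\qquad u'(1)-\mathbf{i}ku(1)=0,$$ and let $u_h\in V_h$ be the solution of the continuous interior penalty finite element method $a_h(u_h,v_h)=(f,v_h)$ for all $v_h\in V_h$. Then $$\|k(u-u_h)\|\le C\,(|\gamma|+|\gamma|^{-1})\,\min(1,k^3h^2)\,\|f\|$$ and $$\|(u-u_h)'\|\le C\,(|\gamma|+|\gamma|^{-1})\,\bigl(kh+\min(1,k^3h^2)\bigr)\,\|f\|.$$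
   Context: All functions are complex-valued, $\mathbf{i}$ is the imaginary unit, $(v,w)=\int_0^1 v\bar w\,dx$ and $\|w\|=(w,w)^{1/2}$. The boundary value problem has a unique solution $u\in H^2(0,1)$ for each $k>0$ and $f\in L^2(0,1)$. Mesh: $x_j=j/n=jh$, $0\le j\le n$, $K_j=(x_{j-1},x_j)$. For a function $v$ with one-sided limits at an interior node $x_j$ ($1\le j\le n-1$), the jump is $[v]_j:=v(x_j-)-v(x_j+)$. $V_h$ is the space of continuous functions on $[0,1]$ that are linear on each $K_j$ and vanish at $x=0$. For $u,v\in H^1(0,1)$ that vanish at $0$ and are $H^2$ on each $K_j$, $$a_h(u,v):=(u',v')-k^2(u,v)-\mathbf{i}k\,u(1)\bar v(1)+J(u,v),$$ $$J(u,v):=\sum_{j=1}^{n-1}\gamma h\,[u']_j[\bar v']_j+\gamma h\,(u'(1)-\mathbf{i}ku(1))(\bar v'(1)-\mathbf{i}k\bar v(1)),$$ where $\gamma$ is the (complex) penalty parameter. *)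

theory Defs
  imports "HOL-Analysis.Analysis"
begin

section \<open>Lebesgue and Sobolev spaces on an interval\<close>

definition L2 :: "real \<Rightarrow> real \<Rightarrow> (real \<Rightarrow> complex) set" where
  "L2 a b = {f \<in> borel_measurable (lebesgue_on {a<..<b}).
     integrable (lebesgue_on {a<..<b}) (\<lambda>x. (cmod (f x))\<^sup>2)}"

text \<open>Real test functions of class \<open>C\<^sup>1\<close> with compact support in \<open>(a, b)\<close>; this is the class used
  in Brezis's definition of the Sobolev spaces on an interval, and gives the same spaces as smooth
  test functions.\<close>

definition test_function :: "real \<Rightarrow> real \<Rightarrow> (real \<Rightarrow> real) \<Rightarrow> bool" where
  "test_function a b \<phi> \<longleftrightarrow> \<phi> C1_differentiable_on UNIV \<and>
     (\<exists>c d. a < c \<and> d < b \<and> (\<forall>x. x \<notin> {c..d} \<longrightarrow> \<phi> x = 0))"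

text \<open>Only used for \<open>u\<close> and \<open>g\<close> in \<^const>\<open>L2\<close>, so that both integrals are meaningful.\<close>

definition has_weak_deriv ::
    "real \<Rightarrow> real \<Rightarrow> (real \<Rightarrow> complex) \<Rightarrow> (real \<Rightarrow> complex) \<Rightarrow> bool" where
  "has_weak_deriv a b u g \<longleftrightarrow> (\<forall>\<phi>. test_function a b \<phi> \<longrightarrow>
     integral\<^sup>L (lebesgue_on {a<..<b}) (\<lambda>x. u x * complex_of_real (deriv \<phi> x)) =
     - integral\<^sup>L (lebesgue_on {a<..<b}) (\<lambda>x. g x * complex_of_real (\<phi> x)))"

definition H1 :: "real \<Rightarrow> real \<Rightarrow> (real \<Rightarrow> complex) set" where
  "H1 a b = {u \<in> L2 a b. \<exists>g \<in> L2 a b. has_weak_deriv a b u g}"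

definition H2 :: "real \<Rightarrow> real \<Rightarrow> (real \<Rightarrow> complex) set" where
  "H2 a b = {u \<in> L2 a b. \<exists>g \<in> H1 a b. has_weak_deriv a b u g}"

definition ip :: "(real \<Rightarrow> complex) \<Rightarrow> (real \<Rightarrow> complex) \<Rightarrow> complex" where
  "ip v w = integral\<^sup>L (lebesgue_on {0<..<1}) (\<lambda>x. v x * cnj (w x))"

definition L2norm :: "(real \<Rightarrow> complex) \<Rightarrow> real" where
  "L2norm w = sqrt (Re (ip w w))"


section \<open>The boundary value problem\<close>

text \<open>Members of the Sobolev spaces are functions rather than classes, so the point values in the
  boundary conditions are those of the continuous representatives of \<open>u\<close> and of its weak
  derivative \<open>u'\<close> on \<open>[0, 1]\<close>.\<close>

definition bvp_solution :: "real \<Rightarrow> (real \<Rightarrow> complex) \<Rightarrow> (real \<Rightarrow> complex) \<Rightarrow> bool" where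
  "bvp_solution k f u \<longleftrightarrow> u \<in> H2 0 1 \<and> continuous_on {0..1} u \<and> u 0 = 0 \<and>
     (\<exists>u' \<in> H1 0 1. \<exists>u'' \<in> L2 0 1.
        has_weak_deriv 0 1 u u' \<and> has_weak_deriv 0 1 u' u'' \<and>
        (AE x in lebesgue_on {0<..<1}. u'' x + (complex_of_real k)\<^sup>2 * u x = - f x) \<and>
        continuous_on {0..1} u' \<and>
        u' 1 - \<i> * complex_of_real k * u 1 = 0)"


section \<open>The continuous interior penalty method\<close>

text \<open>Classical derivative. A continuous function that is \<open>H\<^sup>2\<close> on each cell of a mesh is \<open>C\<^sup>1\<close> in the
  interior of each cell, where its weak and classical derivatives coincide, and the one-sided limits
  of the classical derivative at the mesh points are the traces of the weak one.\<close>

definition D :: "(real \<Rightarrow> complex) \<Rightarrow> real \<Rightarrow> complex" where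
  "D v x = vector_derivative v (at x)"

definition jump :: "(real \<Rightarrow> complex) \<Rightarrow> real \<Rightarrow> complex" where
  "jump v x = Lim (at_left x) v - Lim (at_right x) v"

definition node :: "nat \<Rightarrow> nat \<Rightarrow> real" where
  "node n j = real j / real n"

definition Vh :: "nat \<Rightarrow> (real \<Rightarrow> complex) set" where
  "Vh n = {v. continuous_on {0..1} v \<and>
     (\<forall>j \<in> {1..n}. \<exists>\<alpha> \<beta>. \<forall>x \<in> {node n (j - 1)<..<node n j}. v x = \<alpha> + \<beta> * complex_of_real x) \<and>
     v 0 = 0}"

text \<open>The second factor of the boundary term is \<open>cnj v' - \<i> k cnj v\<close> and not the conjugate of
  \<open>v' - \<i> k v\<close>. One-sided limits commute with conjugation, so the jump of \<open>cnj v'\<close> is the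
  conjugate of the jump of \<open>v'\<close>.\<close>

definition J :: "nat \<Rightarrow> real \<Rightarrow> complex \<Rightarrow> (real \<Rightarrow> complex) \<Rightarrow> (real \<Rightarrow> complex) \<Rightarrow> complex" where
  "J n k \<gamma> u v = (let h = complex_of_real (1 / real n); K = complex_of_real k in
     (\<Sum>j = 1..n - 1. \<gamma> * h * jump (D u) (node n j) * cnj (jump (D v) (node n j))) +
     \<gamma> * h * (Lim (at_left 1) (D u) - \<i> * K * u 1)
           * (cnj (Lim (at_left 1) (D v)) - \<i> * K * cnj (v 1)))"

definition a_h :: "nat \<Rightarrow> real \<Rightarrow> complex \<Rightarrow> (real \<Rightarrow> complex) \<Rightarrow> (real \<Rightarrow> complex) \<Rightarrow> complex" where
  "a_h n k \<gamma> u v = ip (D u) (D v) - (complex_of_real k)\<^sup>2 * ip u v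
     - \<i> * complex_of_real k * u 1 * cnj (v 1) + J n k \<gamma> u v"

definition cip_solution ::
    "nat \<Rightarrow> real \<Rightarrow> complex \<Rightarrow> (real \<Rightarrow> complex) \<Rightarrow> (real \<Rightarrow> complex) \<Rightarrow> bool" where
  "cip_solution n k \<gamma> f u\<^sub>h \<longleftrightarrow> u\<^sub>h \<in> Vh n \<and> (\<forall>v\<^sub>h \<in> Vh n. a_h n k \<gamma> u\<^sub>h v\<^sub>h = ip f v\<^sub>h)"

end

theory Submission
  imports Defs
begin

text \<open>Write \<open>\<gamma> = - \<i> g\<close> and \<open>t = k h\<close>. On \<open>V\<^sub>h\<close> the penalty is the symmetric \<^emph>\<open>bilinear\<close> form of
  \<open>\<gamma> A\<^sup>2 / h\<close>, where \<open>A\<close> is the second-difference matrix with the Robin condition in its last row (this uses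
  the unconjugated \<open>\<i> k\<close> in the second boundary factor). Hence the nodal values \<open>w\<close> of \<open>u\<^sub>h\<close> solve
  \<open>(A + \<gamma> A\<^sup>2 - t\<^sup>2 M) w = b\<close>. Testing with \<open>w\<close> and \<open>A w\<close>, with weights depending on \<open>t\<close> and \<open>g\<close> that absorb the
  indefinite boundary terms, bounds \<open>g |A w|\<^sup>2 + t |w\<^sub>n|\<^sup>2\<close> by \<open>|w| |b| + g |b|\<^sup>2\<close>. If \<open>k\<^sup>3 h\<^sup>2 \<ge> 1\<close> this is a stability
  estimate and no approximation is needed. If \<open>k\<^sup>3 h\<^sup>2 \<le> 1\<close>, then \<open>w + \<gamma> A w\<close> solves the equations of the
  unpenalised method with load \<open>b - \<gamma> t\<^sup>2 M A w\<close>; these form a three-term recurrence with characteristic roots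
  of modulus one, whose factorisation gives a bound free of pollution, and \<open>A w\<close> itself is small.\<close>

section \<open>Stiffness and mass matrices\<close>

text \<open>The obstacle is that \<open>A\<close> is complex symmetric but not Hermitian. Tested
  with \<open>w\<close>, the penalty gives \<open>g |A w|^2\<close> plus a multiple of the last
  entry of \<open>A w\<close> times the conjugate of that of \<open>w\<close>; this product has no
  sign and is not small unless \<open>g t\<close> is. As \<open>t\<close> is merely bounded and
  \<open>g\<close> arbitrary, it must be cancelled or dominated with the help of the identity for
  the test function \<open>A w\<close>.

  On coarse meshes the factor \<open>g + 1/g\<close> has two sources: \<open>1/g\<close> from
  dividing the bound on \<open>g |A w|^2\<close> by \<open>g\<close>, and \<open>g\<close> from the
  load term \<open>g |b|^2\<close>. The condition \<open>k^3 h^2 \<ge> 1\<close>, that is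
  \<open>h \<le> t^3\<close>, enters the bound on \<open>|w|\<close> where \<open>|w| |A w|\<close>
  has to be dominated by \<open>t^2 |w|^2\<close>.

  On fine meshes the natural factor is \<open>1 + g\<close>, and the difficulty is circularity: the
  load of the unpenalised problem contains \<open>A w\<close>, which is estimated through
  \<open>|w|\<close>, hence through the error itself. The circle is closed by distinguishing the
  size of \<open>g k t^2\<close>. Loads of the unpenalised problem are measured in the l1 norm, in
  which its inverse is bounded by a multiple of \<open>1 / t\<close> whatever the number of
  nodes.\<close>

text \<open>The rows of \<open>A\<close> and \<open>M\<close>: \<open>h\<close> times the stiffness matrix including the term \<open>- \<i> k u(1) v(1)\<close>, and the
  mass matrix divided by \<open>h\<close>. Row 0 of \<open>A\<close> is 0 so that \<open>A w\<close> vanishes at node 0 like \<open>w\<close>.\<close>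

definition stiffness :: "nat \<Rightarrow> real \<Rightarrow> (nat \<Rightarrow> complex) \<Rightarrow> nat \<Rightarrow> complex" where
  "stiffness n t w j = (if j = 0 then 0 else if j < n then 2 * w j - w (j - 1) - w (j + 1)
     else if j = n then w n - w (n - 1) - \<i> * of_real t * w n else 0)"

definition mass :: "nat \<Rightarrow> (nat \<Rightarrow> complex) \<Rightarrow> nat \<Rightarrow> complex" where
  "mass n w j = (if j < n then (w (j - 1) + 4 * w j + w (j + 1)) / 6
     else (w (n - 1) + 2 * w n) / 6)"

lemma sum_stiffness_aux:
  fixes w v :: "nat \<Rightarrow> complex"
  assumes "v 0 = 0"
  shows "(\<Sum>j=1..m. (2 * w j - w (j - 1) - w (j + 1)) * cnj (v j)) =
    (\<Sum>j=1..m. (w j - w (j - 1)) * cnj (v j - v (j - 1))) - (w (m + 1) - w m) * cnj (v m)"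
  using assms by (induction m) (auto simp: algebra_simps)

text \<open>Summation by parts. Apart from the Robin term, which sits at the last node only, the
  form is Hermitian; for \<open>v = w\<close> the real part is the gradient and the imaginary part
  the trace.\<close>

lemma sum_stiffness:
  fixes w v :: "nat \<Rightarrow> complex"
  assumes "v 0 = 0" "n > 0"
  shows "(\<Sum>j=1..n. stiffness n t w j * cnj (v j)) =
    (\<Sum>j=1..n. (w j - w (j - 1)) * cnj (v j - v (j - 1))) - \<i> * of_real t * w n * cnj (v n)"
proof -
  obtain m where m: "n = Suc m" using assms(2) by (cases n) auto
  define Q where "Q = (\<Sum>j=1..m. (w j - w (j - 1)) * cnj (v j - v (j - 1)))"
  have "(\<Sum>j=1..m. stiffness n t w j * cnj (v j)) =
      (\<Sum>j=1..m. (2 * w j - w (j - 1) - w (j + 1)) * cnj (v j))"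
    by (rule sum.cong) (auto simp: stiffness_def m)
  also have "\<dots> = Q - (w (m + 1) - w m) * cnj (v m)"
    unfolding Q_def by (rule sum_stiffness_aux) fact
  finally have "(\<Sum>j=1..n. stiffness n t w j * cnj (v j)) =
      Q - (w n - w m) * cnj (v m) + stiffness n t w n * cnj (v n)"
    by (simp add: m)
  also have "\<dots> = Q + (w n - w (n - 1)) * cnj (v n - v (n - 1)) - \<i> * of_real t * w n * cnj (v n)"
    by (simp add: m stiffness_def algebra_simps)
  also have "Q + (w n - w (n - 1)) * cnj (v n - v (n - 1)) =
      (\<Sum>j=1..n. (w j - w (j - 1)) * cnj (v j - v (j - 1)))"
    by (simp add: Q_def m)
  finally show ?thesis .
qed

lemma sum_mass_aux:
  fixes w v :: "nat \<Rightarrow> complex"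
  assumes "v 0 = 0" "w 0 = 0"
  shows "(\<Sum>j=1..m. (w (j - 1) + 4 * w j + w (j + 1)) * cnj (v j)) =
    6 * (\<Sum>j=1..m. w j * cnj (v j)) - (\<Sum>j=1..m. (w j - w (j - 1)) * cnj (v j - v (j - 1)))
      + (w (m + 1) - w m) * cnj (v m)"
  using assms by (induction m) (auto simp: algebra_simps)

text \<open>Row by row, \<open>(1, 4, 1) / 6 = 1 - (-1, 2, -1) / 6\<close>, and the last row loses a
  further \<open>1 / 2\<close> on the diagonal: up to a trace term the mass matrix is the identity
  minus a sixth of the Neumann stiffness matrix. Hence the energy identities involve no new kind of
  sum.\<close>

lemma sum_mass:
  fixes w v :: "nat \<Rightarrow> complex"
  assumes "v 0 = 0" "w 0 = 0" "n > 0"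
  shows "(\<Sum>j=1..n. mass n w j * cnj (v j)) =
    (\<Sum>j=1..n. w j * cnj (v j)) - w n * cnj (v n) / 2
      - (\<Sum>j=1..n. (w j - w (j - 1)) * cnj (v j - v (j - 1))) / 6"
proof -
  obtain m where m: "n = Suc m" using assms(3) by (cases n) auto
  define Q where "Q = (\<Sum>j=1..m. (w j - w (j - 1)) * cnj (v j - v (j - 1)))"
  define P where "P = (\<Sum>j=1..m. w j * cnj (v j))"
  have "(\<Sum>j=1..m. mass n w j * cnj (v j)) =
      (\<Sum>j=1..m. (w (j - 1) + 4 * w j + w (j + 1)) * cnj (v j)) / 6"
    unfolding sum_divide_distrib by (rule sum.cong) (auto simp: mass_def m)
  also have "\<dots> = (6 * P - Q + (w (m + 1) - w m) * cnj (v m)) / 6"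
    unfolding P_def Q_def by (subst sum_mass_aux[of v w]) (use assms in auto)
  finally have "(\<Sum>j=1..n. mass n w j * cnj (v j)) =
      (6 * P - Q + (w n - w m) * cnj (v m)) / 6 + mass n w n * cnj (v n)"
    by (simp add: m)
  also have "\<dots> = (P + w n * cnj (v n)) - w n * cnj (v n) / 2
      - (Q + (w n - w (n - 1)) * cnj (v n - v (n - 1))) / 6"
    by (simp add: m mass_def field_simps)
  also have "Q + (w n - w (n - 1)) * cnj (v n - v (n - 1)) =
      (\<Sum>j=1..n. (w j - w (j - 1)) * cnj (v j - v (j - 1)))"
    by (simp add: Q_def m)
  also have "P + w n * cnj (v n) = (\<Sum>j=1..n. w j * cnj (v j))"
    by (simp add: P_def m)
  finally show ?thesis .
qed

section \<open>Discrete norms, inverse and trace inequalities\<close>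

definition sq :: "nat \<Rightarrow> (nat \<Rightarrow> complex) \<Rightarrow> real" where
  "sq n w = (\<Sum>j=1..n. (cmod (w j))\<^sup>2)"

text \<open>Neither sum carries a mesh weight: for nodal values, \<open>h * sq\<close> has the size
  of a squared L2 norm and \<open>dsq / h\<close> that of the squared L2 norm of the
  derivative.\<close>

definition dsq :: "nat \<Rightarrow> (nat \<Rightarrow> complex) \<Rightarrow> real" where
  "dsq n w = (\<Sum>j=1..n. (cmod (w j - w (j - 1)))\<^sup>2)"

lemma sq_nonneg: "sq n w \<ge> 0" and dsq_nonneg: "dsq n w \<ge> 0"
  by (auto simp: sq_def dsq_def intro: sum_nonneg)

lemma sq_cnj: "(\<Sum>j=1..n. w j * cnj (w j)) = of_real (sq n w)"
  unfolding sq_def of_real_sum complex_norm_square by simp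

lemma dsq_cnj: "(\<Sum>j=1..n. (w j - w (j - 1)) * cnj (w j - w (j - 1))) = of_real (dsq n w)"
  unfolding dsq_def of_real_sum complex_norm_square by simp

lemma sum_cauchy:
  fixes a b :: "nat \<Rightarrow> complex"
  shows "cmod (\<Sum>j=1..n. a j * cnj (b j)) \<le> sqrt (sq n a) * sqrt (sq n b)"
proof -
  have "cmod (\<Sum>j=1..n. a j * cnj (b j)) \<le> (\<Sum>j=1..n. cmod (a j) * cmod (b j))"
    by (rule order_trans[OF norm_sum]) (simp add: norm_mult)
  also have "\<dots> \<le> L2_set (\<lambda>j. cmod (a j)) {1..n} * L2_set (\<lambda>j. cmod (b j)) {1..n}"
    using L2_set_mult_ineq[of "\<lambda>j. cmod (a j)" "\<lambda>j. cmod (b j)" "{1..n}"] by simp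
  finally show ?thesis by (simp add: L2_set_def sq_def)
qed

lemma norm_le_sq: "1 \<le> j \<Longrightarrow> j \<le> n \<Longrightarrow> (cmod (w j))\<^sup>2 \<le> sq n w"
  unfolding sq_def by (rule member_le_sum) auto

lemma sq_le_max:
  assumes "\<And>j. 1 \<le> j \<Longrightarrow> j \<le> n \<Longrightarrow> cmod (w j) \<le> B" "B \<ge> 0"
  shows "sq n w \<le> n * B\<^sup>2"
proof -
  have "sq n w \<le> (\<Sum>j=1..n. B\<^sup>2)" unfolding sq_def
    by (rule sum_mono) (use assms in \<open>auto intro!: power_mono\<close>)
  then show ?thesis by simp
qed

text \<open>Inverse inequality. The trace term is kept because the mass form contains exactly
  \<open>sq n w - |w n|^2 / 2\<close>.\<close>

lemma dsq_le:
  assumes "w 0 = 0" "n > 0"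
  shows "dsq n w \<le> 4 * sq n w - 2 * (cmod (w n))\<^sup>2"
proof -
  have "dsq m w \<le> 4 * sq m w - 2 * (cmod (w m))\<^sup>2" for m
  proof (induction m)
    case (Suc m)
    have "(cmod (w (Suc m) - w m))\<^sup>2 \<le> (cmod (w (Suc m)) + cmod (w m))\<^sup>2"
      by (intro power_mono norm_triangle_ineq4) auto
    also have "\<dots> \<le> 2 * (cmod (w (Suc m)))\<^sup>2 + 2 * (cmod (w m))\<^sup>2"
      using sum_squares_bound[of "cmod (w (Suc m))" "cmod (w m)"] by (simp add: power2_sum)
    finally show ?case using Suc by (simp add: sq_def dsq_def)
  qed (simp_all add: assms sq_def dsq_def)
  then show ?thesis .
qed

text \<open>A weighted Young inequality for the square of \<open>|w_m|\<close> plus the increment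
  lets \<open>eta |w_m|^2\<close> telescope. The gain over \<open>trace_le_sq\<close> is the factor
  \<open>1 + eta\<close>, paid for by a share of the gradient that is small with
  \<open>eta\<close>.\<close>

lemma trace_sq:
  assumes "w 0 = 0" and eta: "eta \<ge> 0" and n: "n > 0"
  shows "(1 + eta) * (cmod (w n))\<^sup>2 \<le> sq n w + (eta + eta\<^sup>2) * dsq n w"
proof -
  have "eta * (cmod (w m))\<^sup>2 \<le> sq m w - (cmod (w m))\<^sup>2 + (eta + eta\<^sup>2) * dsq m w" if "m > 0" for m
    using that
  proof (induction m)
    case (Suc m)
    let ?a = "cmod (w (Suc m))" and ?b = "cmod (w m)" and ?d = "cmod (w (Suc m) - w m)"
    have tri: "?a \<le> ?b + ?d" using norm_triangle_ineq[of "w m" "w (Suc m) - w m"] by simp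
    have "eta * ?a\<^sup>2 \<le> eta * (?b + ?d)\<^sup>2" using tri eta by (intro mult_left_mono power_mono) auto
    also have "\<dots> \<le> eta * ?b\<^sup>2 + ?b\<^sup>2 + (eta + eta\<^sup>2) * ?d\<^sup>2"
      using sum_squares_bound[of ?b "eta * ?d"] by (simp add: power2_sum algebra_simps)
    finally have *: "eta * ?a\<^sup>2 \<le> eta * ?b\<^sup>2 + ?b\<^sup>2 + (eta + eta\<^sup>2) * ?d\<^sup>2" .
    show ?case
    proof (cases "m = 0")
      case True
      then show ?thesis using * assms by (simp add: sq_def dsq_def)
    next
      case False
      then show ?thesis using * Suc by (simp add: sq_def dsq_def algebra_simps)
    qed
  qed simp
  from this[OF n] show ?thesis by (simp add: algebra_simps)
qed

lemma trace_le_sq: "n > 0 \<Longrightarrow> (cmod (w n))\<^sup>2 \<le> sq n w"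
  by (rule norm_le_sq) auto

text \<open>Discrete form of \<open>|w(1)|^2 \<le> 2 |w| |w'|\<close>: differences of squares
  telescope, and Cauchy-Schwarz separates the increments from the values.\<close>

lemma trace_sqrt:
  assumes w0: "w 0 = 0" and n: "n > 0"
  shows "(cmod (w n))\<^sup>2 \<le> 2 * sqrt (sq n w * dsq n w)"
proof -
  have "(cmod (w m))\<^sup>2 \<le> (\<Sum>j=1..m. cmod (w j - w (j - 1)) * (cmod (w j) + cmod (w (j - 1))))" for m
  proof (induction m)
    case (Suc m)
    let ?a = "cmod (w (Suc m))" and ?b = "cmod (w m)" and ?d = "cmod (w (Suc m) - w m)"
    have tri: "?a - ?b \<le> ?d" by (rule norm_triangle_ineq2)
    have "?a\<^sup>2 - ?b\<^sup>2 = (?a - ?b) * (?a + ?b)" by (simp add: algebra_simps power2_eq_square)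
    also have "\<dots> \<le> ?d * (?a + ?b)" using tri by (intro mult_right_mono) auto
    finally show ?case using Suc by simp
  qed (simp add: w0)
  from this[of n] have "(cmod (w n))\<^sup>2 \<le> (\<Sum>j=1..n. \<bar>cmod (w j - w (j - 1))\<bar> * \<bar>cmod (w j) + cmod (w (j - 1))\<bar>)"
    by simp
  also have "\<dots> \<le> L2_set (\<lambda>j. cmod (w j - w (j - 1))) {1..n} * L2_set (\<lambda>j. cmod (w j) + cmod (w (j - 1))) {1..n}"
    by (rule L2_set_mult_ineq)
  also have "L2_set (\<lambda>j. cmod (w j) + cmod (w (j - 1))) {1..n} \<le> sqrt (4 * sq n w)"
    unfolding L2_set_def
  proof (rule real_sqrt_le_mono)
    have "(\<Sum>j=1..m. (cmod (w j) + cmod (w (j - 1)))\<^sup>2) \<le> 4 * sq m w - 2 * (cmod (w m))\<^sup>2" for m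
    proof (induction m)
      case (Suc m)
      have "(cmod (w (Suc m)) + cmod (w m))\<^sup>2 \<le> 2 * (cmod (w (Suc m)))\<^sup>2 + 2 * (cmod (w m))\<^sup>2"
        using sum_squares_bound[of "cmod (w (Suc m))" "cmod (w m)"] by (simp add: power2_sum)
      then show ?case using Suc by (simp add: sq_def)
    qed (simp add: w0 sq_def)
    from this[of n] show "(\<Sum>j=1..n. (cmod (w j) + cmod (w (j - 1)))\<^sup>2) \<le> 4 * sq n w"
      by (smt (verit) zero_le_power2)
  qed
  finally have "(cmod (w n))\<^sup>2 \<le> L2_set (\<lambda>j. cmod (w j - w (j - 1))) {1..n} * sqrt (4 * sq n w)"
    by (metis (no_types, lifting) L2_set_nonneg mult_left_mono order_trans)
  then show ?thesis by (simp add: L2_set_def dsq_def real_sqrt_mult mult_ac)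
qed

section \<open>Energy estimates for the penalty method\<close>

text \<open>The right-hand side \<open>b\<close> is \<open>h\<close> times the load vector.\<close>

locale cip_system =
  fixes n :: nat and t g :: real and w b :: "nat \<Rightarrow> complex"
  assumes n: "n > 0" and t: "t > 0" and g: "g > 0" and w0: "w 0 = 0"
    and row: "\<And>j. 1 \<le> j \<Longrightarrow> j \<le> n \<Longrightarrow>
      stiffness n t w j - \<i> * of_real g * stiffness n t (stiffness n t w) j - (of_real t)\<^sup>2 * mass n w j = b j"
begin

text \<open>\<open>N\<close> and \<open>R\<close> are norms, whereas \<open>Y\<close>,
  \<open>X\<close>, \<open>Aq\<close>, \<open>U\<close> and \<open>Dn\<close> are squares of norms
  or of boundary values. The boundary product with parts \<open>c'\<close> and \<open>s'\<close> is
  the only quantity of unknown sign. In \<open>c\<close>, the stiffness form and the gradient part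
  of the mass form are merged.\<close>

definition "d = stiffness n t w"
definition "N = sqrt (sq n w)"
definition "R = sqrt (sq n b)"
definition "Y = sq n d"
definition "X = dsq n d"
definition "Aq = dsq n w"
definition "U = (cmod (w n))\<^sup>2"
definition "Dn = (cmod (d n))\<^sup>2"
definition "c' = Re (d n * cnj (w n))"
definition "s' = Im (d n * cnj (w n))"
definition "c = 1 + t\<^sup>2 / 6"

lemma d0: "d 0 = 0" by (simp add: d_def stiffness_def)

lemma nn: "N \<ge> 0" "R \<ge> 0" "Y \<ge> 0" "X \<ge> 0" "Aq \<ge> 0" "U \<ge> 0" "Dn \<ge> 0" "c \<ge> 1"
  by (simp_all add: N_def R_def Y_def X_def Aq_def U_def Dn_def c_def sq_nonneg dsq_nonneg)

lemma N2: "N\<^sup>2 = sq n w" by (simp add: N_def sq_nonneg)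

lemma cs: "c'\<^sup>2 + s'\<^sup>2 = U * Dn"
  unfolding c'_def s'_def cmod_power2[symmetric] by (simp add: U_def Dn_def norm_mult power_mult_distrib)

lemma dw: "d n * cnj (w n) = Complex c' s'" unfolding c'_def s'_def by (rule complex_surj[symmetric])

lemma wd: "w n * cnj (d n) = Complex c' (- s')"
  using dw by (metis complex_cnj complex_cnj_cnj complex_cnj_mult mult.commute)

lemma ww: "w n * cnj (w n) = of_real U" "d n * cnj (d n) = of_real Dn"
  unfolding U_def Dn_def complex_norm_square by simp_all

lemma row': "1 \<le> j \<Longrightarrow> j \<le> n \<Longrightarrow> b j = d j - \<i> * of_real g * stiffness n t d j - (of_real t)\<^sup>2 * mass n w j"
  using row by (simp add: d_def)

lemma grad_wd: "(\<Sum>j=1..n. (w j - w (j - 1)) * cnj (d j - d (j - 1))) = of_real Y + \<i> * of_real t * (w n * cnj (d n))"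
  using sum_stiffness[of d n t w, OF d0 n] sq_cnj[of d n] by (simp add: d_def[symmetric] Y_def algebra_simps)

lemma grad_dw: "(\<Sum>j=1..n. (d j - d (j - 1)) * cnj (w j - w (j - 1))) = of_real Y - \<i> * of_real t * (d n * cnj (w n))"
proof -
  have "(\<Sum>j=1..n. (d j - d (j - 1)) * cnj (w j - w (j - 1))) = cnj (\<Sum>j=1..n. (w j - w (j - 1)) * cnj (d j - d (j - 1)))"
    by (simp add: mult.commute)
  then show ?thesis unfolding grad_wd by (simp add: algebra_simps)
qed

lemma sum_dw: "(\<Sum>j=1..n. d j * cnj (w j)) = of_real Aq - \<i> * of_real t * of_real U"
  using sum_stiffness[of w n t w, OF w0 n] dsq_cnj[of w n] ww by (simp add: d_def[symmetric] Aq_def algebra_simps)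

lemma sum_wd: "(\<Sum>j=1..n. w j * cnj (d j)) = of_real Aq + \<i> * of_real t * of_real U"
proof -
  have "(\<Sum>j=1..n. w j * cnj (d j)) = cnj (\<Sum>j=1..n. d j * cnj (w j))" by (simp add: mult.commute)
  then show ?thesis unfolding sum_dw by simp
qed

text \<open>Since \<open>A\<close> is not Hermitian, the boundary product enters twice when
  \<open>A\<close> is moved off \<open>d\<close>; a Hermitian penalty would leave
  \<open>g * Y\<close> alone. As \<open>g > 0\<close>, the terms \<open>t * U\<close> and
  \<open>g * Y\<close> of the imaginary part have the same sign.\<close>

lemma energy_w: "(\<Sum>j=1..n. b j * cnj (w j)) =
   Complex (c * Aq - t\<^sup>2 * (N\<^sup>2 - U / 2) - 2 * g * t * c') (- (t * U + g * Y + 2 * g * t * s'))"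
proof -
  have "(\<Sum>j=1..n. b j * cnj (w j)) = (\<Sum>j=1..n. d j * cnj (w j))
      - \<i> * of_real g * (\<Sum>j=1..n. stiffness n t d j * cnj (w j)) - (of_real t)\<^sup>2 * (\<Sum>j=1..n. mass n w j * cnj (w j))"
    unfolding sum_distrib_left sum_subtractf[symmetric]
    by (rule sum.cong) (auto simp: row' algebra_simps)
  also have "(\<Sum>j=1..n. stiffness n t d j * cnj (w j)) = of_real Y - 2 * \<i> * of_real t * (d n * cnj (w n))"
    unfolding sum_stiffness[of w n t d, OF w0 n] grad_dw by (simp add: algebra_simps)
  also have "(\<Sum>j=1..n. mass n w j * cnj (w j)) = of_real (N\<^sup>2 - U / 2 - Aq / 6)"
    unfolding sum_mass[of w w n, OF w0 w0 n] dsq_cnj sq_cnj[of w n] by (simp add: ww N2 Aq_def)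
  finally show ?thesis unfolding sum_dw dw
    by (simp add: complex_eq_iff c_def power2_eq_square algebra_simps)
qed

text \<open>The imaginary part adds control of \<open>X\<close>, which \<open>energy_w\<close> does
  not see, with the same sign as \<open>t^3 * U\<close>. The negative sign of \<open>Dn\<close> in
  the real part becomes an asset when a multiple of that part is subtracted.\<close>

lemma energy_d: "(\<Sum>j=1..n. b j * cnj (d j)) =
   Complex (c * Y - g * t * Dn - t\<^sup>2 * Aq + t\<^sup>2 * c' / 2 + t^3 * s' / 6)
     (- (g * X + t^3 * U + t\<^sup>2 * s' / 2 - t^3 * c' / 6))"
proof -
  have "(\<Sum>j=1..n. b j * cnj (d j)) = (\<Sum>j=1..n. d j * cnj (d j))
      - \<i> * of_real g * (\<Sum>j=1..n. stiffness n t d j * cnj (d j)) - (of_real t)\<^sup>2 * (\<Sum>j=1..n. mass n w j * cnj (d j))"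
    unfolding sum_distrib_left sum_subtractf[symmetric]
    by (rule sum.cong) (auto simp: row' algebra_simps)
  also have "(\<Sum>j=1..n. stiffness n t d j * cnj (d j)) = of_real X - \<i> * of_real t * of_real Dn"
    unfolding sum_stiffness[of d n t d, OF d0 n] dsq_cnj by (simp add: ww X_def algebra_simps)
  also have "(\<Sum>j=1..n. mass n w j * cnj (d j)) = of_real Aq + \<i> * of_real t * of_real U - Complex c' (- s') / 2
     - (of_real Y + \<i> * of_real t * Complex c' (- s')) / 6"
    unfolding sum_mass[of d w n, OF d0 w0 n] sum_wd grad_wd wd by simp
  finally show ?thesis unfolding sq_cnj Y_def[symmetric]
    by (simp add: complex_eq_iff c_def power2_eq_square power3_eq_cube algebra_simps)
qed

lemma N_sqrt: "sqrt (sq n w) = N" "sqrt (sq n b) = R" "sqrt (sq n d) = sqrt Y"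
  by (simp_all add: N_def R_def Y_def)

lemma energy_w_Im: "t * U + g * Y + 2 * g * t * s' \<le> N * R"
  and energy_w_Re: "\<bar>c * Aq - t\<^sup>2 * (N\<^sup>2 - U / 2) - 2 * g * t * c'\<bar> \<le> N * R"
  and energy_d_Im: "g * X + t^3 * U + t\<^sup>2 * s' / 2 - t^3 * c' / 6 \<le> sqrt Y * R"
  and energy_d_Re: "\<bar>c * Y - g * t * Dn - t\<^sup>2 * Aq + t\<^sup>2 * c' / 2 + t^3 * s' / 6\<bar> \<le> sqrt Y * R"
proof -
  have 1: "cmod (\<Sum>j=1..n. b j * cnj (w j)) \<le> N * R" and 2: "cmod (\<Sum>j=1..n. b j * cnj (d j)) \<le> sqrt Y * R"
    using sum_cauchy[of b w n] sum_cauchy[of b d n] by (simp_all only: N_sqrt mult.commute)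
  show "t * U + g * Y + 2 * g * t * s' \<le> N * R"
    using abs_Im_le_cmod[of "\<Sum>j=1..n. b j * cnj (w j)"] 1 unfolding energy_w by simp
  show "\<bar>c * Aq - t\<^sup>2 * (N\<^sup>2 - U / 2) - 2 * g * t * c'\<bar> \<le> N * R"
    using abs_Re_le_cmod[of "\<Sum>j=1..n. b j * cnj (w j)"] 1 unfolding energy_w by simp
  show "g * X + t^3 * U + t\<^sup>2 * s' / 2 - t^3 * c' / 6 \<le> sqrt Y * R"
    using abs_Im_le_cmod[of "\<Sum>j=1..n. b j * cnj (d j)"] 2 unfolding energy_d by simp
  show "\<bar>c * Y - g * t * Dn - t\<^sup>2 * Aq + t\<^sup>2 * c' / 2 + t^3 * s' / 6\<bar> \<le> sqrt Y * R"
    using abs_Re_le_cmod[of "\<Sum>j=1..n. b j * cnj (d j)"] 2 unfolding energy_d by simp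
qed

lemma Aq_le: "Aq \<le> 4 * (N\<^sup>2 - U / 2)"
  using dsq_le[of w n, OF w0 n] by (simp add: Aq_def N2 U_def)

lemma Dn_le_Y: "Dn \<le> Y" unfolding Dn_def Y_def by (rule trace_le_sq[OF n])

lemma Dn_trace: "eta \<ge> 0 \<Longrightarrow> (1 + eta) * Dn \<le> Y + (eta + eta\<^sup>2) * X"
  unfolding Dn_def Y_def X_def by (rule trace_sq[of d, OF d0 _ n])

lemma Dn_sqrt: "Dn \<le> 2 * sqrt (Y * X)"
  unfolding Dn_def Y_def X_def by (rule trace_sqrt[of d, OF d0 n])

text \<open>Interpolation between \<open>w\<close> and \<open>A w\<close>: the real part of the
  product of \<open>A w\<close> with \<open>w\<close> is the gradient.\<close>

lemma Aq_le_NY: "Aq \<le> N * sqrt Y"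
  using abs_Re_le_cmod[of "\<Sum>j=1..n. d j * cnj (w j)"] sum_cauchy[of d w n] nn(5)
  unfolding sum_dw N_sqrt by (simp add: mult.commute)

lemma X_le_Y: "X \<le> 4 * Y"
  using dsq_le[of d n, OF d0 n] zero_le_power2[of "cmod (d n)"] unfolding X_def Y_def by linarith

end

text \<open>Young's inequality for a boundary product: the hypothesis on \<open>\<gamma>\<close>,
  here any real coefficient and not the penalty, says that the quadratic form with coefficients
  \<open>\<alpha>\<close>, \<open>- \<gamma>\<close>, \<open>\<beta>\<close> is nonnegative.\<close>

lemma discriminant_bound:
  fixes \<alpha> \<beta> \<gamma> :: real
  assumes "\<alpha> \<ge> 0" "\<beta> \<ge> 0" "U \<ge> 0" "V \<ge> 0" "\<gamma>\<^sup>2 \<le> 4 * \<alpha> * \<beta>" "s\<^sup>2 \<le> U * V"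
  shows "\<bar>\<gamma> * s\<bar> \<le> \<alpha> * U + \<beta> * V"
proof (rule abs_le_square_iff[THEN iffD2, THEN order_trans])
  have "(\<gamma> * s)\<^sup>2 \<le> (4 * \<alpha> * \<beta>) * (U * V)"
    unfolding power_mult_distrib using assms by (intro mult_mono) auto
  also have "\<dots> \<le> (\<alpha> * U + \<beta> * V)\<^sup>2"
    using zero_le_power2[of "\<alpha> * U - \<beta> * V"] by (simp add: power2_eq_square algebra_simps)
  finally show "(\<gamma> * s)\<^sup>2 \<le> (\<alpha> * U + \<beta> * V)\<^sup>2" .
  show "\<bar>\<alpha> * U + \<beta> * V\<bar> \<le> \<alpha> * U + \<beta> * V" using assms by simp
qed

section \<open>Absorbing the boundary terms\<close>

context cip_system begin

lemma s_le: "s'\<^sup>2 \<le> U * Dn" and c_le: "c'\<^sup>2 \<le> U * Dn"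
  using cs zero_le_power2[of c'] zero_le_power2[of s'] by linarith+

lemma s_le_Y: "s'\<^sup>2 \<le> U * Y"
  using s_le mult_left_mono[OF Dn_le_Y nn(6)] by linarith

text \<open>Young's inequality splits \<open>g * sqrt Y * R\<close> into half of
  \<open>g * Y\<close>, which goes to the left, and a multiple of \<open>g * R^2\<close>. This puts
  the results of all regimes into one form.\<close>

lemma absorb:
  assumes e: "e > 0" and K: "K \<ge> 0" and main: "e * (g * Y + t * U) \<le> K * (N * R) + K * (g * (sqrt Y * R))"
  shows "g * Y + t * U \<le> (2 * (K / e) + (K / e)\<^sup>2) * (N * R + g * R\<^sup>2)"
proof -
  define L where "L = K / e"
  have L: "L \<ge> 0" using e K by (simp add: L_def)
  have 1: "g * Y + t * U \<le> L * (N * R) + L * (g * (sqrt Y * R))"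
    using main e by (simp add: L_def field_simps)
  have "2 * (L * (sqrt Y * R)) \<le> Y + L\<^sup>2 * R\<^sup>2"
    using zero_le_power2[of "sqrt Y - L * R"] nn(3) by (simp add: power2_diff power_mult_distrib algebra_simps)
  then have "g * (2 * (L * (sqrt Y * R))) \<le> g * (Y + L\<^sup>2 * R\<^sup>2)" using g by (intro mult_left_mono) auto
  then have "2 * (L * (g * (sqrt Y * R))) \<le> g * Y + L\<^sup>2 * (g * R\<^sup>2)" by (simp add: algebra_simps)
  then have 2: "g * Y + 2 * (t * U) \<le> 2 * (L * (N * R)) + L\<^sup>2 * (g * R\<^sup>2)" using 1 by linarith
  have 3: "0 \<le> t * U" "0 \<le> N * R" "0 \<le> g * R\<^sup>2" using nn t g by auto
  have 4: "0 \<le> L\<^sup>2 * (N * R)" "0 \<le> L * (g * R\<^sup>2)" using 3 L by auto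
  have "g * Y + t * U \<le> 2 * L * (N * R) + L\<^sup>2 * (N * R) + (2 * L * (g * R\<^sup>2) + L\<^sup>2 * (g * R\<^sup>2))"
    using 2 3 4 by linarith
  then show ?thesis by (simp add: L_def algebra_simps)
qed

text \<open>The terms in \<open>s'\<close> and \<open>c'\<close> have no sign. In each of four regimes, multiples of the other energy
  (in)equalities are added to \<open>energy_w_Im\<close> until what remains of these terms is covered by \<open>U\<close>, \<open>X\<close> and \<open>Y\<close>.\<close>

lemma regime_small_gt:
  assumes "g * t \<le> 1/2"
  shows "1/4 * (g * Y + t * U) \<le> N * R"
proof -
  \<comment> \<open>Giving up three quarters of both good terms leaves the factor
    \<open>1/4\<close>. The discriminant condition then reads \<open>g t \<le> 9/16\<close>.\<close>
  have "\<bar>2 * g * t * s'\<bar> \<le> (3/4 * t) * U + (3/4 * g) * Y"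
  proof (rule discriminant_bound)
    have "(g * t) * (g * t) \<le> 1/2 * (g * t)" using assms g t by (intro mult_right_mono) auto
    moreover have "0 < g * t" using g t by simp
    ultimately have "(g * t) * (g * t) \<le> 9/16 * (g * t)" by linarith
    then show "(2 * g * t)\<^sup>2 \<le> 4 * (3/4 * t) * (3/4 * g)" by (simp add: power2_eq_square algebra_simps)
  qed (use t g nn s_le_Y in auto)
  then show ?thesis using energy_w_Im by (simp add: algebra_simps abs_le_iff)
qed

text \<open>The multiple \<open>4 g\<close> of \<open>energy_d_Im\<close> supplies
  \<open>4 g^2 X\<close>. As \<open>t^2\<close> and \<open>t^3\<close> are at most \<open>t\<close>,
  all boundary terms together are at most \<open>(2 + 2 + 2/3) g t\<close> times
  \<open>\<sigma>\<close>. Young's inequality splits this between \<open>U\<close> and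
  \<open>Dn\<close>, and \<open>Dn\<close> is interpolated between \<open>Y\<close> and
  \<open>X\<close>.\<close>

lemma regime_small_t:
  assumes "t \<le> 1"
  shows "1/4 * (g * Y + t * U) \<le> N * R + 4 * (g * (sqrt Y * R))"
proof -
  define r where "r = sqrt g"
  have r: "r > 0" "g = r\<^sup>2" using g by (auto simp: r_def)
  have I2': "4 * g\<^sup>2 * X + 4 * g * t^3 * U + 2 * g * t\<^sup>2 * s' - 2/3 * g * t^3 * c' \<le> 4 * (g * (sqrt Y * R))"
    using mult_left_mono[OF energy_d_Im, of "4 * g"] g by (simp add: algebra_simps power2_eq_square power3_eq_cube)
  define \<sigma> where "\<sigma> = sqrt (U * Dn)"
  have \<sigma>: "\<bar>s'\<bar> \<le> \<sigma>" "\<bar>c'\<bar> \<le> \<sigma>" "\<sigma> \<ge> 0" "\<sigma>\<^sup>2 = U * Dn"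
    using s_le c_le nn by (auto simp: \<sigma>_def intro!: real_le_rsqrt)
  have t2: "t\<^sup>2 \<le> t" "t^3 \<le> t"
    using assms t by (auto simp: power2_eq_square power3_eq_cube intro: mult_left_le mult_le_one)
  have a1: "\<bar>2 * g * t * s'\<bar> \<le> 2 * g * t * \<sigma>" using \<sigma> g t by (simp add: abs_mult)
  have a2: "\<bar>2 * g * t\<^sup>2 * s'\<bar> \<le> 2 * g * t * \<sigma>" using \<sigma> g t t2 by (simp add: abs_mult mult_mono)
  have a3: "\<bar>2/3 * g * t^3 * c'\<bar> \<le> 2/3 * g * t * \<sigma>" 
    using mult_mono[OF t2(2) \<sigma>(2)] g t by (simp add: abs_mult mult.commute)
  have "\<bar>(14/3 * g * t) * \<sigma>\<bar> \<le> (3/4 * t + 4 * g * t^3) * U + (17/10 * r^3) * Dn"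
  proof (rule discriminant_bound)
    define z where "z = r * t"
    have z: "z > 0" using r t by (simp add: z_def)
    \<comment> \<open>The point \<open>245/612\<close> is the vertex of the parabola
      \<open>272/10 z^2 - 196/9 z + 51/10\<close>, whose positivity is the discriminant condition
      after division by \<open>r^3 t\<close>.\<close>
    have "0 \<le> (z - 245/612)\<^sup>2" by simp
    then have "196/9 * z \<le> 51/10 + 272/10 * z\<^sup>2" by (simp add: power2_eq_square algebra_simps)
    then have "r^3 * t * (196/9 * z) \<le> r^3 * t * (51/10 + 272/10 * z\<^sup>2)" using r t by (intro mult_left_mono) auto
    then show "(14/3 * g * t)\<^sup>2 \<le> 4 * (3/4 * t + 4 * g * t^3) * (17/10 * r^3)"
      unfolding r z_def by (simp add: power2_eq_square power3_eq_cube algebra_simps)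
  qed (use r t g nn \<sigma> in auto)
  moreover have "(17/10 * r^3) * Dn \<le> 3/4 * g * Y + 4 * g\<^sup>2 * X"
  proof -
    \<comment> \<open>The weight \<open>r^3\<close> is the geometric mean of the available weights
      \<open>g\<close> of \<open>Y\<close> and \<open>g^2\<close> of \<open>X\<close>;
      \<open>17/10\<close> is small enough that its half squared stays below
      \<open>3/4\<close>.\<close>
    have "(17/10 * r^3) * Dn \<le> (17/10 * r^3) * (2 * sqrt (Y * X))"
      using Dn_sqrt r by (intro mult_left_mono) auto
    also have "\<dots> = 2 * (17/20 * (r * sqrt Y)) * (2 * (r\<^sup>2 * sqrt X))"
      by (simp add: real_sqrt_mult power2_eq_square power3_eq_cube)
    also have "\<dots> \<le> (17/20 * (r * sqrt Y))\<^sup>2 + (2 * (r\<^sup>2 * sqrt X))\<^sup>2" by (rule sum_squares_bound)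
    also have "\<dots> = (17/20)\<^sup>2 * (g * Y) + 4 * g\<^sup>2 * X" 
      using nn by (simp add: r(2) power_mult_distrib power_divide)
    also have "\<dots> \<le> 3/4 * g * Y + 4 * g\<^sup>2 * X" using g nn by (simp add: power2_eq_square)
    finally show ?thesis .
  qed
  moreover have "\<bar>(14/3 * g * t) * \<sigma>\<bar> = 2 * g * t * \<sigma> + 2 * g * t * \<sigma> + 2/3 * g * t * \<sigma>"
    using g t \<sigma>(3) by simp
  ultimately show ?thesis using energy_w_Im I2' a1[THEN abs_le_D2] a2[THEN abs_le_D2] a3[THEN abs_le_D1]
    by (simp only: algebra_simps)
qed

text \<open>The inverse inequality turns the indefinite mass term into a multiple of
  \<open>Aq\<close>. What is left bounds \<open>c'\<close> from above without involving
  \<open>N^2\<close>, and can cancel the \<open>c'\<close> term of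
  \<open>energy_d_Im\<close>.\<close>

lemma energy_w_Re_lower: "p \<ge> 0 \<Longrightarrow> p * ((t\<^sup>2 / 4 - c) * Aq + 2 * g * t * c') \<le> p * (N * R)"
proof (rule mult_left_mono)
  have "t\<^sup>2 * (Aq / 4) \<le> t\<^sup>2 * (N\<^sup>2 - U / 2)" using Aq_le by (intro mult_left_mono) auto
  then show "(t\<^sup>2 / 4 - c) * Aq + 2 * g * t * c' \<le> N * R" using energy_w_Re by (simp add: algebra_simps abs_le_iff)
qed

text \<open>The factors \<open>3 g / (2 t)\<close> of \<open>energy_d_Im\<close>, \<open>p = t (1 + 1 / c) / 8\<close> of \<open>energy_w_Re_lower\<close> and \<open>- g / (2 c)\<close> of
  \<open>energy_d_Re\<close> are chosen so that all terms in \<open>c'\<close> cancel and the coefficient of \<open>Aq\<close> is nonnegative.\<close>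

lemma regime_mid:
  assumes t1: "t \<ge> 1" and t2: "t\<^sup>2 \<le> 12" and gt: "g * t \<ge> 1/2"
  shows "1/50 * (g * Y + t * U) \<le> 2 * (N * R) + 2 * (g * (sqrt Y * R))"
proof -
  define ic where "ic = 1 / c"
  have "c \<le> 3" using t2 by (simp add: c_def)
  then have ic: "c * ic = 1" "ic \<le> 1" "ic \<ge> 1/3" "ic > 0" using nn(8) by (auto simp: ic_def field_simps)
  have "ic + t\<^sup>2 * ic / 6 = 1" using ic(1) unfolding c_def by (simp only: distrib_right mult_1 times_divide_eq_left)
  then have "t\<^sup>2 * ic / 6 = 1 - ic" by (metis add_diff_cancel_left')
  then have t2ic: "t\<^sup>2 * ic = 6 * (1 - ic)" by (simp only: divide_eq_eq_numeral1)
  define p where "p = t / 8 * (1 + ic)"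
  have p: "p \<ge> 0" "p \<le> 1"
  proof -
    have "t \<le> 4" by (rule power2_le_imp_le) (use t2 in auto)
    then have "t / 8 * (1 + ic) \<le> 1/2 * 2" using ic(2,4) t by (intro mult_mono) simp_all
    then show "p \<le> 1" by (simp add: p_def)
  qed (use t ic(4) in \<open>simp add: p_def\<close>)
  have NR: "N * R \<ge> 0" "g * (sqrt Y * R) \<ge> 0" using nn g by auto
  have q2: "3/2 * g\<^sup>2 / t * X + 3/2 * g * t\<^sup>2 * U + 3/4 * g * t * s' - 1/4 * g * t\<^sup>2 * c' \<le> 3/2 * (g * (sqrt Y * R))"
  proof -
    have "3/2 * g / t * (g * X + t^3 * U + t\<^sup>2 * s' / 2 - t^3 * c' / 6) \<le> 3/2 * g / t * (sqrt Y * R)"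
      using t g by (intro mult_left_mono energy_d_Im) auto
    also have "\<dots> \<le> 3/2 * g * (sqrt Y * R)"
      using t t1 g nn by (intro mult_right_mono) (auto simp: field_simps)
    also have "3/2 * g / t * (g * X + t^3 * U + t\<^sup>2 * s' / 2 - t^3 * c' / 6)
        = 3/2 * g\<^sup>2 / t * X + 3/2 * g * t\<^sup>2 * U + 3/4 * g * t * s' - 1/4 * g * t\<^sup>2 * c'"
      using t by (simp add: field_simps power2_eq_square power3_eq_cube)
    finally show ?thesis by (simp add: algebra_simps)
  qed
  have q3: "p * (t\<^sup>2 / 4 - c) * Aq + 1/4 * g * t\<^sup>2 * c' + 1/4 * g * t\<^sup>2 * ic * c' \<le> N * R"
  proof -
    have "p * ((t\<^sup>2 / 4 - c) * Aq + 2 * g * t * c') \<le> p * (N * R)" by (rule energy_w_Re_lower[OF p(1)])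
    also have "\<dots> \<le> 1 * (N * R)" using p NR by (intro mult_right_mono) auto
    finally have "p * (t\<^sup>2 / 4 - c) * Aq + p * (2 * g * t * c') \<le> N * R" by (simp only: distrib_left mult.assoc mult_1)
    moreover have "p * (2 * g * t * c') = 1/4 * g * t\<^sup>2 * c' + 1/4 * g * t\<^sup>2 * ic * c'"
      by (simp add: p_def algebra_simps power2_eq_square)
    ultimately show ?thesis by simp
  qed
  have q4: "- 1/2 * g * Y + 1/2 * g\<^sup>2 * t * ic * Dn + 1/2 * g * ic * t\<^sup>2 * Aq - 1/4 * g * t\<^sup>2 * ic * c'
     - 1/12 * g * ic * t^3 * s' \<le> 1/2 * (g * (sqrt Y * R))"
  proof -
    have "g * ic / 2 * (- (c * Y - g * t * Dn - t\<^sup>2 * Aq + t\<^sup>2 * c' / 2 + t^3 * s' / 6)) \<le> g * ic / 2 * (sqrt Y * R)"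
      using energy_d_Re g ic(4) by (intro mult_left_mono) (auto simp: abs_le_iff)
    also have "\<dots> \<le> g / 2 * (sqrt Y * R)" using g ic(2,4) nn(2,3) by (intro mult_right_mono) auto
    also have "g * ic / 2 * (- (c * Y - g * t * Dn - t\<^sup>2 * Aq + t\<^sup>2 * c' / 2 + t^3 * s' / 6))
       = - 1/2 * g * (c * ic) * Y + 1/2 * g\<^sup>2 * t * ic * Dn + 1/2 * g * ic * t\<^sup>2 * Aq - 1/4 * g * t\<^sup>2 * ic * c'
     - 1/12 * g * ic * t^3 * s'"
      by (simp add: algebra_simps power2_eq_square power3_eq_cube)
    finally show ?thesis using ic(1) by simp
  qed
  have "p * (t\<^sup>2 / 4 - c) + 1/2 * g * ic * t\<^sup>2 \<ge> 0"
  proof -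
    have "1/4 * t * ic \<le> 1/2 * g * ic * t\<^sup>2"
      using mult_left_mono[OF gt, of "ic * t / 2"] ic(4) t by (simp add: power2_eq_square algebra_simps)
    moreover have "p * (c - t\<^sup>2 / 4) = t / 8 * ((1 + ic) * (1 - t\<^sup>2 / 12))" by (simp add: p_def c_def)
    \<comment> \<open>Multiplication by \<open>c\<close> makes the left side
      \<open>(c + 1) (1 - t^2 / 12) = 2 - t^4 / 72\<close>.\<close>
    moreover have "(1 + ic) * (1 - t\<^sup>2 / 12) \<le> 2 * ic"
    proof -
      have "(c + 1) * (1 - t\<^sup>2 / 12) = 2 - (t\<^sup>2)\<^sup>2 / 72" by (simp add: c_def power2_eq_square algebra_simps)
      then have "ic * ((c + 1) * (1 - t\<^sup>2 / 12)) \<le> ic * 2" using ic(4) by (intro mult_left_mono) auto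
      moreover have "ic * ((c + 1) * (1 - t\<^sup>2 / 12)) = (c * ic + ic) * (1 - t\<^sup>2 / 12)" by (simp add: algebra_simps)
      ultimately show ?thesis using ic(1) by simp
    qed
    then have "t / 8 * ((1 + ic) * (1 - t\<^sup>2 / 12)) \<le> t / 8 * (2 * ic)" using t by (intro mult_left_mono) auto
    ultimately have "p * (c - t\<^sup>2 / 4) \<le> 1/2 * g * ic * t\<^sup>2" by linarith
    then show ?thesis by (simp add: algebra_simps)
  qed
  then have A0: "(p * (t\<^sup>2 / 4 - c) + 1/2 * g * ic * t\<^sup>2) * Aq \<ge> 0" using nn by simp
  have X0: "3/2 * g\<^sup>2 / t * X \<ge> 0" using t nn by simp
  \<comment> \<open>The total coefficient \<open>2 + 3/4 - t^2 ic / 12\<close> of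
    \<open>g t s'\<close>, rewritten with \<open>t^2 ic = 6 (1 - ic)\<close>.\<close>
  define m where "m = 9/4 + ic / 2"
  have m_s: "2 * g * t * s' + 3/4 * g * t * s' - 1/12 * g * ic * t^3 * s' = (g * t * m) * s'"
  proof -
    have "1/12 * g * ic * t^3 * s' = 1/12 * g * t * (t\<^sup>2 * ic) * s'" by (simp add: power2_eq_square power3_eq_cube)
    then show ?thesis unfolding t2ic by (simp add: m_def algebra_simps)
  qed
  \<comment> \<open>The weights are what the three combined estimates offer, except for
    \<open>1/20\<close> of \<open>t * U\<close> and \<open>1/50\<close> of \<open>g * Y\<close>,
    which are kept: \<open>energy_d_Re\<close> costs half of \<open>g * Y\<close>, and
    \<open>12/25 = 1/2 - 1/50\<close>.\<close>
  have "\<bar>(g * t * m) * s'\<bar> \<le> (19/20 * t + 3/2 * g * t\<^sup>2) * U + (12/25 * g + 1/2 * g\<^sup>2 * t * ic) * Dn"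
  proof (rule discriminant_bound)
    define \<tau> where "\<tau> = g * t"
    have \<tau>: "\<tau> > 0" using g t by (simp add: \<tau>_def)
    have "\<tau> * m\<^sup>2 \<le> 228/125 + \<tau> * (72/25 + 19/10 * ic) + 3 * \<tau>\<^sup>2 * ic"
    proof -
      \<comment> \<open>\<open>B\<close> is the part of the bound \<open>81/16 + 5/2 ic\<close> for
        \<open>m^2\<close> that exceeds the cross term \<open>72/25 + 19/10 ic\<close> of the
        product of the weights; it has to be covered by the two outer terms.\<close>
      define B where "B = 873/400 + 3/5 * ic"
      have "ic\<^sup>2 \<le> ic" using ic(2,4) by (simp add: power2_eq_square mult_left_le)
      then have "m\<^sup>2 \<le> 72/25 + 19/10 * ic + B" unfolding m_def B_def by (simp add: power2_eq_square algebra_simps)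
      then have 1: "\<tau> * m\<^sup>2 \<le> \<tau> * (72/25 + 19/10 * ic + B)" using \<tau> by (intro mult_left_mono) auto
      \<comment> \<open>On the range \<open>1/3 \<le> ic \<le> 1\<close> the square
        \<open>ic^2\<close> lies below its chord \<open>4/3 ic - 1/3\<close>, which makes the
        required bound for \<open>B^2\<close> linear in \<open>ic\<close>.\<close>
      have "(ic - 1/3) * (1 - ic) \<ge> 0" using ic(2,3) by simp
      moreover have "B\<^sup>2 = 762129/160000 + 2619/1000 * ic + 9/25 * (ic * ic)"
        unfolding B_def by (simp add: power2_eq_square algebra_simps)
      moreover have "(ic - 1/3) * (1 - ic) = 4/3 * ic - 1/3 - ic * ic" by (simp add: field_simps)
      ultimately have "B\<^sup>2 \<le> 2736/125 * ic" using ic(3) by linarith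
      then have "\<bar>B * \<tau>\<bar> \<le> 228/125 * 1 + (3 * ic) * \<tau>\<^sup>2"
        by (intro discriminant_bound) (use ic(4) \<tau> in auto)
      then have "B * \<tau> \<le> 228/125 + 3 * ic * \<tau>\<^sup>2" by (simp add: abs_le_iff)
      then show ?thesis using 1 by (simp add: algebra_simps)
    qed
    then have "\<tau> * (\<tau> * m\<^sup>2) \<le> \<tau> * (228/125 + \<tau> * (72/25 + 19/10 * ic) + 3 * \<tau>\<^sup>2 * ic)"
      using \<tau> by (intro mult_left_mono) auto
    then show "(g * t * m)\<^sup>2 \<le> 4 * (19/20 * t + 3/2 * g * t\<^sup>2) * (12/25 * g + 1/2 * g\<^sup>2 * t * ic)"
      unfolding \<tau>_def by (simp add: power2_eq_square algebra_simps)
  qed (use g t ic(4) nn s_le in auto)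
  moreover have "12/25 * g * Dn \<le> 12/25 * g * Y" using Dn_le_Y g by simp
  moreover have "2 * g * t * s' + 3/4 * g * t * s' - 1/12 * g * ic * t^3 * s' \<ge> - \<bar>(g * t * m) * s'\<bar>"
    unfolding m_s by linarith
  ultimately have "1/20 * (t * U) + 1/50 * (g * Y) \<le> 2 * (N * R) + 2 * (g * (sqrt Y * R))"
    using energy_w_Im q2 q3 q4 A0 X0 by (simp add: algebra_simps)
  moreover have "t * U \<ge> 0" using t nn by simp
  ultimately show ?thesis by (simp add: algebra_simps)
qed

text \<open>For \<open>t\<^sup>2 \<ge> 12\<close> the coefficient \<open>t\<^sup>2 / 4 - c\<close> of \<open>Aq\<close> is nonnegative, so \<open>energy_d_Re\<close> can be dispensed with.
  The factor \<open>4 g / t\<close> of \<open>energy_d_Im\<close> makes the discriminant condition for the \<open>s'\<close> term an equality,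
  and \<open>t / 3\<close> cancels the \<open>c'\<close> term; the missing part of \<open>g Y\<close> comes from the trace inequality.\<close>

lemma regime_large_t:
  assumes t2: "t\<^sup>2 \<ge> 12" and tT: "t \<le> T" and gt: "g * t \<ge> 1/2"
  shows "1 / (2 * T\<^sup>2) * (g * Y + t * U) \<le> (1 + T) * (N * R) + 4 * (g * (sqrt Y * R))"
proof -
  have t1: "t \<ge> 1" using t2 t by (smt (verit) power_le_one)
  then have T1: "T \<ge> 1" using tT by simp
  have NR: "N * R \<ge> 0" using nn by auto
  have q2: "4 * g\<^sup>2 / t * X + 4 * g * t\<^sup>2 * U + 2 * g * t * s' - 2/3 * g * t\<^sup>2 * c' \<le> 4 * (g * (sqrt Y * R))"
  proof -
    have "4 * g / t * (g * X + t^3 * U + t\<^sup>2 * s' / 2 - t^3 * c' / 6) \<le> 4 * g / t * (sqrt Y * R)"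
      using t g by (intro mult_left_mono energy_d_Im) auto
    also have "\<dots> \<le> 4 * g * (sqrt Y * R)"
      using t t1 g nn by (intro mult_right_mono) (auto simp: field_simps)
    also have "4 * g / t * (g * X + t^3 * U + t\<^sup>2 * s' / 2 - t^3 * c' / 6)
        = 4 * g\<^sup>2 / t * X + 4 * g * t\<^sup>2 * U + 2 * g * t * s' - 2/3 * g * t\<^sup>2 * c'"
      using t by (simp add: field_simps power2_eq_square power3_eq_cube)
    finally show ?thesis by (simp add: algebra_simps)
  qed
  have q3: "2/3 * g * t\<^sup>2 * c' \<le> T * (N * R)"
  proof -
    have "t / 3 * (2 * g * t * c') \<le> t / 3 * ((t\<^sup>2 / 4 - c) * Aq + 2 * g * t * c')"
      using t t2 nn by (intro mult_left_mono) (auto simp: c_def)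
    also have "\<dots> \<le> t / 3 * (N * R)" using t by (intro energy_w_Re_lower) simp
    also have "\<dots> \<le> T * (N * R)" using t tT NR by (intro mult_right_mono) auto
    finally show ?thesis by (simp add: power2_eq_square algebra_simps)
  qed
  \<comment> \<open>Chosen so that \<open>eta + eta^2 \<le> 2 / t^2 \<le> 4 g / t\<close>, the
    weight with which \<open>X\<close> is available; the second inequality is
    \<open>g t \<ge> 1/2\<close>.\<close>
  define eta where "eta = 1 / T\<^sup>2"
  have eta: "eta > 0" "eta \<le> 1" using T1 by (auto simp: eta_def)
  have "eta + eta\<^sup>2 \<le> 2 * eta" using eta by (simp add: power2_eq_square mult_left_le)
  also have "\<dots> \<le> 2 / t\<^sup>2" using t tT by (auto simp: eta_def intro!: divide_left_mono power_mono)
  also have "\<dots> \<le> 4 * g / t" using gt t by (simp add: field_simps power2_eq_square)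
  finally have eX: "g * ((eta + eta\<^sup>2) * X) \<le> 4 * g\<^sup>2 / t * X"
    using g nn mult_right_mono[of "eta + eta\<^sup>2" "4 * g / t" "g * X"] by (simp add: power2_eq_square algebra_simps)
  \<comment> \<open>For \<open>0 \<le> eta \<le> 1\<close> the product
    \<open>(1 - eta / 2) (1 + eta)\<close> is at least 1, so the trace inequality frees the share
    \<open>eta / 2\<close> of \<open>g * Y\<close>.\<close>
  have "1 * Dn \<le> ((1 - eta / 2) * (1 + eta)) * Dn"
    using eta nn(7) by (intro mult_right_mono) (simp_all add: algebra_simps power2_eq_square mult_left_le)
  also have "\<dots> = (1 - eta / 2) * ((1 + eta) * Dn)" by simp
  also have "\<dots> \<le> (1 - eta / 2) * (Y + (eta + eta\<^sup>2) * X)"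
    using eta by (intro mult_left_mono Dn_trace) auto
  also have "\<dots> \<le> (1 - eta / 2) * Y + (eta + eta\<^sup>2) * X"
    using eta nn(4) mult_right_mono[of "1 - eta / 2" 1 "(eta + eta\<^sup>2) * X"] by (simp add: algebra_simps)
  finally have "g * Dn \<le> g * ((1 - eta / 2) * Y + (eta + eta\<^sup>2) * X)" using g by simp
  then have D: "g * Dn \<le> g * Y - eta / 2 * (g * Y) + 4 * g\<^sup>2 / t * X" using eX by (simp add: algebra_simps)
  have "\<bar>(4 * g * t) * s'\<bar> \<le> (4 * g * t\<^sup>2) * U + g * Dn"
    by (rule discriminant_bound) (use g t nn s_le in \<open>auto simp: power2_eq_square\<close>)
  then have "t * U + eta / 2 * (g * Y) \<le> (1 + T) * (N * R) + 4 * (g * (sqrt Y * R))"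
    using energy_w_Im q2 q3 D by (simp add: algebra_simps abs_le_iff)
  moreover have "eta / 2 * (t * U) \<le> 1 * (t * U)" using eta nn t by (intro mult_right_mono) auto
  ultimately show ?thesis by (simp add: eta_def algebra_simps)
qed

text \<open>The four regimes cover all \<open>t\<close> and \<open>g\<close>. The factor
  \<open>e\<close> is below each of their left-hand constants (\<open>1/4\<close>,
  \<open>1/50\<close>, \<open>1 / (2 T^2)\<close>) and \<open>K\<close> above all right-hand ones,
  so that the final constant depends on \<open>T\<close> only.\<close>

lemma key_bound:
  assumes tT: "t \<le> T" and T: "T \<ge> 1"
  shows "g * Y + t * U \<le> (200 * (1 + T) * T\<^sup>2)\<^sup>2 * (N * R + g * R\<^sup>2)"
proof -
  define e K where "e = 1 / (50 * T\<^sup>2)" and "K = 2 * (1 + T)"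
  have T2: "T\<^sup>2 \<ge> 1" using T by (simp add: power2_eq_square mult_ge1_I)
  have e: "e > 0" "e \<le> 1/50" "e \<le> 1/4" "e \<le> 1 / (2 * T\<^sup>2)" 
  proof -
    have "1 / (50 * T\<^sup>2) \<le> 1 / (50 * 1)" using T2 by (intro divide_left_mono) auto
    then show "e \<le> 1/50" "e \<le> 1/4" by (simp_all add: e_def)
    show "e > 0" using T by (simp add: e_def)
    show "e \<le> 1 / (2 * T\<^sup>2)" unfolding e_def using T by (intro divide_left_mono) auto
  qed
  have K: "K \<ge> 4" "K \<ge> 1 + T" using T by (auto simp: K_def)
  have NR: "N * R \<ge> 0" "g * (sqrt Y * R) \<ge> 0" "g * Y + t * U \<ge> 0" using nn g t by auto
  have step: "e * (g * Y + t * U) \<le> K * (N * R) + K * (g * (sqrt Y * R))"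
    if "e1 * (g * Y + t * U) \<le> k1 * (N * R) + k2 * (g * (sqrt Y * R))" "e \<le> e1" "k1 \<le> K" "k2 \<le> K" for e1 k1 k2
    using mult_right_mono[OF that(2) NR(3)] mult_right_mono[OF that(3) NR(1)] mult_right_mono[OF that(4) NR(2)] that(1)
    by linarith
  have "e * (g * Y + t * U) \<le> K * (N * R) + K * (g * (sqrt Y * R))"
  proof -
    consider "g * t \<le> 1/2" | "t \<le> 1" | "t \<ge> 1" "t\<^sup>2 \<le> 12" "g * t \<ge> 1/2" | "t\<^sup>2 \<ge> 12" "g * t \<ge> 1/2" by linarith
    then show ?thesis
    proof cases
      case 1 then show ?thesis using step[of "1/4" 1 0] regime_small_gt e K T by simp
    next
      case 2 then show ?thesis using step[of "1/4" 1 4] regime_small_t e K T by simp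
    next
      case 3 then show ?thesis using step[of "1/50" 2 2] regime_mid e K T by simp
    next
      case 4 then show ?thesis using step[OF regime_large_t[OF 4(1) tT 4(2)]] e K T by simp
    qed
  qed
  then have *: "g * Y + t * U \<le> (2 * (K / e) + (K / e)\<^sup>2) * (N * R + g * R\<^sup>2)"
    using absorb[OF e(1)] K by simp
  have Ke: "K / e = 100 * (1 + T) * T\<^sup>2" using T by (simp add: K_def e_def)
  have "1 * 1 \<le> (1 + T) * T\<^sup>2" using T T2 by (intro mult_mono) auto
  then have "K / e \<ge> 1" unfolding Ke by linarith
  moreover have "2 * L + L\<^sup>2 \<le> (2 * L)\<^sup>2" if "L \<ge> 1" for L :: real
    using mult_right_mono[OF that, of L] that by (simp add: power2_eq_square)
  ultimately have "2 * (K / e) + (K / e)\<^sup>2 \<le> (2 * (K / e))\<^sup>2" by blast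
  also have "\<dots> = (200 * (1 + T) * T\<^sup>2)\<^sup>2" unfolding Ke by (simp only: mult.assoc[symmetric]) simp
  finally have c: "2 * (K / e) + (K / e)\<^sup>2 \<le> (200 * (1 + T) * T\<^sup>2)\<^sup>2" .
  have "0 \<le> N * R + g * R\<^sup>2" using nn g by auto
  with c * show ?thesis by (meson mult_right_mono order_trans)
qed

end

section \<open>A direct bound on \<open>A w\<close> for weak penalties\<close>

lemma sum_cauchy_grad:
  "cmod (\<Sum>j=1..n. (w j - w (j - 1)) * cnj (v j - v (j - 1))) \<le> sqrt (dsq n w) * sqrt (dsq n v)"
  using sum_cauchy[of "\<lambda>j. w j - w (j - 1)" "\<lambda>j. v j - v (j - 1)" n] by (simp add: sq_def dsq_def)

lemma mass_bound:
  assumes "v 0 = 0" "w 0 = 0" "n > 0"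
  shows "cmod (\<Sum>j=1..n. mass n w j * cnj (v j)) \<le> 3 * (sqrt (sq n w) * sqrt (sq n v))"
proof -
  define a b where "a = sqrt (sq n w)" and "b = sqrt (sq n v)"
  have dsq4: "sqrt (dsq n z) \<le> 2 * sqrt (sq n z)" if "z 0 = 0" for z
  proof -
    have "dsq n z \<le> 4 * sq n z"
      using dsq_le[of z n, OF that assms(3)] zero_le_power2[of "cmod (z n)"] by linarith
    then show ?thesis by (intro real_le_lsqrt) (auto simp: sq_nonneg power_mult_distrib)
  qed
  define p q r where "p = (\<Sum>j=1..n. w j * cnj (v j))" and "q = w n * cnj (v n)"
    and "r = (\<Sum>j=1..n. (w j - w (j - 1)) * cnj (v j - v (j - 1)))"
  have r: "cmod r \<le> (2 * a) * (2 * b)"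
    unfolding a_def b_def r_def using dsq4[of v, OF assms(1)] dsq4[of w, OF assms(2)]
    by (intro order_trans[OF sum_cauchy_grad] mult_mono) (auto simp: sq_nonneg dsq_nonneg)
  have p: "cmod p \<le> a * b" unfolding a_def b_def p_def by (rule sum_cauchy)
  have q: "cmod q \<le> a * b"
    unfolding norm_mult complex_mod_cnj a_def b_def q_def
    by (intro mult_mono real_le_rsqrt norm_le_sq) (use assms in \<open>auto simp: sq_nonneg\<close>)
  have "cmod (p - q / 2 - r / 6) \<le> cmod p + cmod q / 2 + cmod r / 6"
    using norm_triangle_ineq4[of "p - q / 2" "r / 6"] norm_triangle_ineq4[of p "q / 2"]
    by (simp add: norm_divide)
  also have "\<dots> \<le> 3 * (a * b)"
  proof -
    have "a * b \<ge> 0" by (simp add: a_def b_def sq_nonneg)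
    then show ?thesis using p q r by simp
  qed
  finally show ?thesis unfolding sum_mass[of v w n, OF assms] a_def b_def p_def q_def r_def .
qed

context cip_system begin

text \<open>Here the mass term counts as part of the load instead of being expanded as in
  \<open>energy_d\<close>, so that only \<open>Dn\<close> remains as a boundary quantity.\<close>

lemma energy_d': "(\<Sum>j=1..n. b j * cnj (d j)) + (of_real t)\<^sup>2 * (\<Sum>j=1..n. mass n w j * cnj (d j)) =
   Complex (Y - g * t * Dn) (- (g * X))"
proof -
  have "(\<Sum>j=1..n. b j * cnj (d j)) + (of_real t)\<^sup>2 * (\<Sum>j=1..n. mass n w j * cnj (d j))
     = (\<Sum>j=1..n. d j * cnj (d j)) - \<i> * of_real g * (\<Sum>j=1..n. stiffness n t d j * cnj (d j))"
    unfolding sum_distrib_left sum_subtractf[symmetric] sum.distrib[symmetric]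
    by (rule sum.cong) (auto simp: row' algebra_simps)
  also have "(\<Sum>j=1..n. stiffness n t d j * cnj (d j)) = of_real X - \<i> * of_real t * of_real Dn"
    unfolding sum_stiffness[of d n t d, OF d0 n] dsq_cnj by (simp add: ww X_def algebra_simps)
  finally show ?thesis unfolding sq_cnj Y_def[symmetric] by (simp add: complex_eq_iff)
qed

text \<open>The only bad term is \<open>g t Dn\<close>. By \<open>Dn_sqrt\<close> and
  \<open>g t^2 \<le> 1\<close> it is at most \<open>Y / 4 + 4 g X\<close>, and the imaginary part of
  \<open>energy_d'\<close> controls \<open>g X\<close>. Unlike in \<open>key_bound\<close>, no
  division by \<open>g\<close> is needed to bound \<open>Y\<close>.\<close>

lemma Y_bound_direct:
  assumes "g * t\<^sup>2 \<le> 1"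
  shows "sqrt Y \<le> 7 * (R + 3 * t\<^sup>2 * N)"
proof -
  define Q where "Q = R + 3 * t\<^sup>2 * N"
  have Q: "Q \<ge> 0" using nn by (simp add: Q_def)
  let ?S = "(\<Sum>j=1..n. b j * cnj (d j)) + (of_real t)\<^sup>2 * (\<Sum>j=1..n. mass n w j * cnj (d j))"
  have "cmod ?S \<le> sqrt Y * R + t\<^sup>2 * (3 * (N * sqrt Y))"
    using sum_cauchy[of b d n] mult_left_mono[OF mass_bound[of d w n, OF d0 w0 n], of "t\<^sup>2"]
    unfolding N_sqrt
    by (intro order_trans[OF norm_triangle_ineq] add_mono) (simp_all add: norm_mult norm_power mult.commute)
  then have S: "cmod ?S \<le> Q * sqrt Y" by (simp add: Q_def algebra_simps)
  have 1: "Y - g * t * Dn \<le> Q * sqrt Y" using abs_Re_le_cmod[of ?S] S unfolding energy_d' by simp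
  have 2: "g * X \<le> Q * sqrt Y" using abs_Im_le_cmod[of ?S] S nn g unfolding energy_d' by simp
  have "g * t * Dn \<le> g * t * (2 * sqrt (Y * X))" using Dn_sqrt g t by simp
  also have "\<dots> = (sqrt g * t) * (2 * (1 / 2 * sqrt Y) * (2 * (sqrt g * sqrt X)))"
    using g by (simp add: real_sqrt_mult)
  also have "\<dots> \<le> 1 * (2 * (1 / 2 * sqrt Y) * (2 * (sqrt g * sqrt X)))"
  proof (rule mult_right_mono)
    have "sqrt (g * t\<^sup>2) \<le> 1" using assms by simp
    then show "sqrt g * t \<le> 1" using t by (simp add: real_sqrt_mult)
  qed (use nn g in auto)
  also have "\<dots> \<le> (1/2 * sqrt Y)\<^sup>2 + (2 * (sqrt g * sqrt X))\<^sup>2" by (simp only: mult_1 sum_squares_bound)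
  also have "\<dots> = 1/4 * Y + 4 * (g * X)" using nn g by (simp add: power_mult_distrib power_divide)
  finally have "3/4 * Y \<le> 5 * (Q * sqrt Y)" using 1 2 by linarith
  then have *: "sqrt Y * sqrt Y \<le> (20/3 * Q) * sqrt Y" using nn by simp
  have "sqrt Y \<le> 20/3 * Q"
  proof (cases "Y = 0")
    case False
    then have "sqrt Y > 0" using nn(3) by simp
    then show ?thesis by (rule mult_right_le_imp_le[OF *])
  qed (use Q in simp)
  then have "sqrt Y \<le> 7 * Q" using Q by linarith
  then show ?thesis unfolding Q_def .
qed

end

section \<open>Stability of the unpenalised method\<close>

text \<open>If \<open>\<omega>\<close> and its conjugate are the roots of the characteristic polynomial, then \<open>e\<^sub>m\<^sub>+\<^sub>1 - \<omega> e\<^sub>m\<close> satisfies a first-order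
  recurrence with a factor of modulus one.\<close>

lemma first_order_factor:
  fixes e r :: "nat \<Rightarrow> complex" and \<omega> :: complex
  assumes \<omega>: "\<omega> * cnj \<omega> = 1" and e0: "e 0 = 0"
    and rec: "\<And>j. 1 \<le> j \<Longrightarrow> j < n \<Longrightarrow> e (j + 1) = (\<omega> + cnj \<omega>) * e j - e (j - 1) - r j"
    and m: "m < n"
  shows "cmod (e (m + 1) - \<omega> * e m) \<le> cmod (e 1) + (\<Sum>j=1..m. cmod (r j))"
    and "cmod (e 1) \<le> cmod (e (m + 1) - \<omega> * e m) + (\<Sum>j=1..m. cmod (r j))"
proof -
  have w1: "cmod \<omega> = 1" using \<omega> by (metis complex_mod_mult_cnj norm_one norm_ge_zero abs_of_nonneg power2_eq_1_iff abs_1 norm_minus_cancel power2_eq_square real_sqrt_abs real_sqrt_one)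
  have "cmod (e (m + 1) - \<omega> * e m) \<le> cmod (e 1) + (\<Sum>j=1..m. cmod (r j)) \<and>
     cmod (e 1) \<le> cmod (e (m + 1) - \<omega> * e m) + (\<Sum>j=1..m. cmod (r j))"
    using m
  proof (induction m)
    case (Suc m)
    define P where "P = e (m + 1) - \<omega> * e m"
    have *: "e (Suc m + 1) - \<omega> * e (Suc m) = cnj \<omega> * P - r (Suc m)"
    proof -
      have "e (Suc m + 1) = (\<omega> + cnj \<omega>) * e (Suc m) - e m - r (Suc m)" using rec[of "Suc m"] Suc.prems by simp
      moreover have "cnj \<omega> * P = cnj \<omega> * e (Suc m) - (\<omega> * cnj \<omega>) * e m" by (simp add: P_def algebra_simps)
      ultimately show ?thesis unfolding \<omega> by (simp only: distrib_right mult_1) simp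
    qed
    have c: "cmod (cnj \<omega> * P) = cmod P" by (simp add: norm_mult w1)
    have "cmod (cnj \<omega> * P - r (Suc m)) \<le> cmod P + cmod (r (Suc m))"
      using norm_triangle_ineq4[of "cnj \<omega> * P" "r (Suc m)"] c by simp
    moreover have "cmod P - cmod (r (Suc m)) \<le> cmod (cnj \<omega> * P - r (Suc m))"
      using norm_triangle_ineq2[of "cnj \<omega> * P" "r (Suc m)"] c by simp
    ultimately show ?case using Suc unfolding * P_def by simp
  qed (simp add: e0)
  then show "cmod (e (m + 1) - \<omega> * e m) \<le> cmod (e 1) + (\<Sum>j=1..m. cmod (r j))"
    and "cmod (e 1) \<le> cmod (e (m + 1) - \<omega> * e m) + (\<Sum>j=1..m. cmod (r j))" by auto
qed

text \<open>Both first-order factors are bounded by \<open>|e 1|\<close> plus the l1 norm of the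
  load, and a combination of them with unimodular coefficients is \<open>2 s\<close> times the nodal
  value up to a unimodular factor. Running the recurrence back from the Robin row bounds
  \<open>|e 1|\<close> by a small multiple of \<open>a |e n|\<close>, where
  \<open>a = t / c\<close>, so that the argument closes.\<close>

lemma fem_stability:
  fixes e r :: "nat \<Rightarrow> complex"
  assumes n: "n > 0" and t: "0 < t" "t \<le> 1" and e0: "e 0 = 0"
    and row: "\<And>j. 1 \<le> j \<Longrightarrow> j \<le> n \<Longrightarrow> stiffness n t e j - (of_real t)\<^sup>2 * mass n e j = r j"
    and j: "j \<le> n"
  shows "cmod (e j) \<le> 3 / t * (\<Sum>j=1..n. cmod (r j))"
proof -
  define c where "c = 1 + t\<^sup>2 / 6"
  have t2: "t\<^sup>2 \<le> 1" "t\<^sup>2 > 0" using t by (auto simp: power_le_one)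
  have c: "c \<ge> 1" "c \<le> 7/6" using t2 by (simp_all add: c_def)
  then have "c > 0" by simp
  note c = c this
  \<comment> \<open>Cosine and sine of the discrete wave number times \<open>h\<close>:
    \<open>2 C\<close> is the middle coefficient \<open>2 (1 - t^2 / 3) / c\<close> of the
    recurrence.\<close>
  define C s where "C = 1 - t\<^sup>2 / (2 * c)" and "s = t / c * sqrt (1 - t\<^sup>2 / 12)"
  define \<omega> where "\<omega> = Complex C s"
  define \<sigma> where "\<sigma> = (\<Sum>j=1..n. cmod (r j))"
  have s: "s \<ge> 9/10 * (t / c)" "s \<le> t / c" "s > 0"
  proof -
    have "9/10 \<le> sqrt (1 - t\<^sup>2 / 12)" by (rule real_le_rsqrt) (use t2 in \<open>simp add: power2_eq_square\<close>)
    moreover have "sqrt (1 - t\<^sup>2 / 12) \<le> 1" using t2 by simp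
    moreover have tc: "t / c > 0" using t c by simp
    ultimately have "t / c * (9/10) \<le> s" "s \<le> t / c * 1"
      unfolding s_def by (simp_all only: mult_left_mono less_imp_le)
    then show 1: "s \<ge> 9/10 * (t / c)" and "s \<le> t / c" by (simp_all only: mult.commute mult_1)
    have "9/10 * (t / c) > 0" using tc by (rule mult_pos_pos[rotated]) simp
    then show "s > 0" using 1 by linarith
  qed
  have Cs: "C\<^sup>2 + s\<^sup>2 = 1"
  proof -
    have t2c: "t\<^sup>2 = 6 * (c - 1)" by (simp add: c_def)
    have "s\<^sup>2 = t\<^sup>2 / c\<^sup>2 * (1 - t\<^sup>2 / 12)" using t2 by (simp add: s_def power_mult_distrib power_divide)
    then have 1: "s\<^sup>2 = 6 * (c - 1) / c\<^sup>2 * (1 - (c - 1) / 2)" unfolding t2c by simp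
    have "C = 3 / c - 2" unfolding C_def t2c using c(3) by (simp add: field_simps)
    then have "C\<^sup>2 = 9 / c\<^sup>2 - 12 / c + 4" by (simp add: power2_diff power_divide)
    then show ?thesis unfolding 1 using c(3) by (simp add: field_simps power2_eq_square)
  qed
  have \<omega>: "\<omega> * cnj \<omega> = 1" "\<omega> + cnj \<omega> = of_real (2 * C)"
    using Cs by (simp_all add: \<omega>_def complex_eq_iff power2_eq_square)
  have w1: "cmod \<omega> = 1" using Cs by (simp add: \<omega>_def complex_norm)
  have rec: "e (i + 1) = of_real (2 * C) * e i - e (i - 1) - r i / of_real c" if i: "1 \<le> i" "i < n" for i
  proof -
    have "of_real c * (e (i + 1)) = (2 * of_real c - (of_real t)\<^sup>2) * e i - of_real c * e (i - 1) - r i"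
      using row[of i] i by (simp add: stiffness_def mass_def c_def field_simps)
    then have "e (i + 1) = ((2 * of_real c - (of_real t)\<^sup>2) * e i - of_real c * e (i - 1) - r i) / of_real c"
      using c(3) by (simp add: field_simps)
    also have "\<dots> = of_real (2 * C) * e i - e (i - 1) - r i / of_real c"
      using c(3) by (simp add: C_def field_simps)
    finally show ?thesis .
  qed
  have rc: "cmod (r i / of_real c) \<le> cmod (r i)" for i
    using c mult_left_mono[of 1 c "cmod (r i)"] by (simp add: norm_divide divide_le_eq)
  have sr: "(\<Sum>i=1..m. cmod (r i / of_real c)) \<le> (\<Sum>i=1..m. cmod (r i))" for m by (intro sum_mono rc)
  have P: "cmod (e (m + 1) - \<omega> * e m) \<le> cmod (e 1) + (\<Sum>j=1..m. cmod (r j))"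
     "cmod (e 1) \<le> cmod (e (m + 1) - \<omega> * e m) + (\<Sum>j=1..m. cmod (r j))"
     "cmod (e (m + 1) - cnj \<omega> * e m) \<le> cmod (e 1) + (\<Sum>j=1..m. cmod (r j))" if m: "m < n" for m
  proof -
    have rec1: "e (i + 1) = (\<omega> + cnj \<omega>) * e i - e (i - 1) - r i / of_real c" if "1 \<le> i" "i < n" for i
      unfolding \<omega>(2) using that by (rule rec)
    have rec2: "e (i + 1) = (cnj \<omega> + cnj (cnj \<omega>)) * e i - e (i - 1) - r i / of_real c" if "1 \<le> i" "i < n" for i
      using rec1[OF that] by (simp add: add.commute)
    have \<omega>': "cnj \<omega> * cnj (cnj \<omega>) = 1" using \<omega>(1) by (simp add: mult.commute)
    note * = first_order_factor[where r = "\<lambda>i. r i / of_real c", OF \<omega>(1) e0 rec1 m]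
      first_order_factor(1)[where r = "\<lambda>i. r i / of_real c", OF \<omega>' e0 rec2 m]
    show "cmod (e (m + 1) - \<omega> * e m) \<le> cmod (e 1) + (\<Sum>j=1..m. cmod (r j))"
      using *(1) sr[of m] by linarith
    show "cmod (e 1) \<le> cmod (e (m + 1) - \<omega> * e m) + (\<Sum>j=1..m. cmod (r j))"
      using *(2) sr[of m] by linarith
    show "cmod (e (m + 1) - cnj \<omega> * e m) \<le> cmod (e 1) + (\<Sum>j=1..m. cmod (r j))"
      using *(3) sr[of m] by linarith
  qed
  have \<sigma>m: "(\<Sum>j=1..m. cmod (r j)) \<le> \<sigma>" if "m \<le> n" for m
    unfolding \<sigma>_def using that by (intro sum_mono2) auto
  have es: "s * cmod (e i) \<le> cmod (e 1) + \<sigma>" if i: "i \<le> n" for i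
  proof (cases i)
    case (Suc m)
    define A B where "A = e (m + 1) - \<omega> * e m" and "B = e (m + 1) - cnj \<omega> * e m"
    have "cnj \<omega> - \<omega> = - (2 * \<i> * of_real s)" by (simp add: \<omega>_def complex_eq_iff)
    then have "cmod (cnj \<omega> - \<omega>) = 2 * s" using s(3) by (simp add: norm_mult)
    then have "2 * s * cmod (e (m + 1)) = cmod ((cnj \<omega> - \<omega>) * e (m + 1))" by (simp only: norm_mult)
    also have "(cnj \<omega> - \<omega>) * e (m + 1) = cnj \<omega> * A - \<omega> * B"
      by (simp add: A_def B_def algebra_simps)
    also have "cmod \<dots> \<le> cmod (cnj \<omega> * A) + cmod (\<omega> * B)" by (rule norm_triangle_ineq4)
    also have "\<dots> = cmod A + cmod B" by (simp add: norm_mult w1)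
    finally have "2 * s * cmod (e (m + 1)) \<le> cmod (e (m + 1) - \<omega> * e m) + cmod (e (m + 1) - cnj \<omega> * e m)"
      by (simp only: A_def B_def)
    then show ?thesis using P[of m] \<sigma>m[of m] i Suc by simp
  qed (simp add: e0 \<sigma>_def sum_nonneg)
  obtain m where m: "n = Suc m" using n by (cases n) auto
  have "e (n - 1) = (of_real C - \<i> * of_real (t / c)) * e n - r n / of_real c"
  proof -
    have rn: "r n = e n - e (n - 1) - \<i> * of_real t * e n - (of_real t)\<^sup>2 * ((e (n - 1) + 2 * e n) / 6)"
      using row[of n] n by (simp add: stiffness_def mass_def)
    have "of_real c * e (n - 1) = (of_real c - (of_real t)\<^sup>2 / 2) * e n - \<i> * of_real t * e n - r n"
      unfolding rn c_def by (simp add: field_simps)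
    also have "of_real c - (of_real t)\<^sup>2 / 2 = of_real c * complex_of_real C"
    proof -
      have "c * C = c - t\<^sup>2 / 2" unfolding C_def using c(3) by (simp add: field_simps)
      then have "complex_of_real (c * C) = of_real (c - t\<^sup>2 / 2)" by (simp only:)
      then show ?thesis by simp
    qed
    also have "complex_of_real t = of_real c * of_real (t / c)" using c(3) by simp
    also have "r n = of_real c * (r n / of_real c)" using c(3) by simp
    also have "of_real c * complex_of_real C * e n - \<i> * (of_real c * of_real (t / c)) * e n - of_real c * (r n / of_real c)
        = of_real c * ((of_real C - \<i> * of_real (t / c)) * e n - r n / of_real c)"
      by (simp only: algebra_simps)
    finally show ?thesis using c(3) by (simp only: mult_cancel_left of_real_eq_0_iff) simp
  qed
  note en = this
  \<comment> \<open>The Robin row is the condition \<open>e n = \<omega> e (n - 1)\<close> for an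
    outgoing discrete wave, up to the load and to the mismatch \<open>t / c - s\<close>, which is at
    most a tenth of \<open>t / c\<close>.\<close>
  have C\<omega>: "of_real C = cnj \<omega> + \<i> * of_real s" by (simp add: \<omega>_def complex_eq_iff)
  define Z where "Z = \<i> * of_real (s - t / c) * e n - r n / of_real c"
  have "e (n - 1) = cnj \<omega> * e n + Z" unfolding en C\<omega> Z_def by (simp only: of_real_diff) (simp add: algebra_simps)
  then have "e n - \<omega> * e (n - 1) = e n - \<omega> * (cnj \<omega> * e n + Z)" by (simp only:)
  also have "\<dots> = (1 - \<omega> * cnj \<omega>) * e n - \<omega> * Z" by (simp only: algebra_simps mult_1)
  also have "\<dots> = - (\<omega> * Z)" unfolding \<omega>(1) by simp
  finally have "cmod (e n - \<omega> * e (n - 1)) = cmod Z" by (simp add: norm_mult w1)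
  also have "\<dots> \<le> cmod (\<i> * of_real (s - t / c) * e n) + cmod (r n / of_real c)"
    unfolding Z_def by (rule norm_triangle_ineq4)
  also have "cmod (\<i> * of_real (s - t / c) * e n) = (t / c - s) * cmod (e n)"
    using s(2) by (simp only: norm_mult norm_of_real norm_ii mult_1) simp
  finally have "cmod (e n - \<omega> * e (n - 1)) \<le> (t / c - s) * cmod (e n) + cmod (r n)"
    using rc[of n] by linarith
  then have e1: "cmod (e 1) \<le> (t / c - s) * cmod (e n) + \<sigma>"
    using P(2)[of m] m by (simp add: \<sigma>_def)
  define a where "a = t / c"
  have "9/10 * a \<le> s" using s(1) by (simp only: a_def)
  then have lower: "9/10 * a * cmod (e i) \<le> s * cmod (e i)" for i by (rule mult_right_mono) simp
  have e1': "cmod (e 1) \<le> a * cmod (e n) - s * cmod (e n) + \<sigma>"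
    using e1 by (simp only: a_def left_diff_distrib)
  have "9/10 * a * cmod (e n) \<le> a * cmod (e n) - 9/10 * a * cmod (e n) + 2 * \<sigma>"
    using lower[of n] es[of n] e1' by simp
  then have "a * cmod (e n) \<le> 5/2 * \<sigma>" by simp
  then have ae: "a * cmod (e j) \<le> 5/2 * \<sigma>" using lower[of j] lower[of n] es[OF j] e1' by simp
  have "cmod (e j) = c / t * (a * cmod (e j))" unfolding a_def using c(3) t(1) by simp
  also have "\<dots> \<le> c / t * (5/2 * \<sigma>)" using c(3) t(1) by (intro mult_left_mono ae) simp
  finally have "cmod (e j) \<le> 5/2 * c / t * \<sigma>" by simp
  also have "\<dots> \<le> 3 / t * \<sigma>"
  proof (rule mult_right_mono)
    show "5/2 * c / t \<le> 3 / t" using c(2) t(1) by (intro divide_right_mono) auto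
  qed (simp add: \<sigma>_def sum_nonneg)
  finally show ?thesis by (simp add: \<sigma>_def)
qed

section \<open>The two mesh regimes\<close>

lemma quadratic_bound:
  fixes y Z :: real
  assumes "y\<^sup>2 \<le> a * Z\<^sup>2 + b * (Z * y)" "a \<ge> 0" "b \<ge> 0" "Z \<ge> 0"
  shows "y \<le> (a + b + 1) * Z"
proof (rule ccontr)
  define c where "c = a + b + 1"
  assume "\<not> ?thesis"
  then have y: "c * Z < y" by (simp add: c_def)
  have c: "c \<ge> 1" using assms by (simp add: c_def)
  have Zy: "Z \<le> y" using y c assms(4) mult_right_mono[of 1 c Z] by linarith
  then have y0: "y > 0" using y assms(4) c by (metis mult_zero_right not_less_iff_gr_or_eq order.strict_trans1)
  have "a * Z\<^sup>2 \<le> a * (Z * y)" using assms Zy by (simp add: power2_eq_square mult_left_mono)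
  then have "y\<^sup>2 \<le> (a + b) * Z * y" using assms(1) by (simp add: algebra_simps)
  then have "y * y \<le> ((a + b) * Z) * y" by (simp add: power2_eq_square)
  then have "y \<le> (a + b) * Z" using y0 by (rule mult_right_le_imp_le)
  then show False using y assms(4) by (simp add: c_def algebra_simps)
qed

section \<open>Coarse meshes: stability\<close>

context cip_system begin

definition "G = g + 1 / g"

lemma G: "G \<ge> 1" "g \<le> G" "1 / g \<le> G" "G > 0"
proof -
  have "g + 1 / g \<ge> 1"
  proof (cases "g \<ge> 1")
    case False
    then have "1 / g \<ge> 1" using g by simp
    then show ?thesis using g by linarith
  qed (use g in \<open>simp add: add_increasing2\<close>)
  then show "G \<ge> 1" "G > 0" by (auto simp: G_def)
qed (use g in \<open>auto simp: G_def\<close>)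

text \<open>The real part of \<open>energy_w\<close> is read as a bound for the mass term,
  everything else being controlled by \<open>Q\<close>: \<open>Aq\<close> through
  \<open>Aq_le_NY\<close> with \<open>Y \<le> Q / g\<close>, and \<open>g t c'\<close> through
  \<open>c'^2 \<le> U Y\<close> with \<open>U \<le> Q / t\<close>, which leaves
  \<open>sqrt (g t) Q\<close>.\<close>

lemma N2_bound:
  assumes K: "g * Y + t * U \<le> Q"
  shows "t\<^sup>2 * N\<^sup>2 \<le> c * (N * sqrt (Q / g)) + t * Q / 2 + 2 * (sqrt (g * t) * Q) + N * R"
proof -
  have gY: "g * Y \<le> Q" and tU: "t * U \<le> Q" and p: "0 \<le> g * Y" "0 \<le> t * U"
  proof -
    show p: "0 \<le> g * Y" "0 \<le> t * U" using nn g t by auto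
    show "g * Y \<le> Q" "t * U \<le> Q" using K p by linarith+
  qed
  have "(g * t * c')\<^sup>2 \<le> (g * t)\<^sup>2 * (U * Y)"
    using mult_left_mono[OF order_trans[OF c_le mult_left_mono[OF Dn_le_Y nn(6)]], of "(g * t)\<^sup>2"]
    by (simp add: power_mult_distrib)
  also have "\<dots> = g * t * ((t * U) * (g * Y))" by (simp add: power2_eq_square)
  also have "\<dots> \<le> g * t * (Q * Q)" using gY tU p g t by (intro mult_left_mono mult_mono) auto
  also have "\<dots> = (sqrt (g * t) * Q)\<^sup>2" using g t by (simp add: power_mult_distrib power2_eq_square)
  finally have 1: "\<bar>g * t * c'\<bar> \<le> sqrt (g * t) * Q"
    using gY p g t by (subst (asm) abs_le_square_iff[symmetric]) (auto simp: abs_mult)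
  have "Aq \<le> N * sqrt Y" by (rule Aq_le_NY)
  also have "\<dots> \<le> N * sqrt (Q / g)"
    using gY g nn by (intro mult_left_mono real_sqrt_le_mono) (auto simp: field_simps)
  finally have "c * Aq \<le> c * (N * sqrt (Q / g))" using nn by (intro mult_left_mono) auto
  moreover have "t\<^sup>2 * U \<le> t * Q" using mult_left_mono[OF tU, of t] t by (simp add: power2_eq_square)
  moreover have "t\<^sup>2 * (N\<^sup>2 - U / 2) = t\<^sup>2 * N\<^sup>2 - t\<^sup>2 * U / 2" by (simp add: algebra_simps)
  ultimately show ?thesis using energy_w_Re 1 unfolding abs_le_iff by linarith
qed

text \<open>If \<open>R\<close> were too small compared with \<open>N\<close>, every term on the
  right of \<open>N2_bound\<close> would be a small fraction of \<open>t^2 N^2\<close>. The gradient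
  bound then follows from \<open>Aq_le_NY\<close> and \<open>key_bound\<close>.\<close>

lemma coarse_stability:
  assumes tT: "t \<le> T" "T \<ge> 1" and h: "0 < h" "h \<le> 1" "h \<le> t" "h \<le> t^3"
  defines "K \<equiv> (200 * (1 + T) * T\<^sup>2)\<^sup>2"
  defines "L \<equiv> 64 * (1 + T\<^sup>2)\<^sup>2 * (K * (1 + T))"
  shows "t * h * N \<le> L * G * R" and "h\<^sup>2 * Aq \<le> 2 * L\<^sup>2 * G\<^sup>2 * R\<^sup>2"
proof -
  define Q where "Q = K * (N * R + g * R\<^sup>2)"
  have key: "g * Y + t * U \<le> Q" unfolding Q_def K_def by (rule key_bound[OF tT])
  have T2: "T\<^sup>2 \<ge> 1" using tT by simp
  have K1: "K \<ge> 1"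
  proof -
    have "1 * 1 \<le> (1 + T) * T\<^sup>2" using tT T2 by (intro mult_mono) auto
    then have "1 \<le> 200 * ((1 + T) * T\<^sup>2)" by linarith
    then show ?thesis unfolding K_def mult.assoc by (rule one_le_power)
  qed
  define K' where "K' = K * (1 + T)"
  have "K * 1 \<le> K * (1 + T)" using K1 tT by (intro mult_left_mono) auto
  then have K': "K' \<ge> K" "K' \<ge> 1" unfolding K'_def using K1 by linarith+
  define S where "S = 1 + T\<^sup>2"
  have "T * 1 \<le> T * T" using tT by (intro mult_left_mono) auto
  then have S: "S \<ge> 2" "S \<ge> T" using T2 by (auto simp: S_def power2_eq_square)
  have LS: "L = 64 * S\<^sup>2 * K'" by (simp add: L_def S_def K'_def)
  have S4: "S\<^sup>2 \<ge> 4" using S(1) mult_mono[of 2 S 2 S] by (simp add: power2_eq_square)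
  have LK: "L \<ge> 256 * K'" using mult_right_mono[OF S4, of K'] K' unfolding LS by simp
  have L1: "L \<ge> 1" "L \<ge> K" "L > 0" using LK K' by auto
  have th: "t * h > 0" using t h by simp
  have "t\<^sup>2 / 6 \<le> t\<^sup>2" "t\<^sup>2 \<le> T\<^sup>2" using power_mono[OF tT(1), of 2] t by simp_all
  then have cS: "c \<le> S" unfolding c_def S_def by linarith
  show main: "t * h * N \<le> L * G * R"
  proof (rule ccontr)
    assume "\<not> ?thesis"
    then have R_lt: "L * G * R < t * h * N" by simp
    moreover have "L * G * R \<ge> 0" using nn L1 G by simp
    ultimately have "t * h * N > 0" by linarith
    then have Npos: "N > 0" using th by (simp add: zero_less_mult_iff)
    \<comment> \<open>The negated claim becomes \<open>G R \<le> a N\<close>. The factor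
      \<open>64 S^2\<close> in \<open>L\<close> leaves \<open>1 / (8 S)\<close> after the square
      root taken below, enough to beat \<open>c \<le> S\<close>.\<close>
    define a where "a = t * h / L"
    have a: "a > 0" using th L1 by (simp add: a_def)
    have GR: "G * R \<le> a * N" using R_lt L1 by (simp add: a_def field_simps)
    have R_le: "R \<le> a * N" using GR G nn mult_right_mono[of 1 G R] by simp
    have aT: "a \<le> T"
    proof -
      have "t * h \<le> T * 1" using tT h t by (intro mult_mono) auto
      moreover have "t * h * 1 \<le> t * h * L" using L1 th by (intro mult_left_mono) auto
      then have "a \<le> t * h" unfolding a_def using L1 by (simp add: divide_le_eq)
      ultimately show ?thesis by simp
    qed
    have GQ: "G * Q \<le> K' * (a * N\<^sup>2)"
    proof -
      have "G * (N * R) \<le> a * N\<^sup>2" using mult_left_mono[OF GR, of N] nn by (simp add: power2_eq_square mult_ac)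
      moreover have "G * (g * R\<^sup>2) \<le> T * (a * N\<^sup>2)"
      proof -
        have "G * (g * R\<^sup>2) \<le> G * (G * R\<^sup>2)" using G by (intro mult_left_mono mult_right_mono) auto
        also have "\<dots> = (G * R)\<^sup>2" by (simp add: power2_eq_square)
        also have "\<dots> \<le> (a * N)\<^sup>2" using GR G nn by (intro power_mono) auto
        also have "\<dots> = a * (a * N\<^sup>2)" by (simp add: power2_eq_square)
        also have "\<dots> \<le> T * (a * N\<^sup>2)" using aT a by (intro mult_right_mono) auto
        finally show ?thesis .
      qed
      ultimately have "G * (N * R + g * R\<^sup>2) \<le> (1 + T) * (a * N\<^sup>2)" by (simp add: distrib_left distrib_right)
      then have "K * (G * (N * R + g * R\<^sup>2)) \<le> K * ((1 + T) * (a * N\<^sup>2))" using K1 by (intro mult_left_mono) auto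
      then show ?thesis by (simp add: Q_def K'_def mult_ac)
    qed
    have Q0: "Q \<ge> 0" using nn g K1 by (simp add: Q_def)
    have QG: "Q \<le> G * Q" using Q0 G mult_right_mono[of 1 G Q] by simp
    define m where "m = t\<^sup>2 * N\<^sup>2"
    have m: "m > 0" using Npos t by (simp add: m_def)
    have thN: "t * h * N\<^sup>2 \<le> m" unfolding m_def power2_eq_square[of t] using h t by (intro mult_right_mono mult_left_mono) auto
    have K'a: "K' * (a * N\<^sup>2) \<le> m / (64 * S\<^sup>2)"
    proof -
      have "K' * (a * N\<^sup>2) = t * h * N\<^sup>2 / (64 * S\<^sup>2)" using K' by (simp add: a_def LS)
      also have "\<dots> \<le> m / (64 * S\<^sup>2)" using thN by (intro divide_right_mono) auto
      finally show ?thesis .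
    qed
    have Qm: "Q \<le> m / (64 * S\<^sup>2)" using QG GQ K'a by linarith
    \<comment> \<open>The critical term, and the one that needs \<open>h \<le> t^3\<close>: up to
      constants \<open>sqrt (Q / g)\<close> is at most \<open>sqrt (t h) N\<close>, hence at most
      \<open>t^2 N\<close>.\<close>
    have e1: "c * (N * sqrt (Q / g)) \<le> m / 8"
    proof -
      have "Q / g \<le> G * Q" using G(3) Q0 mult_right_mono[of "1 / g" G Q] by simp
      also have "\<dots> \<le> t * h * N\<^sup>2 / (64 * S\<^sup>2)" using GQ K' by (simp add: a_def LS)
      also have "\<dots> \<le> t^4 * N\<^sup>2 / (64 * S\<^sup>2)"
        using mult_left_mono[OF h(4), of t] t by (intro divide_right_mono mult_right_mono) (auto simp: power4_eq_xxxx power3_eq_cube)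
      also have "\<dots> = (t\<^sup>2 * N / (8 * S))\<^sup>2" by (simp add: power_mult_distrib power_divide)
      finally have "sqrt (Q / g) \<le> t\<^sup>2 * N / (8 * S)" using nn S by (intro real_le_lsqrt) auto
      then have "c * (N * sqrt (Q / g)) \<le> S * (N * (t\<^sup>2 * N / (8 * S)))" using nn cS Q0 g
        by (intro mult_mono) auto
      also have "\<dots> = m / 8" using S by (simp add: m_def power2_eq_square)
      finally show ?thesis .
    qed
    have TS: "T \<le> S\<^sup>2" using S mult_mono[of 1 S T S] tT by (simp add: power2_eq_square)
    have e2: "t * Q / 2 \<le> m / 64"
    proof -
      have "t * Q \<le> S\<^sup>2 * (m / (64 * S\<^sup>2))" using tT TS Qm Q0 t by (intro mult_mono) auto
      also have "\<dots> = m / 64" using S by simp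
      finally show ?thesis using m by linarith
    qed
    have e3: "2 * (sqrt (g * t) * Q) \<le> m / 32"
    proof -
      have "g * t \<le> G * T" using G tT g t by (intro mult_mono) auto
      also have "\<dots> \<le> (G * T) * (G * T)" using G tT mult_mono[of 1 G 1 T] mult_right_mono[of 1 "G * T" "G * T"] by simp
      finally have "sqrt (g * t) \<le> G * T" using G tT by (intro real_le_lsqrt) (auto simp: power2_eq_square)
      then have "sqrt (g * t) * Q \<le> T * (G * Q)" using Q0 mult_right_mono[of "sqrt (g * t)" "G * T" Q] by (simp add: mult_ac)
      also have "\<dots> \<le> S\<^sup>2 * (m / (64 * S\<^sup>2))" using GQ K'a TS tT G Q0 by (intro mult_mono) auto
      also have "\<dots> = m / 64" using S by simp
      finally show ?thesis by linarith
    qed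
    have e4: "N * R \<le> m / 4"
    proof -
      have "N * R \<le> a * N\<^sup>2" using mult_left_mono[OF R_le, of N] nn by (simp add: power2_eq_square mult_ac)
      also have "\<dots> \<le> K' * (a * N\<^sup>2)" using K' a mult_right_mono[of 1 K' "a * N\<^sup>2"] by simp
      also have "\<dots> \<le> m / (64 * S\<^sup>2)" by (rule K'a)
      also have "\<dots> \<le> m / 4" using S4 m by (intro divide_left_mono) auto
      finally show ?thesis .
    qed
    \<comment> \<open>The fractions \<open>1/8\<close>, \<open>1/64\<close>, \<open>1/32\<close> and
      \<open>1/4\<close> add up to less than 1.\<close>
    show False using N2_bound[OF key] e1 e2 e3 e4 m unfolding m_def[symmetric] by linarith
  qed
  show "h\<^sup>2 * Aq \<le> 2 * L\<^sup>2 * G\<^sup>2 * R\<^sup>2"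
  proof (rule power2_le_imp_le)
    have Y: "Y \<le> G * Q"
    proof -
      have "t * U \<ge> 0" using t nn by simp
      then have "g * Y \<le> Q" using key by linarith
      then have "Y \<le> 1 / g * Q" using g by (simp add: field_simps)
      also have "\<dots> \<le> G * Q" using G nn g K1 by (intro mult_right_mono) (auto simp: Q_def)
      finally show ?thesis .
    qed
    have tY: "t\<^sup>2 * h * Q \<le> h * 0 + K * (t * (L * G * R) * R + t\<^sup>2 * h * (G * R\<^sup>2))"
    proof -
      have "t\<^sup>2 * h * Q = K * (t * (t * h * N) * R + t\<^sup>2 * h * (g * R\<^sup>2))" by (simp add: Q_def algebra_simps power2_eq_square)
      also have "\<dots> \<le> K * (t * (L * G * R) * R + t\<^sup>2 * h * (G * R\<^sup>2))"
        using main K1 t nn h G by (intro mult_left_mono add_mono mult_right_mono) auto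
      finally show ?thesis by simp
    qed
    have "(h\<^sup>2 * Aq)\<^sup>2 \<le> (h\<^sup>2 * (N * sqrt Y))\<^sup>2" using Aq_le_NY nn by (intro power_mono mult_left_mono) auto
    also have "\<dots> = h\<^sup>2 * (h * N)\<^sup>2 * Y" using nn by (simp add: power_mult_distrib power2_eq_square)
    also have "\<dots> \<le> h\<^sup>2 * (h * N)\<^sup>2 * (G * Q)" using Y by (intro mult_left_mono) auto
    \<comment> \<open>The factor \<open>t^4\<close> supplies the powers that turn the right side
      into \<open>(t h N)^2\<close> and \<open>t^2 h Q\<close>, both already bounded; it is
      cancelled at the end.\<close>
    finally have "t^3 * (t * (h\<^sup>2 * Aq)\<^sup>2) \<le> t^3 * (t * (h\<^sup>2 * (h * N)\<^sup>2 * (G * Q)))"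
      using t by (intro mult_left_mono) auto
    also have "\<dots> = h * (G * ((t * h * N)\<^sup>2 * (t\<^sup>2 * h * Q)))"
      by (simp add: power2_eq_square power3_eq_cube)
    also have "\<dots> \<le> h * (G * ((L * G * R)\<^sup>2 * (K * (t * (L * G * R) * R + t\<^sup>2 * h * (G * R\<^sup>2)))))"
    proof (intro mult_left_mono)
      show "(t * h * N)\<^sup>2 * (t\<^sup>2 * h * Q) \<le> (L * G * R)\<^sup>2 * (K * (t * (L * G * R) * R + t\<^sup>2 * h * (G * R\<^sup>2)))"
      proof (rule mult_mono)
        show "(t * h * N)\<^sup>2 \<le> (L * G * R)\<^sup>2" using main t h nn by (intro power_mono) auto
        show "t\<^sup>2 * h * Q \<le> K * (t * (L * G * R) * R + t\<^sup>2 * h * (G * R\<^sup>2))" using tY by simp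
        show "0 \<le> t\<^sup>2 * h * Q" using h nn g K1 by (simp add: Q_def)
      qed simp
    qed (use h G in auto)
    also have "\<dots> \<le> t^3 * (t * (2 * L\<^sup>2 * G\<^sup>2 * R\<^sup>2)\<^sup>2)"
    proof -
      have "h * (K * (t * (L * G * R) * R + t\<^sup>2 * h * (G * R\<^sup>2))) \<le> t^4 * (2 * L\<^sup>2 * (G * R\<^sup>2))"
      proof -
        have GR0: "G * R\<^sup>2 \<ge> 0" using G by simp
        have x1: "h * t \<le> t^4" using mult_right_mono[OF h(4), of t] t by (simp add: power4_eq_xxxx power3_eq_cube)
        have "h * h \<le> t * t" using h by (intro mult_mono) auto
        then have x2: "h * (t\<^sup>2 * h) \<le> t^4"
          using mult_left_mono[of "h * h" "t * t" "t\<^sup>2"] t by (simp add: power4_eq_xxxx power2_eq_square mult_ac)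
        have "h * (K * (t * (L * G * R) * R + t\<^sup>2 * h * (G * R\<^sup>2))) = K * (L * (h * t) + h * (t\<^sup>2 * h)) * (G * R\<^sup>2)"
          by (simp add: algebra_simps power2_eq_square)
        also have "\<dots> \<le> L * (L * t^4 + L * t^4) * (G * R\<^sup>2)"
        proof -
          have "h * (t\<^sup>2 * h) \<le> L * t^4" using x2 L1 mult_right_mono[of 1 L "t^4"] by simp
          moreover have "L * (h * t) \<le> L * t^4" using x1 L1 by simp
          ultimately have "L * (h * t) + h * (t\<^sup>2 * h) \<le> L * t^4 + L * t^4" by (rule add_mono[rotated])
          then show ?thesis
            by (intro mult_right_mono[OF mult_mono]) (use L1 K1 GR0 h t in auto)
        qed
        also have "\<dots> = t^4 * (2 * L\<^sup>2 * (G * R\<^sup>2))" by (simp add: power2_eq_square)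
        finally show ?thesis .
      qed
      then have "(G * (L * G * R)\<^sup>2) * (h * (K * (t * (L * G * R) * R + t\<^sup>2 * h * (G * R\<^sup>2))))
          \<le> (G * (L * G * R)\<^sup>2) * (t^4 * (2 * L\<^sup>2 * (G * R\<^sup>2)))"
        using G by (intro mult_left_mono) auto
      also have "\<dots> = t^4 * (2 * (L\<^sup>2 * G\<^sup>2 * R\<^sup>2)\<^sup>2)" by (simp add: power2_eq_square)
      also have "\<dots> \<le> t^4 * (2 * L\<^sup>2 * G\<^sup>2 * R\<^sup>2)\<^sup>2"
        by (intro mult_left_mono) (auto simp: power_mult_distrib)
      also have "\<dots> = t^3 * (t * (2 * L\<^sup>2 * G\<^sup>2 * R\<^sup>2)\<^sup>2)" by (simp add: power4_eq_xxxx power3_eq_cube)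
      finally show ?thesis by (simp add: mult_ac)
    qed
    finally have "t^3 * (t * (h\<^sup>2 * Aq)\<^sup>2) \<le> t^3 * (t * (2 * L\<^sup>2 * G\<^sup>2 * R\<^sup>2)\<^sup>2)" .
    then show "(h\<^sup>2 * Aq)\<^sup>2 \<le> (2 * L\<^sup>2 * G\<^sup>2 * R\<^sup>2)\<^sup>2" using t by simp
  qed (use nn in simp)
qed

end

section \<open>Fine meshes: comparison with the unpenalised method\<close>

lemma sum_norm_mass:
  fixes v :: "nat \<Rightarrow> complex"
  assumes "v 0 = 0" "n > 0"
  shows "(\<Sum>j=1..n. cmod (mass n v j)) \<le> (\<Sum>j=1..n. cmod (v j))"
proof -
  obtain m where m: "n = Suc m" using assms(2) by (cases n) auto
  \<comment> \<open>Each column of the mass matrix has sum at most 1. The additional terms bring the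
    columns \<open>p\<close> and \<open>p + 1\<close>, which later rows still reach, up to the full
    weight 6.\<close>
  have aux: "(\<Sum>j=1..p. cmod (v (j - 1)) + 4 * cmod (v j) + cmod (v (j + 1))) + cmod (v p) + 5 * cmod (v (p + 1))
      \<le> 6 * (\<Sum>j=1..p+1. cmod (v j))" for p
    by (induction p) (simp_all add: assms(1))
  have tri: "cmod (x + y + z) \<le> cmod x + cmod y + cmod z" for x y z :: complex
    by (rule order_trans[OF norm_triangle_ineq add_right_mono[OF norm_triangle_ineq]])
  have "6 * (\<Sum>j=1..n. cmod (mass n v j)) = (\<Sum>j=1..m. 6 * cmod (mass n v j)) + 6 * cmod (mass n v n)"
    by (simp add: m sum_distrib_left)
  also have "\<dots> \<le> (\<Sum>j=1..m. cmod (v (j - 1)) + 4 * cmod (v j) + cmod (v (j + 1))) + (cmod (v m) + 5 * cmod (v (m + 1)))"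
  proof (intro add_mono sum_mono)
    fix j assume "j \<in> {1..m}"
    then have "6 * cmod (mass n v j) = cmod (v (j - 1) + 4 * v j + v (j + 1))"
      by (simp add: mass_def m norm_divide)
    also have "\<dots> \<le> cmod (v (j - 1)) + 4 * cmod (v j) + cmod (v (j + 1))"
      using tri[of "v (j - 1)" "4 * v j" "v (j + 1)"] by (simp add: norm_mult)
    finally show "6 * cmod (mass n v j) \<le> cmod (v (j - 1)) + 4 * cmod (v j) + cmod (v (j + 1))" .
  next
    have "6 * cmod (mass n v n) = cmod (v m + 2 * v (m + 1))" by (simp add: mass_def m norm_divide)
    also have "\<dots> \<le> cmod (v m) + 2 * cmod (v (m + 1))"
      using norm_triangle_ineq[of "v m" "2 * v (m + 1)"] by (simp add: norm_mult)
    finally show "6 * cmod (mass n v n) \<le> cmod (v m) + 5 * cmod (v (m + 1))" using norm_ge_zero[of "v (m + 1)"] by linarith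
  qed
  also have "\<dots> \<le> 6 * (\<Sum>j=1..n. cmod (v j))" using aux[of m] by (simp add: m)
  finally show ?thesis by simp
qed

lemma sum_norm_le_sq: "(\<Sum>j=1..n. cmod (v j)) \<le> sqrt n * sqrt (sq n v)"
  using L2_set_mult_ineq[of "\<lambda>j. 1" "\<lambda>j. cmod (v j)" "{1..n}"] by (simp add: L2_set_def sq_def)

lemma sqrt_sq_triangle: "sqrt (sq n (\<lambda>j. u j + v j)) \<le> sqrt (sq n u) + sqrt (sq n v)"
proof -
  have "sqrt (sq n (\<lambda>j. u j + v j)) \<le> L2_set (\<lambda>j. cmod (u j) + cmod (v j)) {1..n}"
    unfolding sq_def L2_set_def by (intro real_sqrt_le_mono sum_mono power_mono norm_triangle_ineq) auto
  also have "\<dots> \<le> sqrt (sq n u) + sqrt (sq n v)"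
    unfolding sq_def using L2_set_triangle_ineq[of "\<lambda>j. cmod (u j)" "\<lambda>j. cmod (v j)"] by (simp add: L2_set_def)
  finally show ?thesis .
qed

lemma sq_scale: "sq n (\<lambda>j. a * v j) = (cmod a)\<^sup>2 * sq n v"
  by (simp add: sq_def norm_mult power_mult_distrib sum_distrib_left)

lemma dsq_scale: "dsq n (\<lambda>j. a * v j) = (cmod a)\<^sup>2 * dsq n v"
  by (simp add: dsq_def norm_mult power_mult_distrib sum_distrib_left flip: right_diff_distrib)

lemma sqrt_dsq_triangle: "sqrt (dsq n (\<lambda>j. u j + v j)) \<le> sqrt (dsq n u) + sqrt (dsq n v)"
  using sqrt_sq_triangle[of n "\<lambda>j. u j - u (j - 1)" "\<lambda>j. v j - v (j - 1)"]
  by (simp add: sq_def dsq_def algebra_simps)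

text \<open>\<open>F\<close> stands for the norm of the right-hand side, \<open>ut\<close> for the
  nodal values of the exact solution and \<open>q\<close> for their residual in the unpenalised
  equations. The assumption \<open>t^3 \<le> h\<close> is \<open>k^3 h^2 \<le> 1\<close>.\<close>

locale fine_cip_system = cip_system +
  fixes k h F :: real and ut q :: "nat \<Rightarrow> complex"
  assumes k: "k \<ge> 1" and h: "h = 1 / n" and tkh: "t = k * h" and t3: "t^3 \<le> h" and F: "F \<ge> 0"
    and R_le: "R \<le> 2 * (h * sqrt h * F)"
    and ut0: "ut 0 = 0" and ut_le: "\<And>j. j \<le> n \<Longrightarrow> cmod (ut j) \<le> 2 * F / k"
    and ut_row: "\<And>j. 1 \<le> j \<Longrightarrow> j \<le> n \<Longrightarrow> stiffness n t ut j - (of_real t)\<^sup>2 * mass n ut j = b j + q j"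
    and q_le: "(\<Sum>j=1..n. cmod (q j)) \<le> 6 * (t^3 * F)"
begin

text \<open>\<open>e\<close> is the error of \<open>w + \<gamma> A w\<close>, and satisfies the unpenalised equations with right-hand side \<open>r\<close>.\<close>

definition "e j = w j - \<i> * of_real g * d j - ut j"
definition "r j = \<i> * of_real g * (of_real t)\<^sup>2 * mass n d j - q j"
definition "s = sqrt h"
definition "y = sqrt Y"
text \<open>The expected size of \<open>y\<close>: second differences are about
  \<open>h^2 u''\<close>, the norm of \<open>u''\<close> is of order \<open>k F\<close>, and the
  unweighted sum adds \<open>1 / sqrt h\<close>.\<close>

definition "Z = t * s * F"

lemma h0: "h > 0" "h \<le> 1" using n by (auto simp: h)
lemma s: "s > 0" "s * s = h" "sqrt n * s = 1"
proof -
  show "s > 0" "s * s = h" using h0 by (simp_all add: s_def)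
  have "sqrt n * s = sqrt (n * h)" by (simp add: s_def real_sqrt_mult)
  also have "n * h = 1" using n by (simp add: h)
  finally show "sqrt n * s = 1" by simp
qed
lemma ht: "h \<le> t" using k h0 by (simp add: tkh)
lemma kt2: "k * t\<^sup>2 \<le> 1"
proof -
  have "h * (k * t\<^sup>2) \<le> h * 1" using t3 by (simp add: tkh power3_eq_cube power2_eq_square mult_ac)
  then show ?thesis using h0 by simp
qed
lemma t_le1: "t \<le> 1" "t\<^sup>2 \<le> 1"
proof -
  show "t\<^sup>2 \<le> 1" using kt2 k mult_right_mono[of 1 k "t\<^sup>2"] by simp
  then show "t \<le> 1" using t by (simp add: power_le_one_iff abs_square_le_1)
qed
lemma y: "y \<ge> 0" "y\<^sup>2 = Y" using nn by (auto simp: y_def)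
lemma Z: "Z \<ge> 0" using t s F by (simp add: Z_def)

lemma e0: "e 0 = 0" by (simp add: e_def w0 d0 ut0)

lemma stiffness_e: "stiffness n t e j = stiffness n t w j - \<i> * of_real g * stiffness n t d j - stiffness n t ut j"
  by (simp add: stiffness_def e_def algebra_simps)

lemma mass_e: "mass n e j = mass n w j - \<i> * of_real g * mass n d j - mass n ut j"
  by (simp add: mass_def e_def field_simps)

lemma e_row: "1 \<le> j \<Longrightarrow> j \<le> n \<Longrightarrow> stiffness n t e j - (of_real t)\<^sup>2 * mass n e j = r j"
  using row'[of j] ut_row[of j] unfolding stiffness_e mass_e r_def d_def[symmetric] by (simp add: algebra_simps)

text \<open>The factor \<open>s = sqrt h\<close> compensates the \<open>sqrt n\<close> lost in
  passing from the l2 norm of \<open>d\<close> to its l1 norm.\<close>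

lemma r_le: "s * (\<Sum>j=1..n. cmod (r j)) \<le> t\<^sup>2 * g * y + 6 * (t^3 * F * s)"
proof -
  have "(\<Sum>j=1..n. cmod (r j)) \<le> (\<Sum>j=1..n. g * t\<^sup>2 * cmod (mass n d j) + cmod (q j))"
  proof (rule sum_mono)
    fix j show "cmod (r j) \<le> g * t\<^sup>2 * cmod (mass n d j) + cmod (q j)"
      unfolding r_def by (rule order_trans[OF norm_triangle_ineq4]) (use g in \<open>simp add: norm_mult norm_power\<close>)
  qed
  also have "\<dots> = g * t\<^sup>2 * (\<Sum>j=1..n. cmod (mass n d j)) + (\<Sum>j=1..n. cmod (q j))"
    by (simp add: sum.distrib sum_distrib_left)
  also have "\<dots> \<le> g * t\<^sup>2 * (sqrt n * y) + 6 * (t^3 * F)"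
    unfolding y_def Y_def using g q_le
    by (intro add_mono mult_left_mono order_trans[OF sum_norm_mass[of d n, OF d0 n] sum_norm_le_sq]) auto
  finally have "s * (\<Sum>j=1..n. cmod (r j)) \<le> s * (g * t\<^sup>2 * (sqrt n * y) + 6 * (t^3 * F))"
    using s by (intro mult_left_mono) auto
  also have "\<dots> = (sqrt n * s) * (t\<^sup>2 * g * y) + 6 * (t^3 * F * s)" by (simp add: algebra_simps)
  finally show ?thesis unfolding s by simp
qed

lemma e_le: "j \<le> n \<Longrightarrow> s * cmod (e j) \<le> 3 * (t * g * y) + 18 * (t * Z)"
proof -
  assume j: "j \<le> n"
  have "s * cmod (e j) \<le> s * (3 / t * (\<Sum>j=1..n. cmod (r j)))"
    using s(1) by (intro mult_left_mono fem_stability[OF n t t_le1(1) e0 e_row j]) auto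
  also have "\<dots> = 3 / t * (s * (\<Sum>j=1..n. cmod (r j)))" by (simp only: mult_ac)
  also have "\<dots> \<le> 3 / t * (t\<^sup>2 * g * y + 6 * (t^3 * F * s))"
    using t by (intro mult_left_mono r_le) auto
  also have "\<dots> = 3 * (t * g * y) + 18 * (t * Z)"
    using t by (simp add: Z_def field_simps power2_eq_square power3_eq_cube)
  finally show ?thesis .
qed

lemma sq_le_bound:
  assumes "\<And>j. 1 \<le> j \<Longrightarrow> j \<le> n \<Longrightarrow> s * cmod (v j) \<le> B" "B \<ge> 0"
  shows "h * sqrt (sq n v) \<le> B"
proof -
  have "s\<^sup>2 * sq n v \<le> n * B\<^sup>2"
    using sq_le_max[of n "\<lambda>j. of_real s * v j" B] assms s sq_scale[of n "of_real s" v]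
    by (simp add: norm_mult)
  then have "sqrt (s\<^sup>2 * sq n v) \<le> sqrt (n * B\<^sup>2)" by (rule real_sqrt_le_mono)
  then have "s * sqrt (sq n v) \<le> sqrt n * B" using s assms by (simp add: real_sqrt_mult)
  then have "s * (s * sqrt (sq n v)) \<le> s * (sqrt n * B)" using s by (intro mult_left_mono) auto
  moreover have "s * (s * sqrt (sq n v)) = h * sqrt (sq n v)" by (simp only: mult.assoc[symmetric] s(2))
  moreover have "s * (sqrt n * B) = (sqrt n * s) * B" by (simp only: mult_ac)
  ultimately show ?thesis unfolding s(3) by simp
qed

text \<open>From \<open>w = ut + e + \<i> g d\<close> and \<open>e_le\<close>, the solution is
  bounded by the data and \<open>y\<close> alone.\<close>

lemma hN_le: "h * N \<le> 20 * (s * F / k) + 4 * (t * g * y)"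
proof -
  have w_eq: "w = (\<lambda>j. (ut j + e j) + (\<i> * of_real g) * d j)" by (auto simp: e_def)
  have "N \<le> sqrt (sq n ut) + sqrt (sq n e) + g * y"
  proof -
    have "N \<le> sqrt (sq n (\<lambda>j. ut j + e j)) + sqrt (sq n (\<lambda>j. (\<i> * of_real g) * d j))"
      unfolding N_def by (subst w_eq) (rule sqrt_sq_triangle)
    moreover have "sqrt (sq n (\<lambda>j. (\<i> * of_real g) * d j)) = g * y"
      unfolding sq_scale using g by (simp add: norm_mult real_sqrt_mult y_def Y_def)
    ultimately show ?thesis using sqrt_sq_triangle[of n ut e] by linarith
  qed
  then have "h * N \<le> h * (sqrt (sq n ut) + sqrt (sq n e) + g * y)"
    using h0 by (intro mult_left_mono) auto
  then have "h * N \<le> h * sqrt (sq n ut) + h * sqrt (sq n e) + h * (g * y)"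
    by (simp only: distrib_left)
  moreover have "h * sqrt (sq n ut) \<le> 2 * (s * F / k)"
  proof (rule sq_le_bound)
    fix j assume "j \<le> n" then show "s * cmod (ut j) \<le> 2 * (s * F / k)"
      using mult_left_mono[OF ut_le, of j s] s(1) by (simp add: mult.left_commute)
  qed (use s F k in auto)
  moreover have "h * sqrt (sq n e) \<le> 3 * (t * g * y) + 18 * (t * Z)"
    by (rule sq_le_bound) (use e_le t g y Z in auto)
  moreover have "h * (g * y) \<le> t * g * y"
    unfolding mult.assoc[of t] using ht g y by (intro mult_right_mono) auto
  moreover have "t * Z \<le> s * F / k"
  proof -
    have "k * t\<^sup>2 * (s * F) \<le> 1 * (s * F)" using kt2 s F by (intro mult_right_mono) auto
    then show ?thesis using k by (simp add: Z_def field_simps power2_eq_square)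
  qed
  moreover have "x \<le> 20 * p + 4 * u" if "x \<le> a + b + c" "a \<le> 2 * p" "b \<le> 3 * u + 18 * v" "c \<le> u" "v \<le> p"
    for x a b c p u v :: real using that by linarith
  ultimately show ?thesis by blast
qed

lemma R_le_Z: "R \<le> 2 * Z"
proof -
  have "h * s * F \<le> t * s * F" using ht s F by (intro mult_right_mono) auto
  then show ?thesis using R_le by (simp add: Z_def s_def)
qed

text \<open>The energy estimates bound \<open>y\<close> through \<open>N\<close>, and
  \<open>hN_le\<close> bounds \<open>N\<close> through \<open>y\<close>. The feedback factor is of
  order \<open>g k t^2\<close>: if it is small, \<open>Y_bound_direct\<close> absorbs it; if not,
  \<open>1 / k\<close> is at most a multiple of \<open>g t^2\<close> and \<open>key_bound\<close>
  gives a quadratic inequality for \<open>y\<close>.\<close>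

lemma y_le: "y \<le> 2000000000 * Z"
proof (cases "g * (k * t\<^sup>2) \<le> 1 / 168")
  case True
  have "g * (1 * t\<^sup>2) \<le> g * (k * t\<^sup>2)" using g k by (intro mult_left_mono mult_right_mono) auto
  then have "g * t\<^sup>2 \<le> 1" using True by simp
  then have "y \<le> 7 * (R + 3 * t\<^sup>2 * N)" unfolding y_def by (rule Y_bound_direct)
  \<comment> \<open>With the factor \<open>7 * 3\<close> of \<open>Y_bound_direct\<close>,
    \<open>21 * 4 / 168 = 1/2\<close>: half of \<open>y\<close> is absorbed.\<close>
  moreover have "t\<^sup>2 * N \<le> 20 * Z + 4 * (1 / 168 * y)"
  proof -
    have "t\<^sup>2 * N = t * k * (h * N)" by (simp add: tkh power2_eq_square)
    also have "\<dots> \<le> t * k * (20 * (s * F / k) + 4 * (t * g * y))"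
      using t k by (intro mult_left_mono hN_le) auto
    also have "\<dots> = 20 * Z + 4 * (g * (k * t\<^sup>2) * y)" using k by (simp add: Z_def algebra_simps power2_eq_square)
    also have "\<dots> \<le> 20 * Z + 4 * (1 / 168 * y)" using True y by (intro add_left_mono mult_left_mono mult_right_mono) auto
    finally show ?thesis .
  qed
  moreover have "7 * (R + 3 * t\<^sup>2 * N) = 7 * R + 21 * (t\<^sup>2 * N)" by simp
  ultimately have "y \<le> 2000 * Z" using R_le_Z Z by linarith
  then show ?thesis using Z by linarith
next
  case False
  have gkt: "g * (k * t\<^sup>2) \<ge> 1 / 168" using False by simp
  have "g * Y + t * U \<le> (200 * (1 + 1) * 1\<^sup>2)\<^sup>2 * (N * R + g * R\<^sup>2)" by (rule key_bound[OF t_le1(1)]) simp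
  moreover have "t * U \<ge> 0" using t nn by simp
  ultimately have "g * Y \<le> 160000 * (N * R + g * R\<^sup>2)" by simp
  also have "\<dots> \<le> 160000 * (g * (6720 * Z\<^sup>2 + 8 * (Z * y)) + g * (4 * Z\<^sup>2))"
  proof (intro mult_left_mono add_mono)
    have "N * R \<le> N * (2 * (h * s * F))" using R_le nn by (intro mult_left_mono) (auto simp: s_def)
    also have "\<dots> = (h * N) * (2 * (s * F))" by simp
    also have "\<dots> \<le> (20 * (s * F / k) + 4 * (t * g * y)) * (2 * (s * F))"
      using hN_le s F by (intro mult_right_mono) auto
    also have "\<dots> = 40 * (s * F)\<^sup>2 / k + g * (8 * (Z * y))" by (simp add: Z_def algebra_simps power2_eq_square)
    \<comment> \<open>The only term lacking the factor \<open>g\<close>, which is about to be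
      divided out; the case assumption supplies it.\<close>
    also have "40 * (s * F)\<^sup>2 / k \<le> g * (6720 * Z\<^sup>2)"
    proof -
      have "40 * (s * F)\<^sup>2 / k * 1 \<le> 40 * (s * F)\<^sup>2 / k * (168 * (g * (k * t\<^sup>2)))"
        using gkt k by (intro mult_left_mono) auto
      also have "\<dots> = g * (6720 * Z\<^sup>2)" using k by (simp add: Z_def power2_eq_square)
      finally show ?thesis by simp
    qed
    finally show "N * R \<le> g * (6720 * Z\<^sup>2 + 8 * (Z * y))" by (simp add: algebra_simps)
    have "R\<^sup>2 \<le> (2 * Z)\<^sup>2" using R_le_Z nn by (intro power_mono) auto
    then show "R\<^sup>2 \<le> 4 * Z\<^sup>2" by (simp add: power_mult_distrib)
  qed (use g in auto)
  finally have "g * Y \<le> g * (160000 * (6724 * Z\<^sup>2 + 8 * (Z * y)))" by (simp add: algebra_simps)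
  then have "y\<^sup>2 \<le> 1075840000 * Z\<^sup>2 + 1280000 * (Z * y)" using g unfolding y by simp
  then have "y \<le> (1075840000 + 1280000 + 1) * Z" by (rule quadratic_bound) (use Z in auto)
  also have "\<dots> \<le> 2000000000 * Z" using Z by (intro mult_right_mono) auto
  finally show ?thesis .
qed

text \<open>The size of the nodal error in \<open>u\<close>; \<open>k * M\<close> is
  \<open>1 + g\<close> times \<open>k^3 h^2 F\<close>.\<close>

definition "M = (1 + g) * t\<^sup>2 * F"

lemma M: "M \<ge> 0" using g F by (simp add: M_def)

lemma e_le_M: "j \<le> n \<Longrightarrow> cmod (e j) \<le> 6000000018 * M"
proof -
  assume "j \<le> n"
  have "s * cmod (e j) \<le> 3 * (t * g * (2000000000 * Z)) + 18 * (t * Z)"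
  proof -
    have "t * g * y \<le> t * g * (2000000000 * Z)" using t g by (intro mult_left_mono y_le) auto
    then show ?thesis using e_le[OF \<open>j \<le> n\<close>] by linarith
  qed
  also have "\<dots> = s * (6000000000 * (g * t\<^sup>2 * F) + 18 * (t\<^sup>2 * F))" by (simp add: Z_def algebra_simps power2_eq_square)
  finally have "cmod (e j) \<le> 6000000000 * (g * t\<^sup>2 * F) + 18 * (t\<^sup>2 * F)" using s by simp
  also have "\<dots> \<le> 6000000018 * M"
    using g F mult_nonneg_nonneg[of "g * t\<^sup>2" F] mult_nonneg_nonneg[of "t\<^sup>2" F] by (simp add: M_def algebra_simps)
  finally show ?thesis .
qed

lemma sum_r_le: "(\<Sum>j=1..n. cmod (r j)) \<le> 2000000006 * (t * M)"
proof -
  have "s * (\<Sum>j=1..n. cmod (r j)) \<le> t\<^sup>2 * g * (2000000000 * Z) + 6 * (t^3 * F * s)"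
  proof -
    have "t\<^sup>2 * g * y \<le> t\<^sup>2 * g * (2000000000 * Z)" using g by (intro mult_left_mono y_le) auto
    then show ?thesis using r_le by linarith
  qed
  also have "\<dots> = s * (2000000000 * (g * t^3 * F) + 6 * (t^3 * F))" by (simp add: Z_def algebra_simps power2_eq_square power3_eq_cube)
  finally have "(\<Sum>j=1..n. cmod (r j)) \<le> 2000000000 * (g * t^3 * F) + 6 * (t^3 * F)" using s by simp
  also have "\<dots> \<le> 2000000006 * (t * M)"
    using t g F mult_nonneg_nonneg[of "g * t^3" F] mult_nonneg_nonneg[of "t^3" F]
    by (simp add: M_def algebra_simps power2_eq_square power3_eq_cube)
  finally show ?thesis .
qed

text \<open>The real part of the error equation tested with \<open>e\<close> bounds the gradient by
  \<open>t^2 * sq n e\<close> and the pairing of \<open>r\<close> with \<open>e\<close>. The latter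
  uses the l1 bound of \<open>r\<close> and the maximum bound of \<open>e\<close>.\<close>

lemma dsq_e_le: "dsq n e \<le> 10^20 * (h * (k * M)\<^sup>2)"
proof -
  define A where "A = (6000000018 * M)\<^sup>2"
  have sqe: "sq n e \<le> n * A" unfolding A_def by (rule sq_le_max) (use e_le_M M in auto)
  have "(\<Sum>j=1..n. r j * cnj (e j)) = (\<Sum>j=1..n. stiffness n t e j * cnj (e j)) - (of_real t)\<^sup>2 * (\<Sum>j=1..n. mass n e j * cnj (e j))"
    unfolding sum_distrib_left sum_subtractf[symmetric]
    by (rule sum.cong) (auto simp flip: e_row simp: algebra_simps)
  also have "\<dots> = of_real (dsq n e) - \<i> * of_real t * of_real ((cmod (e n))\<^sup>2)
      - (of_real t)\<^sup>2 * (of_real (sq n e) - of_real ((cmod (e n))\<^sup>2) / 2 - of_real (dsq n e) / 6)"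
    unfolding sum_stiffness[of e n t e, OF e0 n] sum_mass[of e e n, OF e0 e0 n] dsq_cnj sq_cnj complex_norm_square
    by (simp add: mult.assoc)
  finally have eq: "(\<Sum>j=1..n. r j * cnj (e j)) = \<dots>" .
  have "Re (\<Sum>j=1..n. r j * cnj (e j)) = dsq n e - t\<^sup>2 * (sq n e - (cmod (e n))\<^sup>2 / 2 - dsq n e / 6)"
    unfolding eq by (simp flip: of_real_power)
  moreover have "t\<^sup>2 * ((cmod (e n))\<^sup>2 / 2 + dsq n e / 6) \<ge> 0" by (simp add: dsq_nonneg)
  ultimately have "dsq n e \<le> t\<^sup>2 * sq n e + cmod (\<Sum>j=1..n. r j * cnj (e j))"
    using complex_Re_le_cmod[of "\<Sum>j=1..n. r j * cnj (e j)"] by (simp add: algebra_simps)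
  also have "t\<^sup>2 * sq n e \<le> t\<^sup>2 * (n * A)" using sqe by (intro mult_left_mono) auto
  also have "t\<^sup>2 * (n * A) = h * (k\<^sup>2 * A)" using n by (simp add: tkh h power2_eq_square)
  also have "cmod (\<Sum>j=1..n. r j * cnj (e j)) \<le> (\<Sum>j=1..n. cmod (r j) * (6000000018 * M))"
    by (rule order_trans[OF norm_sum sum_mono]) (auto simp: norm_mult intro!: mult_left_mono e_le_M)
  also have "\<dots> = (\<Sum>j=1..n. cmod (r j)) * (6000000018 * M)" by (simp add: sum_distrib_right)
  also have "\<dots> \<le> (2000000006 * (t * M)) * (6000000018 * M)" using sum_r_le M by (intro mult_right_mono) auto
  also have "\<dots> = h * (k * (12000000072000000108 * M\<^sup>2))" by (simp add: tkh power2_eq_square)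
  also have "\<dots> \<le> h * (k\<^sup>2 * (12000000072000000108 * M\<^sup>2))"
    using h0 k by (intro mult_left_mono mult_right_mono) (auto simp: power2_eq_square)
  finally have "dsq n e \<le> 48000000288000000432 * (h * (k * M)\<^sup>2)"
    by (simp add: A_def power_mult_distrib algebra_simps)
  also have "\<dots> \<le> 10^20 * (h * (k * M)\<^sup>2)" using h0 by (intro mult_right_mono) auto
  finally show ?thesis .
qed

lemma nodal_error: "s * sqrt (sq n (\<lambda>j. ut j - w j)) \<le> 10^11 * M"
proof -
  have "(\<lambda>j. ut j - w j) = (\<lambda>j. (-1) * e j + (- \<i> * of_real g) * d j)" by (auto simp: e_def)
  then have "sqrt (sq n (\<lambda>j. ut j - w j)) \<le> sqrt (sq n (\<lambda>j. (-1) * e j)) + sqrt (sq n (\<lambda>j. (- \<i> * of_real g) * d j))"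
    by (simp only: sqrt_sq_triangle)
  also have "sqrt (sq n (\<lambda>j. (-1) * e j)) = sqrt (sq n e)" unfolding sq_scale by simp
  also have "sqrt (sq n (\<lambda>j. (- \<i> * of_real g) * d j)) = g * y"
    unfolding sq_scale using g by (simp add: norm_mult real_sqrt_mult y_def Y_def)
  finally have "s * sqrt (sq n (\<lambda>j. ut j - w j)) \<le> s * (sqrt (sq n e) + g * y)"
    using s(1) by (intro mult_left_mono) auto
  then have "s * sqrt (sq n (\<lambda>j. ut j - w j)) \<le> s * sqrt (sq n e) + s * (g * y)"
    by (simp only: distrib_left)
  moreover have "s * sqrt (sq n e) \<le> 6000000018 * M"
  proof -
    have "h * sqrt (sq n e) \<le> s * (6000000018 * M)"
      by (rule sq_le_bound) (use e_le_M s M in auto)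
    then have "s * (s * sqrt (sq n e)) \<le> s * (6000000018 * M)" by (simp only: mult.assoc[symmetric] s(2))
    then show ?thesis using s by simp
  qed
  moreover have "s * (g * y) \<le> 2000000000 * M"
  proof -
    have "s * (g * y) \<le> s * (g * (2000000000 * Z))" using s g y_le by simp
    also have "\<dots> = 2000000000 * (g * ((s * s) * t) * F)" by (simp add: Z_def)
    also have "\<dots> = 2000000000 * (g * (h * t) * F)" by (simp only: s(2))
    also have "\<dots> \<le> 2000000000 * (g * (t * t) * F)" using ht t g F by (intro mult_left_mono mult_right_mono) auto
    also have "\<dots> \<le> 2000000000 * M" using F by (simp add: M_def algebra_simps power2_eq_square)
    finally show ?thesis .
  qed
  ultimately show ?thesis using M by simp
qed

text \<open>Undoing the shift from \<open>w\<close> to \<open>w + \<gamma> A w\<close> costs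
  \<open>g * sqrt X\<close>, at most \<open>2 g y\<close>. This is the source of the first-order
  term \<open>g t F\<close> in the derivative estimate.\<close>

lemma nodal_grad_error: "sqrt (dsq n (\<lambda>j. ut j - w j)) \<le> s * (10^10 * (k * M + g * t * F))"
proof -
  have "(\<lambda>j. ut j - w j) = (\<lambda>j. (-1) * e j + (- \<i> * of_real g) * d j)" by (auto simp: e_def)
  then have "sqrt (dsq n (\<lambda>j. ut j - w j)) \<le> sqrt (dsq n (\<lambda>j. (-1) * e j)) + sqrt (dsq n (\<lambda>j. (- \<i> * of_real g) * d j))"
    by (simp only: sqrt_dsq_triangle)
  also have "sqrt (dsq n (\<lambda>j. (-1) * e j)) = sqrt (dsq n e)" unfolding dsq_scale by simp
  also have "sqrt (dsq n (\<lambda>j. (- \<i> * of_real g) * d j)) = g * sqrt X"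
    unfolding dsq_scale using g by (simp add: norm_mult real_sqrt_mult X_def)
  also have "sqrt (dsq n e) \<le> s * (10^10 * (k * M))"
  proof -
    have "sqrt (dsq n e) \<le> sqrt (10^20 * (h * (k * M)\<^sup>2))" using dsq_e_le by simp
    also have "\<dots> = s * (10^10 * (k * M))"
      using M k by (simp add: real_sqrt_mult s_def real_sqrt_unique[of "10^10"])
    finally show ?thesis .
  qed
  also have "g * sqrt X \<le> s * (10^10 * (g * t * F))"
  proof -
    have "sqrt X \<le> sqrt (4 * Y)" using X_le_Y by simp
    also have "\<dots> = 2 * y" by (simp add: real_sqrt_mult y_def)
    also have "\<dots> \<le> 10^10 * Z" using y_le Z by simp
    finally have "g * sqrt X \<le> g * (10^10 * Z)" using g by simp
    then show ?thesis by (simp add: Z_def mult_ac)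
  qed
  finally show ?thesis by (simp add: algebra_simps)
qed

end

section \<open>Weak derivatives on an interval\<close>

lemma integrable_Ioo_iff:
  fixes f :: "real \<Rightarrow> 'a::euclidean_space"
  shows "integrable (lebesgue_on {a<..<b}) f \<longleftrightarrow> f absolutely_integrable_on {a..b}"
proof -
  have "integrable (lebesgue_on {a<..<b}) f \<longleftrightarrow> f absolutely_integrable_on {a<..<b}"
    by (simp add: integrable_restrict_space set_integrable_def)
  then show ?thesis by (simp add: absolutely_integrable_on_Icc_iff_Ioo)
qed

lemma lebesgue_integral_Ioo:
  fixes f :: "real \<Rightarrow> 'a::euclidean_space"
  assumes "f absolutely_integrable_on {a..b}"
  shows "integral\<^sup>L (lebesgue_on {a<..<b}) f = integral {a..b} f"
proof -
  have "integral\<^sup>L (lebesgue_on {a<..<b}) f = integral {a<..<b} f"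
    by (rule lebesgue_integral_eq_integral) (use assms in \<open>simp_all add: integrable_Ioo_iff\<close>)
  then show ?thesis by (simp add: integral_open_interval_real)
qed

lemma L2_square_integrable:
  assumes "f \<in> L2 a b"
  shows "(\<lambda>x. (cmod (f x))\<^sup>2) absolutely_integrable_on {a..b}"
  using assms by (simp add: L2_def integrable_Ioo_iff[symmetric])

lemma L2_absolutely_integrable:
  assumes "f \<in> L2 a b"
  shows "f absolutely_integrable_on {a..b}"
  unfolding integrable_Ioo_iff[symmetric]
proof (rule Bochner_Integration.integrable_bound)
  have "integrable (lebesgue_on {a<..<b}) (\<lambda>x. 1 :: real)"
    unfolding integrable_Ioo_iff by (intro absolutely_integrable_continuous_real continuous_intros)
  then show "integrable (lebesgue_on {a<..<b}) (\<lambda>x. 1 + (cmod (f x))\<^sup>2)"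
    using assms by (intro Bochner_Integration.integrable_add) (auto simp: L2_def)
  show "f \<in> borel_measurable (lebesgue_on {a<..<b})" using assms by (simp add: L2_def)
  have "z \<le> 1 + z\<^sup>2" for z :: real
    using zero_le_power2[of "z - 1/2"] by (simp add: power2_eq_square algebra_simps)
  then show "AE x in lebesgue_on {a<..<b}. norm (f x) \<le> norm (1 + (cmod (f x))\<^sup>2)" by auto
qed

text \<open>A smoothed unit step: the integral of a hat with support \<open>[0, 2]\<close>, written
  with truncated powers. A quadratic spline suffices because test functions are only required to be
  of class C1.\<close>

definition ramp :: "real \<Rightarrow> real" where
  "ramp x = ((max 0 x)\<^sup>2 - 2 * (max 0 (x - 1))\<^sup>2 + (max 0 (x - 2))\<^sup>2) / 2"

definition tent :: "real \<Rightarrow> real" where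
  "tent x = max 0 x - 2 * max 0 (x - 1) + max 0 (x - 2)"

lemma DERIV_max_square: "((\<lambda>x::real. (max 0 x)\<^sup>2) has_real_derivative 2 * max 0 x) (at x)"
proof -
  consider "x < 0" | "x > 0" | "x = 0" by linarith
  then show ?thesis
  proof cases
    case 1
    have "((\<lambda>x::real. 0) has_real_derivative 2 * max 0 x) (at x)" using 1 by simp
    then show ?thesis
      by (rule has_field_derivative_transform_within_open[where S = "{..<0}"]) (use 1 in auto)
  next
    case 2
    have "((\<lambda>x::real. x\<^sup>2) has_real_derivative 2 * max 0 x) (at x)"
      using 2 by (auto intro!: derivative_eq_intros)
    then show ?thesis
      by (rule has_field_derivative_transform_within_open[where S = "{0<..}"]) (use 2 in auto)
  next
    case 3
    have "((\<lambda>h::real. max 0 h * max 0 h / h) \<longlongrightarrow> 0) (at 0)"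
    proof (rule Lim_null_comparison[where g = "\<lambda>h. \<bar>h\<bar>"])
      show "\<forall>\<^sub>F h in at 0. norm (max 0 h * max 0 h / h) \<le> \<bar>h::real\<bar>"
        by (auto simp: eventually_at max_def intro!: exI[of _ 1])
      show "((\<lambda>h::real. \<bar>h\<bar>) \<longlongrightarrow> 0) (at 0)" by (auto intro!: tendsto_eq_intros)
    qed
    then show ?thesis using 3 by (simp add: DERIV_def power2_eq_square)
  qed
qed

lemma DERIV_ramp: "(ramp has_real_derivative tent x) (at x)"
proof -
  have D: "((\<lambda>x. (max 0 (x - c))\<^sup>2) has_real_derivative 2 * max 0 (x - c)) (at x)" for c
  proof -
    have "((\<lambda>x. x - c) has_real_derivative 1) (at x)" by (auto intro!: derivative_eq_intros)
    from DERIV_chain2[where f = "\<lambda>x. (max 0 x)\<^sup>2" and g = "\<lambda>x. x - c", OF DERIV_max_square this]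
    show ?thesis by simp
  qed
  have "((\<lambda>x. (max 0 x)\<^sup>2 - 2 * (max 0 (x - 1))\<^sup>2 + (max 0 (x - 2))\<^sup>2) has_real_derivative
      2 * max 0 x - 2 * (2 * max 0 (x - 1)) + 2 * max 0 (x - 2)) (at x)"
    by (intro DERIV_add DERIV_diff DERIV_cmult D DERIV_max_square)
  from DERIV_cdivide[OF this, of 2] show ?thesis
    unfolding ramp_def[abs_def] tent_def by (simp add: add_divide_distrib diff_divide_distrib)
qed

lemma continuous_tent: "continuous_on S tent"
  unfolding tent_def[abs_def] by (intro continuous_intros)

lemma ramp_simps: "x \<le> 0 \<Longrightarrow> ramp x = 0" "x \<ge> 2 \<Longrightarrow> ramp x = 1"
  and tent_simps: "x \<le> 0 \<Longrightarrow> tent x = 0" "x \<ge> 2 \<Longrightarrow> tent x = 0"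
  by (auto simp: ramp_def tent_def max_def power2_eq_square algebra_simps)

lemma tent_nonneg: "tent x \<ge> 0"
  by (auto simp: tent_def max_def)

lemma ramp_bounds: "0 \<le> ramp x" "ramp x \<le> 1"
proof -
  have mono: "ramp x \<le> ramp y" if "x \<le> y" for x y
    by (rule DERIV_nonneg_imp_nondecreasing[OF that]) (use DERIV_ramp tent_nonneg in blast)
  show "0 \<le> ramp x" using mono[of "min x 0" x] ramp_simps(1)[of "min x 0"] by simp
  show "ramp x \<le> 1" using mono[of x "max x 2"] ramp_simps(2)[of "max x 2"] by simp
qed

lemma integral_tent:
  assumes e: "\<epsilon> > 0" and x: "a \<le> x" "x + 2 * \<epsilon> \<le> b"
  shows "((\<lambda>z. tent ((z - x) / \<epsilon>) / \<epsilon>) has_integral 1) {a..b}"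
proof -
  have "((\<lambda>z. tent ((z - x) / \<epsilon>) / \<epsilon>) has_integral (ramp ((b - x) / \<epsilon>) - ramp ((a - x) / \<epsilon>))) {a..b}"
  proof (rule fundamental_theorem_of_calculus)
    show "((\<lambda>z. ramp ((z - x) / \<epsilon>)) has_vector_derivative tent ((z - x) / \<epsilon>) / \<epsilon>) (at z within {a..b})" for z
    proof -
      have "((\<lambda>z. ramp ((z - x) / \<epsilon>)) has_real_derivative tent ((z - x) / \<epsilon>) * (1 / \<epsilon>)) (at z)"
        by (rule DERIV_chain2[OF DERIV_ramp]) (use e in \<open>auto intro!: derivative_eq_intros\<close>)
      then show ?thesis
        by (simp add: has_real_derivative_iff_has_vector_derivative has_vector_derivative_at_within)
    qed
  qed (use x e in simp)
  moreover have "ramp ((b - x) / \<epsilon>) = 1" "ramp ((a - x) / \<epsilon>) = 0"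
    using x e by (auto intro!: ramp_simps simp: field_simps)
  ultimately show ?thesis by simp
qed

text \<open>The rescaled tents are nonnegative kernels of mass 1 supported in
  \<open>[x, x + 2 \<epsilon>]\<close>, hence an approximate identity on the right of
  \<open>x\<close>.\<close>

lemma tent_average_tendsto:
  fixes w :: "real \<Rightarrow> complex"
  assumes w: "continuous_on {a..b} w" and x: "a < x" "x < b"
    and e: "\<And>m::nat. \<epsilon> m > 0" "\<And>m. x + 2 * \<epsilon> m \<le> b" "\<epsilon> \<longlonglongrightarrow> 0"
  shows "(\<lambda>m. integral {a..b} (\<lambda>z. w z * of_real (tent ((z - x) / \<epsilon> m) / \<epsilon> m))) \<longlonglongrightarrow> w x"
proof (rule LIMSEQ_I)
  fix r :: real assume r: "r > 0"
  have "continuous_on {a..b} w" by fact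
  then obtain \<delta> where \<delta>: "\<delta> > 0" "\<And>z. z \<in> {a..b} \<Longrightarrow> dist z x < \<delta> \<Longrightarrow> dist (w z) (w x) < r / 2"
    using x r unfolding continuous_on_iff by (metis atLeastAtMost_iff half_gt_zero less_eq_real_def)
  have "\<forall>\<^sub>F m in sequentially. \<epsilon> m < \<delta> / 2" using e(3) \<delta> by (intro order_tendstoD) auto
  then obtain m0 where m0: "\<And>m. m \<ge> m0 \<Longrightarrow> \<epsilon> m < \<delta> / 2" by (auto simp: eventually_sequentially)
  show "\<exists>m0. \<forall>m\<ge>m0. norm (integral {a..b} (\<lambda>z. w z * of_real (tent ((z - x) / \<epsilon> m) / \<epsilon> m)) - w x) < r"
  proof (intro exI allI impI)
    fix m assume "m \<ge> m0"
    then have em: "\<epsilon> m < \<delta> / 2" by (rule m0)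
    define \<psi> where "\<psi> z = tent ((z - x) / \<epsilon> m) / \<epsilon> m" for z
    \<comment> \<open>The unit mass of the kernel; this local fact is unrelated to the energy
      estimate of the same name.\<close>
    have energy_w_Im: "(\<psi> has_integral 1) {a..b}"
      unfolding \<psi>_def using e x by (intro integral_tent) auto
    have c\<psi>: "continuous_on {a..b} \<psi>" unfolding \<psi>_def
      using e(1)[of m] by (intro continuous_intros continuous_on_compose2[OF continuous_tent[of UNIV]]) auto
    have Ic: "((\<lambda>z. w x * of_real (\<psi> z)) has_integral w x) {a..b}"
      using has_integral_mult_right[OF has_integral_of_real[OF energy_w_Im, where 'b = complex], of "w x"] by simp
    have "continuous_on {a..b} (\<lambda>z. w z * of_real (\<psi> z))" by (intro continuous_intros w c\<psi>)
    then have Iw: "(\<lambda>z. w z * of_real (\<psi> z)) integrable_on {a..b}" by (rule integrable_continuous_real)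
    have "integral {a..b} (\<lambda>z. w z * of_real (\<psi> z)) - w x
        = integral {a..b} (\<lambda>z. w z * of_real (\<psi> z) - w x * of_real (\<psi> z))"
      using Iw Ic by (subst integral_diff) (auto simp: has_integral_iff)
    also have "norm \<dots> \<le> integral {a..b} (\<lambda>z. r / 2 * \<psi> z)"
    proof (rule integral_norm_bound_integral)
      show "(\<lambda>z. w z * of_real (\<psi> z) - w x * of_real (\<psi> z)) integrable_on {a..b}"
        using Iw Ic by (intro integrable_diff) (auto simp: has_integral_iff)
      show "(\<lambda>z. r / 2 * \<psi> z) integrable_on {a..b}"
        using has_integral_mult_right[OF energy_w_Im, of "r / 2"] by (auto simp: has_integral_iff)
      fix z assume z: "z \<in> {a..b}"
      have \<psi>0: "\<psi> z \<ge> 0" using tent_nonneg e(1)[of m] by (simp add: \<psi>_def)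
      have eq: "norm (w z * of_real (\<psi> z) - w x * of_real (\<psi> z)) = norm (w z - w x) * \<psi> z"
        using \<psi>0 by (simp flip: left_diff_distrib add: norm_mult)
      show "norm (w z * of_real (\<psi> z) - w x * of_real (\<psi> z)) \<le> r / 2 * \<psi> z"
      proof (cases "x \<le> z \<and> z \<le> x + 2 * \<epsilon> m")
        case True
        then have "dist z x < \<delta>" using em by (auto simp: dist_real_def)
        then have "norm (w z - w x) \<le> r / 2" using \<delta>(2)[OF z] by (simp add: dist_norm)
        then show ?thesis unfolding eq using \<psi>0 by (intro mult_right_mono)
      next
        case False
        then have "\<psi> z = 0" using e(1)[of m] unfolding \<psi>_def by (auto simp: tent_simps field_simps)
        then show ?thesis by simp
      qed
    qed
    also have "\<dots> = r / 2" using energy_w_Im by (simp add: has_integral_iff)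
    finally show "norm (integral {a..b} (\<lambda>z. w z * of_real (tent ((z - x) / \<epsilon> m) / \<epsilon> m)) - w x) < r"
      using r by (simp add: \<psi>_def)
  qed
qed

lemma ramp_tendsto:
  assumes e: "\<And>m::nat. \<epsilon> m > 0" "\<epsilon> \<longlonglongrightarrow> 0"
  shows "(\<lambda>m. ramp ((z - x) / \<epsilon> m)) \<longlonglongrightarrow> (if z \<le> x then 0 else 1)"
proof (cases "z \<le> x")
  case True
  then have "ramp ((z - x) / \<epsilon> m) = 0" for m
    using e(1)[of m] by (intro ramp_simps) (auto simp: divide_nonpos_pos)
  then show ?thesis using True by simp
next
  case False
  have "\<forall>\<^sub>F m in sequentially. \<epsilon> m < (z - x) / 2" using e(2) False by (intro order_tendstoD) auto
  then have "\<forall>\<^sub>F m in sequentially. ramp ((z - x) / \<epsilon> m) = 1"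
  proof eventually_elim
    case (elim m)
    then show ?case using e(1)[of m] by (intro ramp_simps) (auto simp: field_simps)
  qed
  then show ?thesis using False by (simp add: tendsto_eventually)
qed

text \<open>Differences of rescaled copies of \<^const>\<open>ramp\<close> are test functions that converge to the indicator function of
  \<open>(x, y]\<close>; their derivatives, built from \<^const>\<open>tent\<close>, converge to evaluation at \<open>x\<close> minus evaluation at \<open>y\<close>.\<close>

lemma weak_deriv_increment_interior:
  assumes w: "continuous_on {a..b} w" and g: "g \<in> L2 a b" and wd: "has_weak_deriv a b w g"
    and xy: "a < x" "x < y" "y < b"
  shows "w y - w x = integral {x..y} g"
proof -
  define \<epsilon> where "\<epsilon> m = (b - y) / 4 * inverse (real (Suc m))" for m
  have e: "\<epsilon> m > 0" "\<epsilon> m \<le> (b - y) / 4" for m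
  proof -
    show "\<epsilon> m > 0" unfolding \<epsilon>_def using xy by (intro mult_pos_pos) auto
    show "\<epsilon> m \<le> (b - y) / 4" unfolding \<epsilon>_def
      using xy by (intro mult_left_le) (auto simp: inverse_le_1_iff)
  qed
  have "(\<lambda>m. (b - y) / 4 * inverse (real (Suc m))) \<longlonglongrightarrow> (b - y) / 4 * 0"
    by (intro tendsto_mult tendsto_const LIMSEQ_inverse_real_of_nat)
  then have e0: "\<epsilon> \<longlonglongrightarrow> 0" unfolding \<epsilon>_def[abs_def] by simp
  have ey: "y + 2 * \<epsilon> m \<le> b" "x + 2 * \<epsilon> m \<le> b" for m using e(2)[of m] xy by auto
  define \<phi> where "\<phi> m z = ramp ((z - x) / \<epsilon> m) - ramp ((z - y) / \<epsilon> m)" for m z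
  define \<psi> where "\<psi> m z = tent ((z - x) / \<epsilon> m) / \<epsilon> m - tent ((z - y) / \<epsilon> m) / \<epsilon> m" for m z
  have D: "(\<phi> m has_real_derivative \<psi> m z) (at z)" for m z
  proof -
    have "((\<lambda>z. ramp ((z - p) / \<epsilon> m)) has_real_derivative tent ((z - p) / \<epsilon> m) * (1 / \<epsilon> m)) (at z)" for p
      by (rule DERIV_chain2[OF DERIV_ramp]) (use e(1)[of m] in \<open>auto intro!: derivative_eq_intros\<close>)
    from DERIV_diff[OF this[of x] this[of y]] show ?thesis unfolding \<phi>_def \<psi>_def by simp
  qed
  have c\<psi>: "continuous_on S (\<psi> m)" for m S unfolding \<psi>_def
    using e(1)[of m] by (intro continuous_intros continuous_on_compose2[OF continuous_tent[of UNIV]]) auto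
  have c\<phi>: "continuous_on S (\<phi> m)" for m S
    using D by (meson DERIV_isCont continuous_at_imp_continuous_on)
  have "test_function a b (\<phi> m)" for m
    unfolding test_function_def
  proof
    show "\<phi> m C1_differentiable_on UNIV"
      unfolding C1_differentiable_on_def using D c\<psi> has_real_derivative_iff_has_vector_derivative by blast
    show "\<exists>c d. a < c \<and> d < b \<and> (\<forall>z. z \<notin> {c..d} \<longrightarrow> \<phi> m z = 0)"
    proof (intro exI conjI allI impI)
      show "a < x" by fact
      show "y + 2 * \<epsilon> m < b" using e(2)[of m] xy by simp
      fix z assume z: "z \<notin> {x..y + 2 * \<epsilon> m}"
      show "\<phi> m z = 0"
      proof (cases "z < x")
        case True
        then have "(z - x) / \<epsilon> m \<le> 0" "(z - y) / \<epsilon> m \<le> 0" using e(1)[of m] xy by (auto simp: divide_nonpos_pos)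
        then show ?thesis by (simp add: \<phi>_def ramp_simps)
      next
        case False
        then have "(z - x) / \<epsilon> m \<ge> 2" "(z - y) / \<epsilon> m \<ge> 2" using z e(1)[of m] xy by (auto simp: field_simps)
        then show ?thesis by (simp add: \<phi>_def ramp_simps)
      qed
    qed
  qed
  then have W: "integral\<^sup>L (lebesgue_on {a<..<b}) (\<lambda>z. w z * of_real (deriv (\<phi> m) z)) =
     - integral\<^sup>L (lebesgue_on {a<..<b}) (\<lambda>z. g z * of_real (\<phi> m z))" for m
    using wd by (simp add: has_weak_deriv_def)
  have gi: "g absolutely_integrable_on {a..b}" using g by (rule L2_absolutely_integrable)
  have \<phi>1: "\<bar>\<phi> m z\<bar> \<le> 1" for m z
    using ramp_bounds[of "(z - x) / \<epsilon> m"] ramp_bounds[of "(z - y) / \<epsilon> m"] by (auto simp: \<phi>_def)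
  have gm: "(\<lambda>z. g z * of_real (\<phi> m z)) absolutely_integrable_on {a..b}" for m
  proof -
    have "(\<lambda>z. complex_of_real (\<phi> m z) * g z) absolutely_integrable_on {a..b}"
    proof (rule absolutely_integrable_bounded_measurable_product[OF bounded_bilinear_mult[THEN bilinear_conv_bounded_bilinear[THEN iffD2]]])
      show "(\<lambda>z. complex_of_real (\<phi> m z)) \<in> borel_measurable (lebesgue_on {a..b})"
        by (intro continuous_imp_measurable_on_sets_lebesgue continuous_intros c\<phi>) auto
      show "bounded ((\<lambda>z. complex_of_real (\<phi> m z)) ` {a..b})"
        using \<phi>1 by (auto simp: bounded_iff intro!: exI[of _ 1])
    qed (use gi in auto)
    then show ?thesis by (simp add: mult.commute)
  qed
  have L: "integral {a..b} (\<lambda>z. w z * of_real (\<psi> m z)) = - integral {a..b} (\<lambda>z. g z * of_real (\<phi> m z))" for m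
  proof -
    have "(\<lambda>z. w z * of_real (\<psi> m z)) absolutely_integrable_on {a..b}"
      by (intro absolutely_integrable_continuous_real continuous_intros w c\<psi>)
    then show ?thesis
      using W[of m] lebesgue_integral_Ioo gm[of m] by (simp add: DERIV_imp_deriv[OF D] lebesgue_integral_Ioo)
  qed
  have "(\<lambda>m. integral {a..b} (\<lambda>z. w z * of_real (\<psi> m z))) \<longlonglongrightarrow> w x - w y"
  proof -
    have wt: "(\<lambda>z. w z * of_real (tent ((z - p) / \<epsilon> m) / \<epsilon> m)) integrable_on {a..b}" for p m
      using e(1)[of m]
      by (intro integrable_continuous_real continuous_intros w continuous_on_compose2[OF continuous_tent[of UNIV]]) auto
    have "integral {a..b} (\<lambda>z. w z * of_real (\<psi> m z)) =
      integral {a..b} (\<lambda>z. w z * of_real (tent ((z - x) / \<epsilon> m) / \<epsilon> m)) -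
      integral {a..b} (\<lambda>z. w z * of_real (tent ((z - y) / \<epsilon> m) / \<epsilon> m))" for m
      using integral_diff[OF wt[of x m] wt[of y m]] by (simp add: \<psi>_def right_diff_distrib)
    moreover have "(\<lambda>m. integral {a..b} (\<lambda>z. w z * of_real (tent ((z - x) / \<epsilon> m) / \<epsilon> m)) -
      integral {a..b} (\<lambda>z. w z * of_real (tent ((z - y) / \<epsilon> m) / \<epsilon> m))) \<longlonglongrightarrow> w x - w y"
      by (intro tendsto_diff tent_average_tendsto w e ey e0) (use xy in auto)
    ultimately show ?thesis by simp
  qed
  moreover have "(\<lambda>m. integral {a..b} (\<lambda>z. g z * of_real (\<phi> m z))) \<longlonglongrightarrow> integral {a..b} (\<lambda>z. if z \<in> {x<..y} then g z else 0)"
  proof (rule dominated_convergence(2))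
    show "(\<lambda>z. g z * of_real (\<phi> m z)) integrable_on {a..b}" for m
      using gm by (simp add: absolutely_integrable_on_def)
    show "(\<lambda>z. norm (g z)) integrable_on {a..b}" using gi by (simp add: absolutely_integrable_on_def)
    show "norm (g z * of_real (\<phi> m z)) \<le> norm (g z)" for m z
      using \<phi>1[of m z] by (simp add: norm_mult mult_left_le)
    show "(\<lambda>m. g z * of_real (\<phi> m z)) \<longlonglongrightarrow> (if z \<in> {x<..y} then g z else 0)" for z
    proof -
      have "(\<lambda>m. \<phi> m z) \<longlonglongrightarrow> (if z \<le> x then 0 else 1) - (if z \<le> y then 0 else 1)"
        unfolding \<phi>_def by (intro tendsto_diff ramp_tendsto e e0)
      then have "(\<lambda>m. g z * of_real (\<phi> m z)) \<longlonglongrightarrow> g z * of_real ((if z \<le> x then 0 else 1) - (if z \<le> y then 0 else 1))"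
        by (intro tendsto_intros)
      also have "g z * of_real ((if z \<le> x then 0 else 1) - (if z \<le> y then 0 else 1)) = (if z \<in> {x<..y} then g z else 0)"
        using xy by auto
      finally show ?thesis .
    qed
  qed
  then have "(\<lambda>m. - integral {a..b} (\<lambda>z. g z * of_real (\<phi> m z))) \<longlonglongrightarrow> - integral {a..b} (\<lambda>z. if z \<in> {x<..y} then g z else 0)"
    by (rule tendsto_minus)
  ultimately have "w x - w y = - integral {a..b} (\<lambda>z. if z \<in> {x<..y} then g z else 0)"
    unfolding L by (rule LIMSEQ_unique)
  also have "integral {a..b} (\<lambda>z. if z \<in> {x<..y} then g z else 0) = integral {x..y} g"
  proof -
    have "integral {a..b} (\<lambda>z. if z \<in> {x<..y} then g z else 0) = integral {a..b} (\<lambda>z. if z \<in> {x..y} then g z else 0)"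
      by (rule integral_spike[of "{x}"]) auto
    also have "\<dots> = integral {x..y} g"
    proof -
      have "g integrable_on {x..y}"
        by (rule integrable_on_subinterval[of _ "{a..b}"]) (use gi xy in \<open>auto simp: absolutely_integrable_on_def\<close>)
      then show ?thesis
        using has_integral_restrict_closed_subinterval[of g "integral {x..y} g" x y a b] xy
        by (auto simp: has_integral_iff)
    qed
    finally show ?thesis .
  qed
  finally show ?thesis by (simp add: algebra_simps)
qed

text \<open>The difference of \<open>w\<close> and the primitive of \<open>g\<close> is constant on
  the open interval by the interior increments, and continuity carries this to the endpoints, which
  compactly supported test functions do not reach.\<close>

lemma weak_deriv_eq_integral:
  assumes ab: "a < b" and w: "continuous_on {a..b} w" and g: "g \<in> L2 a b" and wd: "has_weak_deriv a b w g"
    and x: "x \<in> {a..b}"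
  shows "w x = w a + integral {a..x} g"
proof -
  have gi: "g integrable_on {a..b}"
    using L2_absolutely_integrable[OF g] by (simp add: absolutely_integrable_on_def)
  define H where "H z = w z - integral {a..z} g" for z
  have H: "continuous_on {a..b} H" unfolding H_def
    by (intro continuous_intros w indefinite_integral_continuous_1 gi)
  define c where "c = (a + b) / 2"
  have c: "c \<in> {a<..<b}" using ab by (simp add: c_def)
  have Hlt: "H p = H q" if "a < p" "p < q" "q < b" for p q
  proof -
    have "integral {a..p} g + integral {p..q} g = integral {a..q} g"
      using that by (intro Henstock_Kurzweil_Integration.integral_combine integrable_on_subinterval[OF gi]) auto
    then show ?thesis using weak_deriv_increment_interior[OF w g wd that] by (simp add: H_def algebra_simps)
  qed
  have "H z = H c" if "z \<in> {a<..<b}" for z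
    using Hlt[of z c] Hlt[of c z] that c by (cases z c rule: linorder_cases) auto
  then have "H z = H c" if "z \<in> closure {a<..<b}" for z
    using continuous_constant_on_closure[of "{a<..<b}" H "H c" z] H ab that by (simp add: closure_greaterThanLessThan)
  then have "H x = H c" "H a = H c" using x ab by (auto simp: closure_greaterThanLessThan)
  then have "H x = H a" by simp
  then show ?thesis by (simp add: H_def algebra_simps)
qed

section \<open>Integration by parts and norm inequalities on an interval\<close>

lemma absolutely_integrable_mult_continuous:
  fixes f Q :: "real \<Rightarrow> complex"
  assumes f: "f absolutely_integrable_on {a..b}" and Q: "continuous_on {a..b} Q"
  shows "(\<lambda>z. f z * Q z) absolutely_integrable_on {a..b}"
proof -
  have "(\<lambda>z. Q z * f z) absolutely_integrable_on {a..b}"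
  proof (rule absolutely_integrable_bounded_measurable_product[OF bounded_bilinear_mult[THEN bilinear_conv_bounded_bilinear[THEN iffD2]]])
    show "Q \<in> borel_measurable (lebesgue_on {a..b})"
      by (intro continuous_imp_measurable_on_sets_lebesgue Q) auto
    show "bounded (Q ` {a..b})"
      by (intro compact_imp_bounded compact_continuous_image Q) auto
  qed (use f in auto)
  then show ?thesis by (simp add: mult.commute)
qed

lemma norm_integral_le:
  fixes f :: "real \<Rightarrow> complex"
  assumes "f absolutely_integrable_on {a..b}"
  shows "cmod (integral {a..b} f) \<le> integral {a..b} (\<lambda>x. cmod (f x))"
  using assms by (intro integral_norm_bound_integral) (auto simp: absolutely_integrable_on_def)

lemma absolutely_integrable_sub:
  fixes f :: "real \<Rightarrow> 'a::euclidean_space"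
  assumes "f absolutely_integrable_on {a..b}" "a \<le> c" "d \<le> b"
  shows "f absolutely_integrable_on {c..d}"
  by (rule absolutely_integrable_on_subinterval[OF assms(1)]) (use assms in auto)

text \<open>Nonnegativity of the integral of \<open>(g - c)^2\<close>, where \<open>c\<close> is the
  mean value of \<open>g\<close>.\<close>

lemma integral_cauchy:
  fixes g :: "real \<Rightarrow> real"
  assumes ab: "a \<le> b" and g: "g integrable_on {a..b}" "(\<lambda>x. (g x)\<^sup>2) integrable_on {a..b}"
  shows "(integral {a..b} g)\<^sup>2 \<le> (b - a) * integral {a..b} (\<lambda>x. (g x)\<^sup>2)"
proof (cases "a = b")
  case False
  then have ab: "a < b" using ab by simp
  define I S c where "I = integral {a..b} g" and "S = integral {a..b} (\<lambda>x. (g x)\<^sup>2)" and "c = I / (b - a)"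
  have "((\<lambda>x. (g x)\<^sup>2 - 2 * c * g x + c\<^sup>2) has_integral S - 2 * c * I + c\<^sup>2 * (b - a)) {a..b}"
    unfolding I_def S_def using g has_integral_const_real[of "c\<^sup>2" a b] ab
    by (intro has_integral_add has_integral_diff has_integral_mult_right) (auto simp: has_integral_iff)
  moreover have "(g x)\<^sup>2 - 2 * c * g x + c\<^sup>2 = (g x - c)\<^sup>2" for x by (simp add: power2_eq_square algebra_simps)
  ultimately have "((\<lambda>x. (g x - c)\<^sup>2) has_integral S - 2 * c * I + c\<^sup>2 * (b - a)) {a..b}" by simp
  then have "0 \<le> S - 2 * c * I + c\<^sup>2 * (b - a)" by (rule has_integral_nonneg) simp
  also have "S - 2 * c * I + c\<^sup>2 * (b - a) = S - I\<^sup>2 / (b - a)"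
  proof -
    have "S - 2 * (I / L) * I + (I / L)\<^sup>2 * L = S - I\<^sup>2 / L" if "L > 0" for L
      using that by (simp add: field_simps power2_eq_square)
    from this[of "b - a"] ab show ?thesis by (simp add: c_def)
  qed
  finally have "I\<^sup>2 / (b - a) \<le> S" by simp
  then have "I\<^sup>2 \<le> S * (b - a)" using ab by (simp only: pos_divide_le_eq diff_gt_0_iff_gt)
  then show ?thesis by (simp add: I_def S_def mult.commute)
qed simp

text \<open>The remainder on a cell is bounded by the cell length times the increment of \<open>\<integral>|p|\<close>;
  summing over ever finer partitions shows that it vanishes.\<close>

lemma absolutely_continuous_by_parts:
  fixes P Q p q :: "real \<Rightarrow> complex"
  assumes ab: "a \<le> b" and p: "p absolutely_integrable_on {a..b}"
    and P: "\<And>z. z \<in> {a..b} \<Longrightarrow> P z = P a + integral {a..z} p"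
    and Q: "\<And>z. z \<in> {a..b} \<Longrightarrow> (Q has_vector_derivative q z) (at z within {a..b})"
    and q: "continuous_on {a..b} q"
  shows "((\<lambda>z. p z * Q z + P z * q z) has_integral P b * Q b - P a * Q a) {a..b}"
proof -
  have pint: "p integrable_on {a..b}" "(\<lambda>z. cmod (p z)) integrable_on {a..b}"
    using p by (auto simp: absolutely_integrable_on_def)
  have Qc: "continuous_on {a..b} Q"
    using Q by (meson continuous_on_eq_continuous_within has_vector_derivative_continuous)
  have Pc: "continuous_on {a..b} P"
  proof -
    have "continuous_on {a..b} (\<lambda>z. P a + integral {a..z} p)"
      by (intro continuous_intros indefinite_integral_continuous_1 pint)
    then show ?thesis by (rule continuous_on_eq) (rule P[symmetric])
  qed
  define f where "f z = p z * Q z + P z * q z" for z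
  have "(\<lambda>z. P z * q z) absolutely_integrable_on {a..b}"
    by (intro absolutely_integrable_continuous_real continuous_on_mult Pc q)
  with absolutely_integrable_mult_continuous[OF p Qc] have "f absolutely_integrable_on {a..b}"
    unfolding f_def by (rule set_integral_add(1))
  then have fint: "f integrable_on {a..b}" by (simp add: absolutely_integrable_on_def)
  have "bounded (q ` {a..b})" by (intro compact_imp_bounded compact_continuous_image q) auto
  then obtain B where B: "B > 0" "\<And>z. z \<in> {a..b} \<Longrightarrow> cmod (q z) \<le> B"
    by (auto simp: bounded_pos)
  define M where "M z = integral {a..z} (\<lambda>z. cmod (p z))" for z
  define H where "H z = P z * Q z - integral {a..z} f" for z
  have local: "cmod (H z - H x) \<le> 2 * B * (z - x) * (M z - M x)" if xz: "a \<le> x" "x \<le> z" "z \<le> b" for x z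
  proof -
    have sub: "{x..z} \<subseteq> {a..b}" using xz by auto
    have comb: "integral {a..z} g - integral {a..x} g = integral {x..z} g"
      if "g integrable_on {a..b}" for g :: "real \<Rightarrow> 'c::euclidean_space"
      using Henstock_Kurzweil_Integration.integral_combine[of a x z g] xz
        integrable_on_subinterval[OF that, of a z] by (auto simp: algebra_simps)
    have Mz: "M z - M x = integral {x..z} (\<lambda>z. cmod (p z))" unfolding M_def by (rule comb) (rule pint)
    have Pz: "P z - P x = integral {x..z} p" using P[of z] P[of x] comb[OF pint(1)] xz by simp
    have Ps: "cmod (P s - P x) \<le> M z - M x" if s: "s \<in> {x..z}" for s
    proof -
      have ps: "p absolutely_integrable_on {x..s}" by (rule absolutely_integrable_sub[OF p]) (use xz s in auto)
      have "P s - P x = integral {x..s} p"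
        using P[of s] P[of x] xz s Henstock_Kurzweil_Integration.integral_combine[of a x s p]
          integrable_on_subinterval[OF pint(1), of a s] by (auto simp: algebra_simps)
      then have "cmod (P s - P x) \<le> integral {x..s} (\<lambda>z. cmod (p z))" using norm_integral_le[OF ps] by simp
      also have "\<dots> \<le> integral {x..z} (\<lambda>z. cmod (p z))"
        using s xz by (intro integral_subset_le integrable_on_subinterval[OF pint(2)]) auto
      finally show ?thesis unfolding Mz .
    qed
    have qi: "(q has_integral Q z - Q x) {x..z}"
      by (rule fundamental_theorem_of_calculus[OF xz(2)])
        (use Q sub in \<open>blast intro: has_vector_derivative_within_subset\<close>)
    have Qs: "cmod (Q z - Q s) \<le> B * (z - x)" if s: "s \<in> {x..z}" for s
    proof -
      have "(q has_integral Q z - Q s) {s..z}"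
      proof (rule fundamental_theorem_of_calculus)
        fix r assume "r \<in> {s..z}"
        then show "(Q has_vector_derivative q r) (at r within {s..z})"
          using s xz by (intro has_vector_derivative_within_subset[OF Q]) auto
      qed (use s in simp)
      then have "cmod (Q z - Q s) \<le> B * measure lborel {s..z}"
        using B sub s by (intro has_integral_bound_real[where f = q and S = "{}"]) auto
      also have "\<dots> \<le> B * (z - x)" using s B by simp
      finally show ?thesis .
    qed
    have pz: "p absolutely_integrable_on {x..z}" by (rule absolutely_integrable_sub[OF p]) (use xz in auto)
    have e1: "((\<lambda>s. p s * Q z) has_integral (P z - P x) * Q z) {x..z}"
      unfolding Pz using pz by (intro has_integral_mult_left) (auto simp: absolutely_integrable_on_def)
    have e2: "((\<lambda>s. P x * q s) has_integral P x * (Q z - Q x)) {x..z}"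
      by (rule has_integral_mult_right[OF qi])
    have e3: "(f has_integral integral {x..z} f) {x..z}"
      using integrable_on_subinterval[OF fint sub] by (rule integrable_integral)
    \<comment> \<open>With \<open>Q\<close> frozen at the right end and \<open>P\<close> at the left
      end, the integrand integrates exactly to the increment of \<open>P Q\<close>; the freezing
      error is a product of two small factors.\<close>
    have "((\<lambda>s. p s * Q z + P x * q s - f s) has_integral (P z - P x) * Q z + P x * (Q z - Q x) - integral {x..z} f) {x..z}"
      by (intro has_integral_diff has_integral_add e1 e2 e3)
    moreover have "(P z - P x) * Q z + P x * (Q z - Q x) - integral {x..z} f = H z - H x"
      unfolding H_def comb[OF fint, symmetric] by (simp add: algebra_simps)
    ultimately have HI: "((\<lambda>s. p s * Q z + P x * q s - f s) has_integral H z - H x) {x..z}" by simp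
    have "cmod (H z - H x) \<le> integral {x..z} (\<lambda>s. B * (z - x) * cmod (p s) + B * (M z - M x))"
      unfolding integral_unique[OF HI, symmetric]
    proof (rule integral_norm_bound_integral)
      show "(\<lambda>s. p s * Q z + P x * q s - f s) integrable_on {x..z}" using HI by auto
      show "(\<lambda>s. B * (z - x) * cmod (p s) + B * (M z - M x)) integrable_on {x..z}"
        using pz by (intro integrable_add integrable_on_mult_right integrable_const_ivl) (auto simp: absolutely_integrable_on_def)
      fix s assume s: "s \<in> {x..z}"
      have "p s * Q z + P x * q s - f s = p s * (Q z - Q s) - (P s - P x) * q s" by (simp add: f_def algebra_simps)
      also have "cmod \<dots> \<le> cmod (p s) * cmod (Q z - Q s) + cmod (P s - P x) * cmod (q s)"
        by (rule order_trans[OF norm_triangle_ineq4]) (simp add: norm_mult)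
      also have "\<dots> \<le> cmod (p s) * (B * (z - x)) + (M z - M x) * B"
        using Qs[OF s] Ps[OF s] B s sub order_trans[OF norm_ge_zero Ps[OF s]]
        by (intro add_mono mult_left_mono mult_mono) auto
      finally show "cmod (p s * Q z + P x * q s - f s) \<le> B * (z - x) * cmod (p s) + B * (M z - M x)"
        by (simp add: mult_ac)
    qed
    also have "\<dots> = B * (z - x) * (M z - M x) + B * (M z - M x) * (z - x)"
    proof -
      have "((\<lambda>s. B * (z - x) * cmod (p s) + B * (M z - M x)) has_integral
          B * (z - x) * (M z - M x) + (z - x) *\<^sub>R (B * (M z - M x))) {x..z}"
        unfolding Mz using pz xz
        by (intro has_integral_add has_integral_mult_right has_integral_const_real[THEN has_integral_eq_rhs])
          (auto simp: absolutely_integrable_on_def)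
      then show ?thesis by (simp add: integral_unique)
    qed
    finally show ?thesis by (simp add: algebra_simps)
  qed
  have "cmod (H b - H a) \<le> 2 * B * ((b - a) / N) * M b" if N: "N > 0" for N :: nat
  proof -
    define w where "w = (b - a) / N"
    have w: "w \<ge> 0" "real N * w = b - a" using ab N by (simp_all add: w_def)
    define x where "x i = a + real i * w" for i :: nat
    have x_Suc: "x (Suc i) = x i + w" for i by (simp add: x_def algebra_simps)
    have x: "a \<le> x i" "x i \<le> x (Suc i)" for i
    proof -
      show "a \<le> x i" using w by (simp add: x_def)
      show "x i \<le> x (Suc i)" using w by (simp add: x_Suc)
    qed
    have xb: "x i \<le> b" if "i \<le> N" for i
    proof -
      have "real i * w \<le> real N * w" using that w by (intro mult_right_mono) auto
      then show ?thesis using w by (simp add: x_def)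
    qed
    have "cmod (H (x i) - H a) \<le> 2 * B * w * M (x i)" if "i \<le> N" for i
      using that
    proof (induction i)
      case 0
      then show ?case by (simp add: x_def M_def)
    next
      case (Suc i)
      have "x (Suc i) - x i = w" by (simp add: x_Suc)
      then have "cmod (H (x (Suc i)) - H (x i)) \<le> 2 * B * w * (M (x (Suc i)) - M (x i))"
        using local[of "x i" "x (Suc i)"] x xb Suc by simp
      moreover have "cmod (H (x (Suc i)) - H a) \<le> cmod (H (x (Suc i)) - H (x i)) + cmod (H (x i) - H a)"
        using norm_triangle_ineq[of "H (x (Suc i)) - H (x i)" "H (x i) - H a"] by simp
      moreover have "cmod (H (x i) - H a) \<le> 2 * B * w * M (x i)" using Suc by simp
      ultimately show ?case unfolding right_diff_distrib by linarith
    qed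
    from this[of N] show ?thesis using w by (simp add: x_def w_def)
  qed
  then have "cmod (H b - H a) \<le> 2 * B * (b - a) * M b * inverse (real (Suc m))" for m
    by (metis (no_types, opaque_lifting) divide_inverse mult.assoc mult.commute zero_less_Suc)
  moreover have "(\<lambda>m. 2 * B * (b - a) * M b * inverse (real (Suc m))) \<longlonglongrightarrow> 2 * B * (b - a) * M b * 0"
    by (intro tendsto_mult tendsto_const LIMSEQ_inverse_real_of_nat)
  then have "(\<lambda>m. 2 * B * (b - a) * M b * inverse (real (Suc m))) \<longlonglongrightarrow> 0" by simp
  ultimately have "cmod (H b - H a) \<le> 0" by (intro LIMSEQ_le_const) auto
  then have "integral {a..b} f = P b * Q b - P a * Q a" by (simp add: H_def algebra_simps)
  then show ?thesis using fint unfolding f_def by (metis integrable_integral)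
qed

lemma L2norm_alt: "L2norm \<phi> = sqrt (integral\<^sup>L (lebesgue_on {0<..<1}) (\<lambda>x. (cmod (\<phi> x))\<^sup>2))"
proof -
  have "ip \<phi> \<phi> = integral\<^sup>L (lebesgue_on {0<..<1}) (\<lambda>x. complex_of_real ((cmod (\<phi> x))\<^sup>2))"
    unfolding ip_def by (simp only: complex_norm_square)
  then show ?thesis by (simp only: L2norm_def integral_complex_of_real Re_complex_of_real)
qed

lemma L2norm_L2: "f \<in> L2 0 1 \<Longrightarrow> (L2norm f)\<^sup>2 = integral {0..1} (\<lambda>x. (cmod (f x))\<^sup>2)"
  unfolding L2norm_alt lebesgue_integral_Ioo[OF L2_square_integrable]
  by (subst real_sqrt_pow2) (auto intro!: integral_nonneg simp: L2_square_integrable absolutely_integrable_on_def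
      dest!: L2_square_integrable)

lemma L2norm_nonneg: "L2norm f \<ge> 0"
  unfolding L2norm_alt by (simp add: integral_nonneg)

lemma integral_norm_le_L2:
  assumes f: "f \<in> L2 0 1" and c: "0 \<le> c" "c \<le> d" "d \<le> 1"
  shows "(integral {c..d} (\<lambda>x. cmod (f x)))\<^sup>2 \<le> (d - c) * integral {c..d} (\<lambda>x. (cmod (f x))\<^sup>2)"
proof (rule integral_cauchy[OF c(2)])
  show "(\<lambda>x. cmod (f x)) integrable_on {c..d}"
    using absolutely_integrable_sub[OF L2_absolutely_integrable[OF f] c(1,3)] by (simp add: absolutely_integrable_on_def)
  show "(\<lambda>x. (cmod (f x))\<^sup>2) integrable_on {c..d}"
    using absolutely_integrable_sub[OF L2_square_integrable[OF f] c(1,3)] by (simp add: absolutely_integrable_on_def)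
qed

lemma integral_le_spike:
  fixes f g :: "real \<Rightarrow> real"
  assumes S: "negligible S" and f: "f integrable_on T" and g: "g integrable_on T"
    and le: "\<And>x. x \<in> T - S \<Longrightarrow> f x \<le> g x"
  shows "integral T f \<le> integral T g"
proof -
  have "integral T f = integral T (\<lambda>x. if x \<in> S then g x else f x)"
    by (rule integral_spike[OF S]) auto
  also have "\<dots> \<le> integral T g"
    by (rule integral_le[OF integrable_spike[OF f S] g]) (use le in auto)
  finally show ?thesis .
qed

section \<open>Stability and regularity of the Helmholtz problem\<close>

text \<open>\<open>v = u'\<close>, \<open>q = u''\<close>, and the differential equation holds off the null set \<open>S\<close>.\<close>

locale helmholtz_solution =
  fixes k :: real and f u v q :: "real \<Rightarrow> complex" and S :: "real set"
  assumes k: "k \<ge> 1" and f: "f \<in> L2 0 1" and q: "q \<in> L2 0 1"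
    and v_cont: "continuous_on {0..1} v"
    and u0: "u 0 = 0"
    and u_eq: "\<And>z. z \<in> {0..1} \<Longrightarrow> u z = integral {0..z} v"
    and v_eq: "\<And>z. z \<in> {0..1} \<Longrightarrow> v z = v 0 + integral {0..z} q"
    and S: "negligible S"
    and ode: "\<And>z. z \<in> {0..1} - S \<Longrightarrow> f z = - q z - (of_real k)\<^sup>2 * u z"
    and bc: "v 1 = \<i> * of_real k * u 1"
begin

definition "F = L2norm f"

lemma F: "F \<ge> 0" "F\<^sup>2 = integral {0..1} (\<lambda>x. (cmod (f x))\<^sup>2)"
  by (simp_all add: F_def L2norm_nonneg L2norm_L2[OF f])

lemma f_ai: "0 \<le> c \<Longrightarrow> d \<le> 1 \<Longrightarrow> f absolutely_integrable_on {c..d}"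
  by (rule absolutely_integrable_sub[OF L2_absolutely_integrable[OF f]])

lemma q_ai: "0 \<le> c \<Longrightarrow> d \<le> 1 \<Longrightarrow> q absolutely_integrable_on {c..d}"
  by (rule absolutely_integrable_sub[OF L2_absolutely_integrable[OF q]])

lemma v_ai: "0 \<le> c \<Longrightarrow> d \<le> 1 \<Longrightarrow> v absolutely_integrable_on {c..d}"
  by (rule absolutely_integrable_sub[OF absolutely_integrable_continuous_real[OF v_cont]])

lemma increment:
  assumes "0 \<le> x" "x \<le> z" "z \<le> 1"
  shows "u z - u x = integral {x..z} v" and "v z - v x = integral {x..z} q"
proof -
  have c: "integral {0..x} g + integral {x..z} g = integral {0..z} g"
    if "g absolutely_integrable_on {0..z}" for g :: "real \<Rightarrow> complex"
    by (rule Henstock_Kurzweil_Integration.integral_combine) (use assms that in \<open>auto simp: absolutely_integrable_on_def\<close>)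
  have "u z = integral {0..z} v" "u x = integral {0..x} v" using assms by (auto intro!: u_eq)
  then show "u z - u x = integral {x..z} v" using c[OF v_ai] assms by (simp add: algebra_simps)
  have "v z = v 0 + integral {0..z} q" "v x = v 0 + integral {0..x} q" using assms by (auto intro!: v_eq)
  then show "v z - v x = integral {x..z} q" using c[OF q_ai] assms by (metis add_diff_cancel_left add_diff_cancel_left' order.refl)
qed

lemma u_deriv: "z \<in> {0..1} \<Longrightarrow> (u has_vector_derivative v z) (at z within {0..1})"
proof (rule has_vector_derivative_transform[where f = "\<lambda>z. integral {0..z} v"])
  assume "z \<in> {0..1}"
  then show "((\<lambda>z. integral {0..z} v) has_vector_derivative v z) (at z within {0..1})"
    by (rule integral_has_vector_derivative[OF v_cont])
qed (simp_all add: u_eq)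

lemma u_cont: "continuous_on {0..1} u"
  using u_deriv by (meson continuous_on_eq_continuous_within has_vector_derivative_continuous)

lemma norm_f_integral: "0 \<le> c \<Longrightarrow> c \<le> d \<Longrightarrow> d \<le> 1 \<Longrightarrow> integral {c..d} (\<lambda>x. cmod (f x)) \<le> F"
proof -
  assume c: "0 \<le> c" "c \<le> d" "d \<le> 1"
  have "integral {c..d} (\<lambda>x. cmod (f x)) \<le> integral {0..1} (\<lambda>x. cmod (f x))"
    using f_ai[of 0 1] f_ai[of c d] c by (intro integral_subset_le) (auto simp: absolutely_integrable_on_def)
  also have "\<dots> \<le> F"
    by (rule power2_le_imp_le) (use integral_norm_le_L2[OF f, of 0 1] F in auto)
  finally show ?thesis .
qed

text \<open>Factoring the operator: \<open>P = u' - \<i> \<kappa> u\<close> satisfies \<open>P' + \<i> \<kappa> P = - f\<close> for \<open>\<kappa> = k\<close> and \<open>\<kappa> = - k\<close>.\<close>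

lemma transport:
  fixes \<kappa> :: real
  assumes \<kappa>: "\<kappa>\<^sup>2 = k\<^sup>2" and xy: "0 \<le> x" "x \<le> y" "y \<le> 1"
  defines "P \<equiv> \<lambda>z. v z - \<i> * of_real \<kappa> * u z"
  shows "cmod (P y * exp (\<i> * of_real (\<kappa> * y)) - P x * exp (\<i> * of_real (\<kappa> * x))) \<le> F"
proof -
  define Q where "Q z = exp (\<i> * of_real (\<kappa> * z))" for z :: real
  define p where "p z = q z - \<i> * of_real \<kappa> * v z" for z
  have vx: "v absolutely_integrable_on {x..z}" "q absolutely_integrable_on {x..z}" if "z \<le> 1" for z
    using v_ai q_ai xy that by auto
  have p: "p absolutely_integrable_on {x..z}" if "z \<le> 1" for z
    unfolding p_def using vx[OF that] by (intro set_integral_diff(1) set_integrable_mult_right) auto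
  have "((\<lambda>z. p z * Q z + P z * (\<i> * of_real \<kappa> * Q z)) has_integral P y * Q y - P x * Q x) {x..y}"
  proof (rule absolutely_continuous_by_parts[OF xy(2) p[OF xy(3)]])
    fix z assume z: "z \<in> {x..y}"
    have "integral {x..z} p = (v z - v x) - \<i> * of_real \<kappa> * (u z - u x)"
    proof -
      have "(q has_integral v z - v x) {x..z}" "(v has_integral u z - u x) {x..z}"
        using increment[of x z] xy z vx[of z] by (auto simp: absolutely_integrable_on_def has_integral_iff)
      from has_integral_diff[OF this(1) has_integral_mult_right[OF this(2), of "\<i> * of_real \<kappa>"]]
      show ?thesis unfolding p_def by (rule integral_unique)
    qed
    then show "P z = P x + integral {x..z} p" by (simp add: P_def algebra_simps)
    show "(Q has_vector_derivative \<i> * of_real \<kappa> * Q z) (at z within {x..y})"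
    proof -
      have "((\<lambda>z. exp (\<i> * of_real \<kappa> * z)) has_field_derivative exp (\<i> * of_real \<kappa> * of_real z) * (\<i> * of_real \<kappa>)) (at (of_real z))"
        by (auto intro!: derivative_eq_intros)
      from has_vector_derivative_real_field[OF this, of "{x..y}"]
      show ?thesis unfolding Q_def[abs_def] by (simp add: o_def mult_ac)
    qed
  next
    show "continuous_on {x..y} (\<lambda>z. \<i> * of_real \<kappa> * Q z)" unfolding Q_def by (intro continuous_intros)
  qed
  then have I: "((\<lambda>z. - (f z * Q z)) has_integral P y * Q y - P x * Q x) {x..y}"
  proof (rule has_integral_spike[OF S, rotated])
    fix z assume "z \<in> {x..y} - S"
    then have "q z = - f z - (of_real k)\<^sup>2 * u z" using ode[of z] xy by auto
    moreover have "(complex_of_real k)\<^sup>2 = (of_real \<kappa>)\<^sup>2" using \<kappa> by (metis of_real_power)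
    ultimately have "q z + (of_real \<kappa>)\<^sup>2 * u z = - f z" by simp
    moreover have "p z * Q z + P z * (\<i> * of_real \<kappa> * Q z) = (q z + (of_real \<kappa>)\<^sup>2 * u z) * Q z"
      by (simp add: p_def P_def algebra_simps power2_eq_square)
    ultimately show "- (f z * Q z) = p z * Q z + P z * (\<i> * of_real \<kappa> * Q z)" by simp
  qed
  have fy: "f absolutely_integrable_on {x..y}" using xy by (intro f_ai) auto
  have Q1: "cmod (Q z) = 1" for z by (simp add: Q_def)
  have "cmod (P y * Q y - P x * Q x) \<le> integral {x..y} (\<lambda>z. cmod (f z))"
    unfolding integral_unique[OF I, symmetric]
    by (rule integral_norm_bound_integral) (use I fy Q1 in \<open>auto simp: norm_mult absolutely_integrable_on_def\<close>)
  also have "\<dots> \<le> F" using xy by (intro norm_f_integral) auto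
  finally show ?thesis by (simp add: Q_def)
qed

text \<open>For \<open>\<kappa> = k\<close> the Robin condition gives \<open>P 1 = 0\<close>, so
  \<open>P\<close> is bounded everywhere, in particular \<open>v 0\<close>, because
  \<open>u 0 = 0\<close>. That is the initial value of the factor with
  \<open>\<kappa> = - k\<close>. Sum and difference of the two factors give \<open>v\<close> and
  \<open>u\<close>.\<close>

lemma stability:
  assumes x: "0 \<le> x" "x \<le> 1"
  shows "cmod (v x) \<le> 2 * F" and "k * cmod (u x) \<le> 2 * F"
proof -
  have a: "cmod (v z - \<i> * of_real k * u z) \<le> F" if "0 \<le> z" "z \<le> 1" for z
    using transport[of k z 1] that by (simp add: bc norm_mult)
  have "cmod ((v x - \<i> * of_real (- k) * u x) * exp (\<i> * of_real (- k * x)) - v 0) \<le> F"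
    using transport[of "- k" 0 x] x by (simp add: u0)
  moreover have "cmod (v 0) \<le> F" using a[of 0] by (simp add: u0)
  ultimately have "cmod ((v x - \<i> * of_real (- k) * u x) * exp (\<i> * of_real (- k * x))) \<le> 2 * F"
    using norm_triangle_sub[of "(v x - \<i> * of_real (- k) * u x) * exp (\<i> * of_real (- k * x))" "v 0"] by linarith
  then have b: "cmod (v x + \<i> * of_real k * u x) \<le> 2 * F" by (simp add: norm_mult)
  have a: "cmod (v x - \<i> * of_real k * u x) \<le> F" using a x by simp
  have "2 * cmod (v x) = cmod ((v x - \<i> * of_real k * u x) + (v x + \<i> * of_real k * u x))"
    by (simp flip: mult_2 add: norm_mult)
  also have "\<dots> \<le> F + 2 * F" by (rule order_trans[OF norm_triangle_ineq add_mono[OF a b]])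
  finally show "cmod (v x) \<le> 2 * F" using F(1) by linarith
  have "(v x + \<i> * of_real k * u x) - (v x - \<i> * of_real k * u x) = 2 * \<i> * of_real k * u x"
    by (simp add: algebra_simps)
  then have "2 * (k * cmod (u x)) = cmod ((v x + \<i> * of_real k * u x) - (v x - \<i> * of_real k * u x))"
    using k by (simp add: norm_mult)
  also have "\<dots> \<le> 2 * F + F" by (rule order_trans[OF norm_triangle_ineq4 add_mono[OF b a]])
  finally show "k * cmod (u x) \<le> 2 * F" using F(1) by linarith
qed

text \<open>The variation of \<open>u'\<close> on an interval. Every approximation error on a cell
  is expressed by it.\<close>

definition "m x y = integral {x..y} (\<lambda>z. cmod (q z))"

lemma q_norm: "z \<in> {0..1} - S \<Longrightarrow> cmod (q z) \<le> cmod (f z) + 2 * k * F"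
proof -
  assume z: "z \<in> {0..1} - S"
  then have "q z = - (f z + (of_real k)\<^sup>2 * u z)" using ode[OF z] by simp
  then have "cmod (q z) = cmod (f z + (of_real k)\<^sup>2 * u z)" by (simp only: norm_minus_cancel)
  also have "\<dots> \<le> cmod (f z) + k * (k * cmod (u z))"
    using norm_triangle_ineq[of "f z" "(of_real k)\<^sup>2 * u z"] by (simp add: norm_mult norm_power power2_eq_square)
  also have "k * (k * cmod (u z)) \<le> k * (2 * F)" using stability(2)[of z] z k by (intro mult_left_mono) auto
  finally show ?thesis by simp
qed

lemma q_L1: "integral {0..1} (\<lambda>z. cmod (q z)) \<le> 3 * k * F"
proof -
  have fi: "(\<lambda>z. cmod (f z)) integrable_on {0..1}" using f_ai[of 0 1] by (simp add: absolutely_integrable_on_def)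
  have I: "((\<lambda>z. cmod (f z) + 2 * k * F) has_integral integral {0..1} (\<lambda>z. cmod (f z)) + 2 * k * F) {0..1}"
    using has_integral_add[OF integrable_integral[OF fi] has_integral_const_real[of "2 * k * F" 0 1]] by simp
  have "integral {0..1} (\<lambda>z. cmod (q z)) \<le> integral {0..1} (\<lambda>z. cmod (f z) + 2 * k * F)"
    by (rule integral_le_spike[OF S]) (use I q_ai[of 0 1] S q_norm in \<open>auto simp: absolutely_integrable_on_def\<close>)
  also have "\<dots> \<le> F + 2 * k * F" using norm_f_integral[of 0 1] by (simp add: integral_unique[OF I])
  also have "\<dots> \<le> 3 * k * F" using mult_right_mono[OF k F(1)] by simp
  finally show ?thesis .
qed

lemma q_L2: "integral {0..1} (\<lambda>z. (cmod (q z))\<^sup>2) \<le> 10 * k\<^sup>2 * F\<^sup>2"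
proof -
  have fi: "(\<lambda>z. (cmod (f z))\<^sup>2) integrable_on {0..1}"
    using L2_square_integrable[OF f] by (simp add: absolutely_integrable_on_def)
  have qi: "(\<lambda>z. (cmod (q z))\<^sup>2) integrable_on {0..1}"
    using L2_square_integrable[OF q] by (simp add: absolutely_integrable_on_def)
  have I: "((\<lambda>z. 2 * (cmod (f z))\<^sup>2 + 8 * k\<^sup>2 * F\<^sup>2) has_integral 2 * F\<^sup>2 + 8 * k\<^sup>2 * F\<^sup>2) {0..1}"
    using has_integral_add[OF has_integral_mult_right[OF integrable_integral[OF fi], of 2] has_integral_const_real[of "8 * k\<^sup>2 * F\<^sup>2" 0 1]]
    by (simp add: F(2))
  have "integral {0..1} (\<lambda>z. (cmod (q z))\<^sup>2) \<le> integral {0..1} (\<lambda>z. 2 * (cmod (f z))\<^sup>2 + 8 * k\<^sup>2 * F\<^sup>2)"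
  proof (rule integral_le_spike[OF S])
    fix z assume "z \<in> {0..1} - S"
    then have "(cmod (q z))\<^sup>2 \<le> (cmod (f z) + 2 * k * F)\<^sup>2" using q_norm by (intro power_mono) auto
    also have "\<dots> \<le> 2 * (cmod (f z))\<^sup>2 + 8 * k\<^sup>2 * F\<^sup>2"
      using sum_squares_bound[of "cmod (f z)" "2 * k * F"] by (simp add: power2_sum power_mult_distrib)
    finally show "(cmod (q z))\<^sup>2 \<le> 2 * (cmod (f z))\<^sup>2 + 8 * k\<^sup>2 * F\<^sup>2" .
  qed (use I qi S in auto)
  also have "\<dots> = 2 * F\<^sup>2 + 8 * k\<^sup>2 * F\<^sup>2" by (rule integral_unique[OF I])
  also have "\<dots> \<le> 10 * k\<^sup>2 * F\<^sup>2" using mult_right_mono[of 1 "k\<^sup>2" "F\<^sup>2"] k by simp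
  finally show ?thesis .
qed

lemma m_square: "0 \<le> x \<Longrightarrow> x \<le> y \<Longrightarrow> y \<le> 1 \<Longrightarrow> (m x y)\<^sup>2 \<le> (y - x) * integral {x..y} (\<lambda>z. (cmod (q z))\<^sup>2)"
  unfolding m_def by (rule integral_norm_le_L2[OF q])

lemma m_nonneg: "m x y \<ge> 0"
  unfolding m_def by (cases "(\<lambda>z. cmod (q z)) integrable_on {x..y}") (auto intro: integral_nonneg simp: not_integrable_integral)

lemma v_osc:
  assumes "0 \<le> x" "y \<le> 1" and z: "z \<in> {x..y}" and s: "s \<in> {x..y}"
  shows "cmod (v z - v s) \<le> m x y"
proof -
  have le: "cmod (v z - v s) \<le> m x y" if "s \<le> z" "s \<in> {x..y}" "z \<in> {x..y}" for z s
  proof -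
    have "v z - v s = integral {s..z} q" using that assms by (intro increment) auto
    then have "cmod (v z - v s) \<le> integral {s..z} (\<lambda>z. cmod (q z))"
      using norm_integral_le[OF q_ai[of s z]] that assms by simp
    also have "\<dots> \<le> m x y" unfolding m_def
      using q_ai[of s z] q_ai[of x y] that assms
      by (intro integral_subset_le) (auto simp: absolutely_integrable_on_def)
    finally show ?thesis .
  qed
  show ?thesis using le[of s z] le[of z s] z s by (cases "s \<le> z") (auto simp: norm_minus_commute)
qed

text \<open>The secant slope is the mean value of \<open>v\<close>, so it differs from each value of
  \<open>v\<close> by at most the oscillation.\<close>

lemma cell_slope:
  assumes xy: "0 \<le> x" "x < y" "y \<le> 1" and z: "z \<in> {x..y}"
  shows "cmod (v z - (u y - u x) / of_real (y - x)) \<le> m x y"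
proof -
  have I: "((\<lambda>s. v z - v s) has_integral of_real (y - x) * v z - (u y - u x)) {x..y}"
  proof -
    have "((\<lambda>s. v z) has_integral (y - x) *\<^sub>R v z) {x..y}" using has_integral_const_real[of "v z" x y] xy by simp
    moreover have "(v has_integral (u y - u x)) {x..y}"
      using increment(1)[of x y] v_ai[of x y] xy by (simp add: has_integral_iff absolutely_integrable_on_def)
    ultimately show ?thesis by (auto dest: has_integral_diff simp: scaleR_conv_of_real)
  qed
  have "cmod (of_real (y - x) * v z - (u y - u x)) \<le> m x y * measure lborel {x..y}"
    by (rule has_integral_bound_real[OF m_nonneg finite.emptyI I]) (use v_osc[OF xy(1,3) z] in auto)
  then have "cmod (of_real (y - x) * v z - (u y - u x)) \<le> m x y * (y - x)" using xy by simp
  moreover have "of_real (y - x) * v z - (u y - u x) = of_real (y - x) * (v z - (u y - u x) / of_real (y - x))"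
    using xy by (simp add: right_diff_distrib[of _ "v z"] del: of_real_diff)
  ultimately have "(y - x) * cmod (v z - (u y - u x) / of_real (y - x)) \<le> (y - x) * m x y"
    using xy by (simp add: norm_mult mult.commute del: of_real_diff)
  then show ?thesis using xy by simp
qed

text \<open>The interpolation error vanishes at \<open>x\<close> and its derivative is bounded by
  \<open>cell_slope\<close>.\<close>

lemma cell_interpolation:
  assumes xy: "0 \<le> x" "x < y" "y \<le> 1" and z: "z \<in> {x..y}"
  shows "cmod (u z - (u x + (u y - u x) / of_real (y - x) * of_real (z - x))) \<le> (y - x) * m x y"
proof -
  define \<beta> where "\<beta> = (u y - u x) / of_real (y - x)"
  have I: "((\<lambda>s. v s - \<beta>) has_integral (u z - u x) - of_real (z - x) * \<beta>) {x..z}"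
  proof -
    have "((\<lambda>s. \<beta>) has_integral (z - x) *\<^sub>R \<beta>) {x..z}" using has_integral_const_real[of \<beta> x z] z by simp
    moreover have "(v has_integral (u z - u x)) {x..z}"
      using increment(1)[of x z] v_ai[of x z] xy z by (simp add: has_integral_iff absolutely_integrable_on_def)
    ultimately show ?thesis by (auto dest: has_integral_diff simp: scaleR_conv_of_real)
  qed
  have "cmod ((u z - u x) - of_real (z - x) * \<beta>) \<le> m x y * measure lborel {x..z}"
    by (rule has_integral_bound_real[OF m_nonneg finite.emptyI I])
      (use cell_slope[OF xy] z in \<open>auto simp: \<beta>_def\<close>)
  also have "\<dots> \<le> m x y * (y - x)" using z m_nonneg by (intro mult_left_mono) auto
  finally show ?thesis by (simp add: \<beta>_def algebra_simps)
qed

lemma cell_by_parts: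
  assumes xy: "0 \<le> x" "x < y" "y \<le> 1"
  shows "((\<lambda>z. q z * (\<alpha> + \<beta> * of_real z)) has_integral
     v y * (\<alpha> + \<beta> * of_real y) - v x * (\<alpha> + \<beta> * of_real x) - (u y - u x) * \<beta>) {x..y}"
proof -
  have 1: "((\<lambda>z. q z * (\<alpha> + \<beta> * of_real z) + v z * \<beta>) has_integral
     v y * (\<alpha> + \<beta> * of_real y) - v x * (\<alpha> + \<beta> * of_real x)) {x..y}"
  proof (rule absolutely_continuous_by_parts)
    show "x \<le> y" using xy by simp
    show "q absolutely_integrable_on {x..y}" using xy by (intro q_ai) auto
    show "v z = v x + integral {x..z} q" if "z \<in> {x..y}" for z
      using increment(2)[of x z] xy that by (auto simp: algebra_simps)
    show "((\<lambda>z. \<alpha> + \<beta> * of_real z) has_vector_derivative \<beta>) (at z within {x..y})" for z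
      by (auto intro!: derivative_eq_intros simp: has_vector_derivative_def scaleR_conv_of_real mult.commute)
    show "continuous_on {x..y} (\<lambda>z. \<beta>)" by simp
  qed
  have "((\<lambda>z. v z * \<beta>) has_integral (u y - u x) * \<beta>) {x..y}"
    using increment(1)[of x y] v_ai[of x y] xy
    by (intro has_integral_mult_left) (auto simp: has_integral_iff absolutely_integrable_on_def)
  from has_integral_diff[OF 1 this] show ?thesis by simp
qed

end

lemma bvp_solution_imp_helmholtz:
  assumes "bvp_solution k f u" "k \<ge> 1" "f \<in> L2 0 1"
  shows "\<exists>v q S. helmholtz_solution k f u v q S"
proof -
  obtain v q where *: "v \<in> H1 0 1" "q \<in> L2 0 1" "has_weak_deriv 0 1 u v" "has_weak_deriv 0 1 v q"
    "AE x in lebesgue_on {0<..<1}. q x + (complex_of_real k)\<^sup>2 * u x = - f x"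
    "continuous_on {0..1} v" "v 1 - \<i> * complex_of_real k * u 1 = 0"
    and u: "continuous_on {0..1} u" "u 0 = 0"
    using assms(1) unfolding bvp_solution_def by blast
  have "AE x in lebesgue. x \<in> {0<..<1} \<longrightarrow> q x + (complex_of_real k)\<^sup>2 * u x = - f x"
    using *(5) by (simp add: AE_restrict_space_iff)
  then obtain S0 where S0: "S0 \<in> null_sets lebesgue"
    "{x. \<not> (x \<in> {0<..<1} \<longrightarrow> q x + (complex_of_real k)\<^sup>2 * u x = - f x)} \<subseteq> S0"
    by (auto simp: eventually_ae_filter)
  have "v \<in> L2 0 1" using *(1) by (simp add: H1_def)
  \<comment> \<open>The endpoints join the null set because the equation is given almost everywhere
    on the open interval, whereas the locale works on the closed one.\<close>
  have "helmholtz_solution k f u v q (S0 \<union> {0, 1})"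
  proof
    show "negligible (S0 \<union> {0, 1})" using S0(1) by (simp add: negligible_Un_eq negligible_iff_null_sets)
    fix z :: real
    show "u z = integral {0..z} v" if "z \<in> {0..1}"
      using weak_deriv_eq_integral[OF _ u(1) \<open>v \<in> L2 0 1\<close> *(3) that] u(2) by simp
    show "v z = v 0 + integral {0..z} q" if "z \<in> {0..1}"
      using weak_deriv_eq_integral[OF _ *(6,2,4) that] by simp
    show "f z = - q z - (complex_of_real k)\<^sup>2 * u z" if "z \<in> {0..1} - (S0 \<union> {0, 1})"
    proof -
      have "z \<in> {0<..<1}" using that by auto
      then have "q z + (complex_of_real k)\<^sup>2 * u z = - f z" using S0(2) that by blast
      then have "f z = - (q z + (complex_of_real k)\<^sup>2 * u z)" by simp
      then show ?thesis by simp
    qed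
    show "v 1 = \<i> * complex_of_real k * u 1" using *(7) by simp
  qed (use * u assms in auto)
  then show ?thesis by blast
qed

section \<open>Matrix form of the method\<close>

lemma node_simps:
  assumes "n > 0"
  shows "node n 0 = 0" "node n n = 1" "j \<ge> 1 \<Longrightarrow> real n * node n (j - 1) = real j - 1" "real n * node n j = real j"
    "j \<ge> 1 \<Longrightarrow> node n j - node n (j - 1) = 1 / n" "node n (Suc j) - node n j = 1 / n"
  using assms by (auto simp: node_def of_nat_diff field_simps)

lemma node_mono: "i \<le> j \<Longrightarrow> node n i \<le> node n j"
  by (simp add: node_def divide_right_mono)

lemma node_less: "n > 0 \<Longrightarrow> i < j \<Longrightarrow> node n i < node n j"
  by (simp add: node_def divide_strict_right_mono)

lemma node_bounds: "n > 0 \<Longrightarrow> j \<le> n \<Longrightarrow> 0 \<le> node n j \<and> node n j \<le> 1"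
  by (simp add: node_def)

abbreviation cell :: "nat \<Rightarrow> nat \<Rightarrow> real set" where
  "cell n j \<equiv> {node n (j - 1)..node n j}"

lemma cell_bounds: "n > 0 \<Longrightarrow> 1 \<le> j \<Longrightarrow> j \<le> n \<Longrightarrow> 0 \<le> node n (j - 1) \<and> node n (j - 1) < node n j \<and> node n j \<le> 1"
  using node_bounds[of n j] node_bounds[of n "j - 1"] node_less[of n "j - 1" j] by simp

lemma cells_absolutely_integrable:
  fixes G :: "real \<Rightarrow> 'a::euclidean_space"
  assumes n: "n > 0" and G: "\<And>j. 1 \<le> j \<Longrightarrow> j \<le> n \<Longrightarrow> G absolutely_integrable_on cell n j"
  shows "G absolutely_integrable_on {0..1}" and "integral {0..1} G = (\<Sum>j=1..n. integral (cell n j) G)"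
proof -
  have "G absolutely_integrable_on {0..node n m} \<and> integral {0..node n m} G = (\<Sum>j=1..m. integral (cell n j) G)"
    if "m \<le> n" for m
    using that
  proof (induction m)
    case 0
    then show ?case using n absolutely_integrable_negligible[of "{0::real}" G] by (simp add: node_simps)
  next
    case (Suc m)
    have c: "G absolutely_integrable_on {node n m..node n (Suc m)}" using G[of "Suc m"] Suc.prems by simp
    have nn: "0 \<le> node n m" "node n m \<le> node n (Suc m)" by (simp_all add: node_def divide_right_mono)
    have IH: "G absolutely_integrable_on {0..node n m}" "integral {0..node n m} G = (\<Sum>j=1..m. integral (cell n j) G)"
      using Suc by auto
    have A: "G absolutely_integrable_on {0..node n (Suc m)}"
      by (rule absolutely_integrable_on_combine[OF IH(1) c nn])
    have "integral {0..node n m} G + integral {node n m..node n (Suc m)} G = integral {0..node n (Suc m)} G"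
      by (rule Henstock_Kurzweil_Integration.integral_combine[OF nn]) (use A in \<open>simp add: absolutely_integrable_on_def\<close>)
    then show ?case using A IH(2) by simp
  qed
  from this[of n] show "G absolutely_integrable_on {0..1}" "integral {0..1} G = (\<Sum>j=1..n. integral (cell n j) G)"
    using n by (simp_all add: node_simps)
qed

lemma cells_integral:
  fixes G :: "real \<Rightarrow> 'a::euclidean_space"
  assumes n: "n > 0" and G: "\<And>j. 1 \<le> j \<Longrightarrow> j \<le> n \<Longrightarrow> G absolutely_integrable_on cell n j"
    and I: "\<And>j. 1 \<le> j \<Longrightarrow> j \<le> n \<Longrightarrow> integral (cell n j) G = I j"
  shows "integral\<^sup>L (lebesgue_on {0<..<1}) G = (\<Sum>j=1..n. I j)"
proof -
  have "integral\<^sup>L (lebesgue_on {0<..<1}) G = integral {0..1} G"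
    by (intro lebesgue_integral_Ioo cells_absolutely_integrable(1)[OF n] G)
  also have "\<dots> = (\<Sum>j=1..n. integral (cell n j) G)"
    by (intro cells_absolutely_integrable(2)[OF n] G)
  also have "\<dots> = (\<Sum>j=1..n. I j)" by (intro sum.cong refl I) auto
  finally show ?thesis .
qed

lemma linear_product_integral:
  fixes a b c d :: complex
  assumes n: "n > 0" and j: "1 \<le> j"
  shows "((\<lambda>z. (a + b * of_real (n * z - (real j - 1))) * (c + d * of_real (n * z - (real j - 1)))) has_integral
    (a * c + (a * d + b * c) / 2 + b * d / 3) / of_nat n) (cell n j)"
proof -
  define s where "s z = of_nat n * z - (of_nat j - 1)" for z :: complex
  define Fn where "Fn z = (a * c * s z + (a * d + b * c) * (s z)\<^sup>2 / 2 + b * d * (s z)^3 / 3) / of_nat n" for z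
  have s_real: "s (of_real z) = of_real (n * z - (real j - 1))" for z :: real by (simp add: s_def)
  have D: "(Fn has_field_derivative (a + b * s z) * (c + d * s z)) (at z)" for z
  proof -
    have ds: "(s has_field_derivative of_nat n) (at z)" unfolding s_def[abs_def]
      by (auto intro!: derivative_eq_intros)
    have "(Fn has_field_derivative (a * c * of_nat n + (a * d + b * c) * (2 * s z * of_nat n) / 2
        + b * d * (3 * (s z)\<^sup>2 * of_nat n) / 3) / of_nat n) (at z)"
      unfolding Fn_def[abs_def]
      by (intro DERIV_cdivide DERIV_add DERIV_cmult ds DERIV_cmult_right)
        (use DERIV_power[OF ds, of 2] DERIV_power[OF ds, of 3] in \<open>simp_all add: mult_ac\<close>)
    then show ?thesis by (rule DERIV_cong) (use n in \<open>simp add: field_simps power2_eq_square\<close>)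
  qed
  have "((\<lambda>z. (a + b * s (of_real z)) * (c + d * s (of_real z))) has_integral Fn (of_real (node n j)) - Fn (of_real (node n (j - 1)))) (cell n j)"
  proof (rule fundamental_theorem_of_calculus)
    show "node n (j - 1) \<le> node n j" by (rule node_mono) simp
    show "((\<lambda>z. Fn (of_real z)) has_vector_derivative (a + b * s (of_real z)) * (c + d * s (of_real z))) (at z within cell n j)" for z
      using has_vector_derivative_real_field[OF D[of "of_real z"]] by (simp add: o_def)
  qed
  moreover have "n * node n j - (real j - 1) = 1" "n * node n (j - 1) - (real j - 1) = 0"
    using node_simps(3)[OF n j] node_simps(4)[OF n] by simp_all
  then have "s (of_real (node n j)) = 1" "s (of_real (node n (j - 1))) = 0"
    by (simp_all only: s_real of_real_1 of_real_0)
  ultimately show ?thesis by (simp add: Fn_def s_real)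
qed

text \<open>\<open>Vh\<close> prescribes affine values on open cells only; continuity extends them
  to the nodes, where the coefficients are then read off.\<close>

lemma Vh_linear:
  assumes n: "n > 0" and v: "v \<in> Vh n" and j: "1 \<le> j" "j \<le> n" and x: "x \<in> cell n j"
  shows "v x = v (node n (j - 1)) + (v (node n j) - v (node n (j - 1))) * of_real (n * x - (real j - 1))"
proof -
  let ?l = "node n (j - 1)" and ?r = "node n j"
  have cb: "0 \<le> ?l" "?l < ?r" "?r \<le> 1" using cell_bounds[OF n j] by auto
  obtain \<alpha> \<beta> where ab: "\<And>x. x \<in> {?l<..<?r} \<Longrightarrow> v x = \<alpha> + \<beta> * of_real x"
    using v j unfolding Vh_def by fastforce
  have "continuous_on {?l..?r} v"
    using v cb unfolding Vh_def by (auto elim: continuous_on_subset)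
  then have "continuous_on (closure {?l<..<?r}) (\<lambda>x. v x - (\<alpha> + \<beta> * of_real x))"
    using cb by (intro continuous_intros) (simp add: closure_greaterThanLessThan)
  then have "v x - (\<alpha> + \<beta> * of_real x) = 0" if "x \<in> {?l..?r}" for x
    by (rule continuous_constant_on_closure) (use ab that cb in \<open>auto simp: closure_greaterThanLessThan\<close>)
  then have lin: "v x = \<alpha> + \<beta> * of_real x" if "x \<in> {?l..?r}" for x using that by fastforce
  define L R X where "L = complex_of_real ?l" and "R = complex_of_real ?r" and "X = complex_of_real x"
  have "n * x - (real j - 1) = n * (x - ?l)"
    using node_simps(3)[OF n j(1)] by (simp add: right_diff_distrib)
  then have X: "of_real (n * x - (real j - 1)) = of_nat n * (X - L)"
    by (simp only: of_real_mult of_real_diff of_real_of_nat_eq X_def L_def)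
  have "real n * (?r - ?l) = 1" using node_simps(5)[OF n j(1)] n by simp
  then have RL: "of_nat n * (R - L) = 1"
    unfolding R_def L_def by (metis of_real_1 of_real_diff of_real_mult of_real_of_nat_eq)
  have "(v ?r - v ?l) * (of_nat n * (X - L)) = \<beta> * (X - L) * (of_nat n * (R - L))"
    using lin[of ?l] lin[of ?r] cb by (simp add: L_def R_def algebra_simps)
  then have "(v ?r - v ?l) * (of_nat n * (X - L)) = \<beta> * (X - L)" unfolding RL by simp
  then show ?thesis unfolding X using lin[OF x] lin[of ?l] cb by (simp add: L_def X_def algebra_simps)
qed

lemma Vh_deriv:
  assumes n: "n > 0" and v: "v \<in> Vh n" and j: "1 \<le> j" "j \<le> n" and x: "x \<in> {node n (j - 1)<..<node n j}"
  shows "(v has_vector_derivative of_nat n * (v (node n j) - v (node n (j - 1)))) (at x)"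
proof -
  let ?l = "node n (j - 1)" and ?r = "node n j"
  have "((\<lambda>x. v ?l + (v ?r - v ?l) * of_real (n * x - (real j - 1))) has_vector_derivative of_nat n * (v ?r - v ?l)) (at x)"
    by (auto intro!: derivative_eq_intros simp: has_vector_derivative_def scaleR_conv_of_real mult_ac)
  then show ?thesis
  proof (rule has_vector_derivative_transform_within_open[where S = "{?l<..<?r}"])
    fix y assume "y \<in> {?l<..<?r}"
    then have "y \<in> cell n j" by simp
    then show "v ?l + (v ?r - v ?l) * of_real (n * y - (real j - 1)) = v y" by (rule Vh_linear[OF n v j, symmetric])
  qed (use x in auto)
qed

lemma D_Vh:
  assumes "n > 0" "v \<in> Vh n" "1 \<le> j" "j \<le> n" "x \<in> {node n (j - 1)<..<node n j}"
  shows "D v x = of_nat n * (v (node n j) - v (node n (j - 1)))"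
  unfolding D_def by (rule vector_derivative_at[OF Vh_deriv[OF assms]])

lemma Lim_left_D:
  assumes n: "n > 0" and v: "v \<in> Vh n" and j: "1 \<le> j" "j \<le> n"
  shows "Lim (at_left (node n j)) (D v) = of_nat n * (v (node n j) - v (node n (j - 1)))"
proof (rule tendsto_Lim)
  show "\<not> trivial_limit (at_left (node n j))" by simp
  have "\<forall>\<^sub>F x in at_left (node n j). D v x = of_nat n * (v (node n j) - v (node n (j - 1)))"
    unfolding eventually_at_left_field using D_Vh[OF n v j] cell_bounds[OF n j]
    by (intro exI[of _ "node n (j - 1)"]) auto
  then show "(D v \<longlongrightarrow> of_nat n * (v (node n j) - v (node n (j - 1)))) (at_left (node n j))"
    by (rule tendsto_eventually)
qed

lemma Lim_right_D:
  assumes n: "n > 0" and v: "v \<in> Vh n" and j: "j < n"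
  shows "Lim (at_right (node n j)) (D v) = of_nat n * (v (node n (j + 1)) - v (node n j))"
proof (rule tendsto_Lim)
  show "\<not> trivial_limit (at_right (node n j))" by simp
  have "\<forall>\<^sub>F x in at_right (node n j). D v x = of_nat n * (v (node n (j + 1)) - v (node n j))"
    unfolding eventually_at_right_field using D_Vh[OF n v, of "j + 1"] cell_bounds[OF n, of "j + 1"] j
    by (intro exI[of _ "node n (j + 1)"]) auto
  then show "(D v \<longlongrightarrow> of_nat n * (v (node n (j + 1)) - v (node n j))) (at_right (node n j))"
    by (rule tendsto_eventually)
qed

lemma ip_D_Vh:
  assumes n: "n > 0" and u: "u \<in> Vh n" and v: "v \<in> Vh n"
  defines "\<mu> \<equiv> \<lambda>j. u (node n j)" and "\<nu> \<equiv> \<lambda>j. v (node n j)"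
  shows "ip (D u) (D v) = of_nat n * (\<Sum>j=1..n. (\<mu> j - \<mu> (j - 1)) * cnj (\<nu> j - \<nu> (j - 1)))"
proof -
  have "integral\<^sup>L (lebesgue_on {0<..<1}) (\<lambda>x. D u x * cnj (D v x)) =
     (\<Sum>j=1..n. of_nat n * ((\<mu> j - \<mu> (j - 1)) * cnj (\<nu> j - \<nu> (j - 1))))"
  proof (rule cells_integral[OF n])
    fix j assume j: "1 \<le> j" "j \<le> n"
    define C where "C = of_nat n * (\<mu> j - \<mu> (j - 1)) * cnj (of_nat n * (\<nu> j - \<nu> (j - 1)))"
    have eq: "D u x * cnj (D v x) = C" if "x \<in> cell n j - {node n (j - 1), node n j}" for x
      using D_Vh[OF n u j, of x] D_Vh[OF n v j, of x] that by (auto simp: C_def \<mu>_def \<nu>_def)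
    have neg: "negligible {node n (j - 1), node n j}" by simp
    show "(\<lambda>x. D u x * cnj (D v x)) absolutely_integrable_on cell n j"
      by (rule absolutely_integrable_spike[where f = "\<lambda>_. C", OF _ neg eq])
        (auto intro!: absolutely_integrable_continuous_real)
    have "integral (cell n j) (\<lambda>x. D u x * cnj (D v x)) = integral (cell n j) (\<lambda>_. C)"
      by (rule integral_spike[OF neg]) (use eq in auto)
    also have "\<dots> = of_real (node n j - node n (j - 1)) * C"
      using cell_bounds[OF n j] by (simp add: scaleR_conv_of_real)
    also have "\<dots> = of_nat n * ((\<mu> j - \<mu> (j - 1)) * cnj (\<nu> j - \<nu> (j - 1)))"
      unfolding node_simps(5)[OF n j(1)] C_def using n by simp
    finally show "integral (cell n j) (\<lambda>x. D u x * cnj (D v x)) = \<dots>" .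
  qed
  then show ?thesis by (simp add: ip_def sum_distrib_left)
qed

lemma Vh_continuous: "v \<in> Vh n \<Longrightarrow> continuous_on {0..1} v"
  by (simp add: Vh_def)

lemma Vh_0: "n > 0 \<Longrightarrow> v \<in> Vh n \<Longrightarrow> v (node n 0) = 0"
  by (simp add: Vh_def node_def)

text \<open>For products of affine functions the trapezoidal rule is exact after subtracting a sixth
  of the product of the increments. Summed over the cells this is the form found in
  \<open>sum_mass\<close>.\<close>

lemma ip_Vh:
  assumes n: "n > 0" and u: "u \<in> Vh n" and v: "v \<in> Vh n"
  defines "\<mu> \<equiv> \<lambda>j. u (node n j)" and "\<nu> \<equiv> \<lambda>j. v (node n j)"
  shows "ip u v = (\<Sum>j=1..n. mass n \<mu> j * cnj (\<nu> j)) / of_nat n"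
proof -
  define I where "I j = (3 * (\<mu> (j - 1) * cnj (\<nu> (j - 1)) + \<mu> j * cnj (\<nu> j)) - (\<mu> j - \<mu> (j - 1)) * cnj (\<nu> j - \<nu> (j - 1))) / 6 / of_nat n" for j
  have "integral\<^sup>L (lebesgue_on {0<..<1}) (\<lambda>x. u x * cnj (v x)) = (\<Sum>j=1..n. I j)"
  proof (rule cells_integral[OF n])
    fix j assume j: "1 \<le> j" "j \<le> n"
    have "continuous_on (cell n j) u" "continuous_on (cell n j) v"
      using Vh_continuous[OF u] Vh_continuous[OF v] cell_bounds[OF n j] by (auto elim: continuous_on_subset)
    then show "(\<lambda>x. u x * cnj (v x)) absolutely_integrable_on cell n j"
      by (intro absolutely_integrable_continuous_real continuous_intros)
    define a b c d where "a = \<mu> (j - 1)" and "b = \<mu> j - \<mu> (j - 1)" and "c = cnj (\<nu> (j - 1))" and "d = cnj (\<nu> j - \<nu> (j - 1))"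
    have "u x * cnj (v x) = (a + b * of_real (n * x - (real j - 1))) * (c + d * of_real (n * x - (real j - 1)))"
      if "x \<in> cell n j" for x :: real
    proof -
      have "u x = a + b * of_real (n * x - (real j - 1))" unfolding a_def b_def \<mu>_def by (rule Vh_linear[OF n u j that])
      moreover have "cnj (v x) = c + d * of_real (n * x - (real j - 1))"
        unfolding c_def d_def \<nu>_def by (subst Vh_linear[OF n v j that]) (simp only: complex_cnj_add complex_cnj_mult complex_cnj_complex_of_real)
      ultimately show ?thesis by (simp only:)
    qed
    then have "integral (cell n j) (\<lambda>x. u x * cnj (v x)) =
       integral (cell n j) (\<lambda>x. (a + b * of_real (n * x - (real j - 1))) * (c + d * of_real (n * x - (real j - 1))))"
      by (rule integral_cong)
    also have "\<dots> = (a * c + (a * d + b * c) / 2 + b * d / 3) / of_nat n"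
      by (rule integral_unique[OF linear_product_integral[OF n j(1)]])
    also have "a * c + (a * d + b * c) / 2 + b * d / 3 = (3 * (a * c + (a + b) * (c + d)) - b * d) / 6"
      by (simp add: field_simps)
    also have "\<dots> / of_nat n = I j" by (simp add: I_def a_def b_def c_def d_def)
    finally show "integral (cell n j) (\<lambda>x. u x * cnj (v x)) = I j" .
  qed
  also have "\<dots> = (\<Sum>j=1..n. mass n \<mu> j * cnj (\<nu> j)) / of_nat n"
  proof -
    have \<mu>0: "\<mu> 0 = 0" "\<nu> 0 = 0" using Vh_0[OF n] u v by (auto simp: \<mu>_def \<nu>_def)
    have shift: "(\<Sum>j=1..m. \<mu> (j - 1) * cnj (\<nu> (j - 1))) = (\<Sum>j=1..m. \<mu> j * cnj (\<nu> j)) - \<mu> m * cnj (\<nu> m)" for m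
      by (induction m) (auto simp: \<mu>0)
    have "(\<Sum>j=1..n. I j) = (3 * ((\<Sum>j=1..n. \<mu> (j - 1) * cnj (\<nu> (j - 1))) + (\<Sum>j=1..n. \<mu> j * cnj (\<nu> j)))
       - (\<Sum>j=1..n. (\<mu> j - \<mu> (j - 1)) * cnj (\<nu> j - \<nu> (j - 1)))) / 6 / of_nat n"
      unfolding I_def sum_divide_distrib[symmetric] sum_subtractf sum_distrib_left[symmetric] sum.distrib ..
    also have "\<dots> = (\<Sum>j=1..n. mass n \<mu> j * cnj (\<nu> j)) / of_nat n"
    proof -
      have "(3 * ((P - m) + P) - Q) / 6 = P - m / 2 - Q / 6" for P m Q :: complex by (simp add: field_simps)
      then show ?thesis unfolding shift sum_mass[of \<nu> \<mu> n, OF \<mu>0(2,1) n] by (simp only:)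
    qed
    finally show ?thesis .
  qed
  finally show ?thesis by (simp add: ip_def)
qed

text \<open>\<open>A\<close> is symmetric for the pairing without conjugation: summation by parts
  against conjugated sequences gives the same expression for both sides.\<close>

lemma stiffness_symmetric:
  assumes "a 0 = 0" "c 0 = 0" "n > 0"
  shows "(\<Sum>j=1..n. stiffness n t a j * c j) = (\<Sum>j=1..n. stiffness n t c j * a j)"
  using sum_stiffness[of "\<lambda>j. cnj (c j)" n t a] sum_stiffness[of "\<lambda>j. cnj (a j)" n t c] assms by (simp add: mult.commute)

text \<open>Derivative jumps are \<open>n\<close> times the interior rows of \<open>A\<close>, and
  the Robin defect is, up to the factor \<open>n\<close>, its last row. The penalty is thus
  \<open>\<gamma> n\<close> times an unconjugated product of two images under \<open>A\<close>, and
  symmetry moves both factors onto \<open>\<mu>\<close>.\<close>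

lemma a_h_Vh:
  fixes k :: real
  assumes n: "n > 0" and u: "u \<in> Vh n" and v: "v \<in> Vh n"
  defines "\<mu> \<equiv> \<lambda>j. u (node n j)" and "\<nu> \<equiv> \<lambda>j. v (node n j)" and "t \<equiv> k / n"
  shows "a_h n k \<gamma> u v / of_nat n =
    (\<Sum>j=1..n. (stiffness n t \<mu> j + \<gamma> * stiffness n t (stiffness n t \<mu>) j - (of_real t)\<^sup>2 * mass n \<mu> j) * cnj (\<nu> j))"
proof -
  define h where "h = complex_of_real (1 / n)"
  have hn: "h * of_nat n = 1" "of_nat n * h = 1" using n by (simp_all add: h_def)
  have n1: "node n n = 1" using node_simps[OF n] by simp
  have \<mu>0: "\<mu> 0 = 0" "\<nu> 0 = 0" using Vh_0[OF n] u v by (auto simp: \<mu>_def \<nu>_def)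
  have th: "of_real t = of_real k * h" by (simp add: t_def h_def)
  have tn: "of_real k = of_nat n * complex_of_real t" using n by (simp add: t_def)
  \<comment> \<open>The second boundary factor has \<open>- \<i> k\<close> unconjugated, so it is
    the last row of \<open>A\<close> applied to the conjugated nodal values rather than the
    conjugate of the last row applied to \<open>\<nu>\<close>.\<close>
  define c\<nu> where "c\<nu> j = cnj (\<nu> j)" for j
  have J: "J n k \<gamma> u v = \<gamma> * of_nat n * (\<Sum>j=1..n. stiffness n t c\<nu> j * stiffness n t \<mu> j)"
  proof -
    obtain m where m: "n = Suc m" using n by (cases n) auto
    have jump: "jump (D z) (node n j) = of_nat n * (2 * z (node n j) - z (node n (j - 1)) - z (node n (j + 1)))"
      if "z \<in> Vh n" "1 \<le> j" "j < n" for z j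
      unfolding jump_def Lim_left_D[OF n that(1,2) less_imp_le[OF that(3)]] Lim_right_D[OF n that(1,3)]
      by (simp add: algebra_simps)
    have "(\<Sum>j=1..n - 1. \<gamma> * h * jump (D u) (node n j) * cnj (jump (D v) (node n j)))
       = (\<Sum>j=1..n - 1. \<gamma> * of_nat n * (stiffness n t c\<nu> j * stiffness n t \<mu> j))"
    proof (rule sum.cong)
      fix j assume "j \<in> {1..n - 1}"
      then have j: "1 \<le> j" "j < n" by auto
      have "\<gamma> * h * jump (D u) (node n j) * cnj (jump (D v) (node n j)) = \<gamma> * (h * of_nat n) * of_nat n *
          (stiffness n t c\<nu> j * stiffness n t \<mu> j)"
        unfolding jump[OF u j] jump[OF v j] using j by (simp add: stiffness_def c\<nu>_def \<mu>_def \<nu>_def)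
      then show "\<gamma> * h * jump (D u) (node n j) * cnj (jump (D v) (node n j)) = \<gamma> * of_nat n * (stiffness n t c\<nu> j * stiffness n t \<mu> j)"
        unfolding hn by simp
    qed simp
    moreover have "\<gamma> * h * (Lim (at_left 1) (D u) - \<i> * of_real k * u 1) * (cnj (Lim (at_left 1) (D v)) - \<i> * of_real k * cnj (v 1))
       = \<gamma> * of_nat n * (stiffness n t c\<nu> n * stiffness n t \<mu> n)"
    proof -
      have L: "Lim (at_left 1) (D z) = of_nat n * (z 1 - z (node n (n - 1)))" if "z \<in> Vh n" for z
        using Lim_left_D[OF n that, of n] n by (simp add: n1)
      have "Lim (at_left 1) (D u) - \<i> * of_real k * u 1 = of_nat n * stiffness n t \<mu> n"
        unfolding L[OF u] tn using n by (simp add: stiffness_def \<mu>_def n1 algebra_simps)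
      moreover have "cnj (Lim (at_left 1) (D v)) - \<i> * of_real k * cnj (v 1) = of_nat n * stiffness n t c\<nu> n"
        unfolding L[OF v] tn using n by (simp add: stiffness_def c\<nu>_def \<nu>_def n1 algebra_simps)
      ultimately have "\<gamma> * h * (Lim (at_left 1) (D u) - \<i> * of_real k * u 1) * (cnj (Lim (at_left 1) (D v)) - \<i> * of_real k * cnj (v 1))
        = \<gamma> * (h * of_nat n) * of_nat n * (stiffness n t c\<nu> n * stiffness n t \<mu> n)" by simp
      then show ?thesis unfolding hn by simp
    qed
    ultimately have "J n k \<gamma> u v = (\<Sum>j=1..n - 1. \<gamma> * of_nat n * (stiffness n t c\<nu> j * stiffness n t \<mu> j)) + \<gamma> * of_nat n * (stiffness n t c\<nu> n * stiffness n t \<mu> n)"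
      unfolding J_def Let_def h_def by simp
    also have "\<dots> = (\<Sum>j=1..n. \<gamma> * of_nat n * (stiffness n t c\<nu> j * stiffness n t \<mu> j))" by (simp add: m)
    finally show ?thesis by (simp add: sum_distrib_left)
  qed
  have fd0: "stiffness n t \<mu> 0 = 0" by (simp add: stiffness_def)
  have sym: "(\<Sum>j=1..n. stiffness n t c\<nu> j * stiffness n t \<mu> j) = (\<Sum>j=1..n. stiffness n t (stiffness n t \<mu>) j * cnj (\<nu> j))"
    using stiffness_symmetric[of c\<nu> "stiffness n t \<mu>" n t] fd0 \<mu>0 n by (simp add: c\<nu>_def)
  have grad: "(\<Sum>j=1..n. (\<mu> j - \<mu> (j - 1)) * cnj (\<nu> j - \<nu> (j - 1))) - \<i> * of_real t * \<mu> n * cnj (\<nu> n)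
     = (\<Sum>j=1..n. stiffness n t \<mu> j * cnj (\<nu> j))"
    using sum_stiffness[of \<nu> n t \<mu>, OF \<mu>0(2) n] by simp
  have u1: "u 1 = \<mu> n" "v 1 = \<nu> n" by (simp_all add: \<mu>_def \<nu>_def n1)
  have "a_h n k \<gamma> u v = of_nat n * (\<Sum>j=1..n. (\<mu> j - \<mu> (j - 1)) * cnj (\<nu> j - \<nu> (j - 1)))
     - (of_real k)\<^sup>2 * ((\<Sum>j=1..n. mass n \<mu> j * cnj (\<nu> j)) / of_nat n) - \<i> * of_real k * \<mu> n * cnj (\<nu> n)
     + \<gamma> * of_nat n * (\<Sum>j=1..n. stiffness n t (stiffness n t \<mu>) j * cnj (\<nu> j))"
  proof -
    have "ip (D u) (D v) = of_nat n * (\<Sum>j=1..n. (\<mu> j - \<mu> (j - 1)) * cnj (\<nu> j - \<nu> (j - 1)))"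
      using ip_D_Vh[OF n u v] by (simp only: \<mu>_def \<nu>_def)
    moreover have "ip u v = (\<Sum>j=1..n. mass n \<mu> j * cnj (\<nu> j)) / of_nat n"
      using ip_Vh[OF n u v] by (simp only: \<mu>_def \<nu>_def)
    ultimately show ?thesis unfolding a_h_def J sym u1 by (simp only:)
  qed
  also have "\<dots> = of_nat n * ((\<Sum>j=1..n. stiffness n t \<mu> j * cnj (\<nu> j)) - (of_real t)\<^sup>2 * (\<Sum>j=1..n. mass n \<mu> j * cnj (\<nu> j))
     + \<gamma> * (\<Sum>j=1..n. stiffness n t (stiffness n t \<mu>) j * cnj (\<nu> j)))"
    unfolding grad[symmetric] tn using n by (simp add: field_simps power2_eq_square)
  finally have "a_h n k \<gamma> u v / of_nat n = (\<Sum>j=1..n. stiffness n t \<mu> j * cnj (\<nu> j))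
     - (of_real t)\<^sup>2 * (\<Sum>j=1..n. mass n \<mu> j * cnj (\<nu> j)) + \<gamma> * (\<Sum>j=1..n. stiffness n t (stiffness n t \<mu>) j * cnj (\<nu> j))"
    using n by simp
  also have "\<dots> = (\<Sum>j=1..n. (stiffness n t \<mu> j + \<gamma> * stiffness n t (stiffness n t \<mu>) j - (of_real t)\<^sup>2 * mass n \<mu> j) * cnj (\<nu> j))"
    by (simp add: sum_distrib_left sum.distrib sum_subtractf algebra_simps)
  finally show ?thesis .
qed

section \<open>The nodal basis and the linear system\<close>

definition hat :: "nat \<Rightarrow> nat \<Rightarrow> real \<Rightarrow> complex" where
  "hat n i x = of_real (max 0 (1 - \<bar>n * x - real i\<bar>))"

lemma hat_node: "n > 0 \<Longrightarrow> hat n i (node n j) = (if j = i then 1 else 0)"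
proof -
  assume n: "n > 0"
  have "\<bar>real j - real i\<bar> \<ge> 1" if "j \<noteq> i" using that by (cases "j < i") auto
  then show ?thesis by (auto simp: hat_def node_simps(4)[OF n])
qed

lemma hat_cell:
  assumes n: "n > 0" and j: "1 \<le> j" and x: "x \<in> cell n j"
  shows "hat n i x = (if i = j then of_real (n * x - (real j - 1)) else if i = j - 1 then of_real (real j - n * x) else 0)"
proof -
  have "n * node n (j - 1) \<le> n * x" "n * x \<le> n * node n j" using x by (auto intro!: mult_left_mono)
  then have nx: "real j - 1 \<le> n * x" "n * x \<le> real j" using node_simps(3,4)[OF n] j by auto
  consider "i = j" | "i = j - 1" | "i > j" | "i < j - 1" by linarith
  then show ?thesis
  proof cases
    case 1 then show ?thesis using nx by (simp add: hat_def)
  next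
    case 2
    then have "i \<noteq> j" using j by simp
    then show ?thesis using 2 nx j by (simp add: hat_def of_nat_diff)
  next
    case 3
    then have "real i \<ge> real j + 1" "i \<noteq> j - 1" by simp_all
    then show ?thesis using nx 3 by (simp add: hat_def)
  next
    case 4
    then have "real i + 2 \<le> real j" "i \<noteq> j" by linarith+
    then show ?thesis using nx 4 by (simp add: hat_def)
  qed
qed

lemma hat_continuous: "continuous_on A (hat n i)"
  unfolding hat_def by (intro continuous_intros)

lemma hat_Vh:
  assumes n: "n > 0" and i: "1 \<le> i"
  shows "hat n i \<in> Vh n"
  unfolding Vh_def
proof (intro CollectI conjI ballI hat_continuous)
  show "hat n i 0 = 0" using i by (simp add: hat_def)
  fix j assume "j \<in> {1..n}"
  then have j: "1 \<le> j" by simp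
  consider "i = j" | "i = j - 1" "i \<noteq> j" | "i \<noteq> j" "i \<noteq> j - 1" by blast
  then show "\<exists>\<alpha> \<beta>. \<forall>x\<in>{node n (j - 1)<..<node n j}. hat n i x = \<alpha> + \<beta> * complex_of_real x"
  proof cases
    case 1
    then show ?thesis using hat_cell[OF n j]
      by (intro exI[of _ "- of_real (real j - 1)"] exI[of _ "of_nat n"]) auto
  next
    case 2
    then show ?thesis using hat_cell[OF n j]
      by (intro exI[of _ "of_nat j"] exI[of _ "- of_nat n"]) auto
  next
    case 3
    then show ?thesis using hat_cell[OF n j]
      by (intro exI[of _ 0] exI[of _ 0]) auto
  qed
qed

lemma cip_solution_imp_system:
  assumes n: "n > 0" and k: "k > 0" and g: "g > 0" and s: "cip_solution n k (- \<i> * of_real g) f w"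
  shows "cip_system n (k / n) g (\<lambda>j. w (node n j)) (\<lambda>i. ip f (hat n i) / of_nat n)"
proof
  have w: "w \<in> Vh n" using s by (simp add: cip_solution_def)
  show "w (node n 0) = 0" by (rule Vh_0[OF n w])
  fix i assume i: "1 \<le> i" "i \<le> n"
  have "a_h n k (- \<i> * of_real g) w (hat n i) = ip f (hat n i)"
    using s hat_Vh[OF n i(1)] by (simp add: cip_solution_def)
  then have "ip f (hat n i) / of_nat n = a_h n k (- \<i> * of_real g) w (hat n i) / of_nat n" by simp
  also have "\<dots> = (\<Sum>j=1..n. (stiffness n (k / n) (\<lambda>j. w (node n j)) j + (- \<i> * of_real g) * stiffness n (k / n) (stiffness n (k / n) (\<lambda>j. w (node n j))) j
      - (of_real (k / n))\<^sup>2 * mass n (\<lambda>j. w (node n j)) j) * (if j = i then 1 else 0))"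
    unfolding a_h_Vh[OF n w hat_Vh[OF n i(1)]] by (rule sum.cong) (auto simp: hat_node[OF n])
  also have "\<dots> = stiffness n (k / n) (\<lambda>j. w (node n j)) i + (- \<i> * of_real g) * stiffness n (k / n) (stiffness n (k / n) (\<lambda>j. w (node n j))) i
      - (of_real (k / n))\<^sup>2 * mass n (\<lambda>j. w (node n j)) i"
    using i by (simp add: if_distrib[of "\<lambda>x. _ * x"] cong: if_cong)
  finally show "stiffness n (k / n) (\<lambda>j. w (node n j)) i - \<i> * of_real g * stiffness n (k / n) (stiffness n (k / n) (\<lambda>j. w (node n j))) i
      - (of_real (k / n))\<^sup>2 * mass n (\<lambda>j. w (node n j)) i = ip f (hat n i) / of_nat n" by simp
qed (use n k g in auto)

section \<open>Consistency\<close>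

lemma L2norm_cell_bound:
  assumes n: "n > 0"
    and B: "\<And>j x. 1 \<le> j \<Longrightarrow> j \<le> n \<Longrightarrow> x \<in> {node n (j - 1)<..<node n j} \<Longrightarrow> cmod (\<phi> x) \<le> B j"
  shows "L2norm \<phi> \<le> sqrt ((\<Sum>j=1..n. (B j)\<^sup>2) / n)"
proof -
  define G where "G x = (cmod (\<phi> x))\<^sup>2" for x
  have "integral\<^sup>L (lebesgue_on {0<..<1}) G \<le> (\<Sum>j=1..n. (B j)\<^sup>2) / n"
  proof (cases "integrable (lebesgue_on {0<..<1}) G")
    \<comment> \<open>A non-integrable function has integral 0 by convention, and the right side is
      nonnegative.\<close>
    case False
    then show ?thesis by (simp add: not_integrable_integral_eq sum_nonneg)
  next
    case True
    then have G: "G absolutely_integrable_on {0..1}" by (simp add: integrable_Ioo_iff)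
    have Gc: "G absolutely_integrable_on cell n j" if "1 \<le> j" "j \<le> n" for j
      by (rule absolutely_integrable_sub[OF G]) (use cell_bounds[OF n that] in auto)
    have "integral\<^sup>L (lebesgue_on {0<..<1}) G = (\<Sum>j=1..n. integral (cell n j) G)"
      by (rule cells_integral[OF n Gc]) auto
    also have "\<dots> \<le> (\<Sum>j=1..n. (B j)\<^sup>2 / n)"
    proof (rule sum_mono)
      fix j assume "j \<in> {1..n}"
      then have j: "1 \<le> j" "j \<le> n" by auto
      have neg: "negligible {node n (j - 1), node n j}" by simp
      have "integral (cell n j) G \<le> integral (cell n j) (\<lambda>_. (B j)\<^sup>2)"
      proof (rule integral_le_spike[OF neg])
        show "G integrable_on cell n j" using Gc[OF j] by (simp add: absolutely_integrable_on_def)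
        fix x assume "x \<in> cell n j - {node n (j - 1), node n j}"
        then show "G x \<le> (B j)\<^sup>2" unfolding G_def using B[OF j, of x] by (intro power_mono) auto
      qed (rule integrable_const_ivl)
      also have "\<dots> = (node n j - node n (j - 1)) * (B j)\<^sup>2" using cell_bounds[OF n j] by simp
      also have "\<dots> = (B j)\<^sup>2 / n" unfolding node_simps(5)[OF n j(1)] by simp
      finally show "integral (cell n j) G \<le> (B j)\<^sup>2 / n" .
    qed
    finally show ?thesis by (simp add: sum_divide_distrib)
  qed
  then show ?thesis unfolding L2norm_alt G_def by (rule real_sqrt_le_mono)
qed

lemma sum_shift_le:
  fixes x :: "nat \<Rightarrow> real"
  assumes "\<And>i. x i \<ge> 0"
  shows "(\<Sum>i=1..n. if i < n then x (i + 1) else 0) \<le> (\<Sum>i=1..n. x i)"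
proof (cases n)
  case (Suc m)
  have "(\<Sum>i=1..n. if i < n then x (i + 1) else 0) = (\<Sum>i=1..m. if i < n then x (i + 1) else 0)"
    by (simp add: Suc)
  also have "\<dots> = (\<Sum>i=1..m. x (i + 1))" by (rule sum.cong) (auto simp: Suc)
  also have "\<dots> \<le> (\<Sum>i=1..n. x i)"
  proof -
    have "(\<Sum>i=1..p. x (i + 1)) + x 1 = (\<Sum>i=1..Suc p. x i)" for p by (induction p) auto
    from this[of m] show ?thesis using assms[of 1] by (simp add: Suc)
  qed
  finally show ?thesis .
qed simp

lemma hat_integral:
  fixes G :: "real \<Rightarrow> complex"
  assumes n: "n > 0" and G: "G absolutely_integrable_on {0..1}" and i: "1 \<le> i" "i \<le> n"
  shows "integral {0..1} (\<lambda>z. G z * hat n i z) =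
    integral (cell n i) (\<lambda>z. G z * of_real (n * z - (real i - 1))) +
    (if i < n then integral (cell n (i + 1)) (\<lambda>z. G z * of_real (real (i + 1) - n * z)) else 0)"
proof -
  have Gh: "(\<lambda>z. G z * hat n i z) absolutely_integrable_on cell n j" if "1 \<le> j" "j \<le> n" for j
    by (rule absolutely_integrable_sub[OF absolutely_integrable_mult_continuous[OF G hat_continuous]])
      (use cell_bounds[OF n that] in auto)
  define A B where "A = integral (cell n i) (\<lambda>z. G z * of_real (n * z - (real i - 1)))"
    and "B = integral (cell n (i + 1)) (\<lambda>z. G z * of_real (real (i + 1) - n * z))"
  have "integral {0..1} (\<lambda>z. G z * hat n i z) = (\<Sum>j=1..n. integral (cell n j) (\<lambda>z. G z * hat n i z))"
    by (rule cells_absolutely_integrable(2)[OF n Gh])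
  also have "\<dots> = (\<Sum>j=1..n. (if j = i then A else 0) + (if j = i + 1 then B else 0))"
  proof (rule sum.cong)
    fix j assume "j \<in> {1..n}"
    then have j: "1 \<le> j" by simp
    have "integral (cell n j) (\<lambda>z. G z * hat n i z) = integral (cell n j) (\<lambda>z. G z *
       (if i = j then of_real (n * z - (real j - 1)) else if i = j - 1 then of_real (real j - n * z) else 0))"
      by (rule integral_cong) (simp only: hat_cell[OF n j])
    also have "\<dots> = (if j = i then A else 0) + (if j = i + 1 then B else 0)"
    proof -
      have "i = j - 1 \<longleftrightarrow> j = i + 1" using j by auto
      then show ?thesis by (auto simp: A_def B_def)
    qed
    finally show "integral (cell n j) (\<lambda>z. G z * hat n i z) = (if j = i then A else 0) + (if j = i + 1 then B else 0)" .
  qed simp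
  also have "\<dots> = A + (if i < n then B else 0)" using i by (simp add: sum.distrib)
  finally show ?thesis by (simp add: A_def B_def)
qed

lemma ip_hat:
  assumes "f absolutely_integrable_on {0..1}"
  shows "ip f (hat n i) = integral {0..1} (\<lambda>z. f z * hat n i z)"
proof -
  have "cnj (hat n i z) = hat n i z" for z by (simp add: hat_def)
  then show ?thesis unfolding ip_def
    using lebesgue_integral_Ioo[OF absolutely_integrable_mult_continuous[OF assms hat_continuous]] by simp
qed

lemma weighted_cell_integral_le:
  fixes G :: "real \<Rightarrow> complex"
  assumes G: "G absolutely_integrable_on {a..b}" and p: "continuous_on {a..b} p"
    and p1: "\<And>z. z \<in> {a..b} \<Longrightarrow> \<bar>p z\<bar> \<le> 1"
  shows "cmod (integral {a..b} (\<lambda>z. G z * of_real (p z))) \<le> integral {a..b} (\<lambda>z. cmod (G z))"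
proof (rule integral_norm_bound_integral)
  have "(\<lambda>z. G z * of_real (p z)) absolutely_integrable_on {a..b}"
    by (intro absolutely_integrable_mult_continuous G continuous_intros p)
  then show "(\<lambda>z. G z * of_real (p z)) integrable_on {a..b}" by (simp add: absolutely_integrable_on_def)
  show "(\<lambda>z. cmod (G z)) integrable_on {a..b}" using G by (simp add: absolutely_integrable_on_def)
qed (use p1 in \<open>auto simp: norm_mult mult_left_le\<close>)

lemma cell_weights:
  assumes n: "n > 0" and j: "1 \<le> j" and z: "z \<in> cell n j"
  shows "\<bar>n * z - (real j - 1)\<bar> \<le> 1" and "\<bar>real j - n * z\<bar> \<le> 1"
proof -
  have "n * node n (j - 1) \<le> n * z" "n * z \<le> n * node n j" using z by (auto intro!: mult_left_mono)
  then show "\<bar>n * z - (real j - 1)\<bar> \<le> 1" "\<bar>real j - n * z\<bar> \<le> 1" using node_simps(3,4)[OF n] j by auto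
qed

context helmholtz_solution begin

text \<open>Each load entry is at most the L1 norm of \<open>f\<close> on the two adjacent cells.
  Cauchy-Schwarz on a cell gives \<open>sqrt h\<close>, and each cell is counted at most
  twice.\<close>

lemma load_bound:
  assumes n: "n > 0"
  shows "sqrt (sq n (\<lambda>i. ip f (hat n i) / of_nat n)) \<le> 2 * (1 / n * sqrt (1 / n) * F)"
proof -
  define \<phi> E where "\<phi> j = integral (cell n j) (\<lambda>z. cmod (f z))" and "E j = integral (cell n j) (\<lambda>z. (cmod (f z))\<^sup>2)" for j
  have f2: "(\<lambda>z. (cmod (f z))\<^sup>2) absolutely_integrable_on {0..1}" by (rule L2_square_integrable[OF f])
  have f2c: "(\<lambda>z. (cmod (f z))\<^sup>2) absolutely_integrable_on cell n j" if "1 \<le> j" "j \<le> n" for j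
    by (rule absolutely_integrable_sub[OF f2]) (use cell_bounds[OF n that] in auto)
  have fc: "f absolutely_integrable_on cell n j" if "1 \<le> j" "j \<le> n" for j
    by (rule f_ai) (use cell_bounds[OF n that] in auto)
  have \<phi>0: "\<phi> j \<ge> 0" if "1 \<le> j" "j \<le> n" for j
    unfolding \<phi>_def using fc[OF that] by (intro integral_nonneg) (auto simp: absolutely_integrable_on_def)
  have \<phi>E: "(\<phi> j)\<^sup>2 \<le> E j / n" if "1 \<le> j" "j \<le> n" for j
    using integral_norm_le_L2[OF f, of "node n (j - 1)" "node n j"] cell_bounds[OF n that]
    unfolding node_simps(5)[OF n that(1)] by (simp add: \<phi>_def E_def)
  define x where "x j = (if 1 \<le> j \<and> j \<le> n then (\<phi> j)\<^sup>2 else 0)" for j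
  have "(cmod (ip f (hat n i)))\<^sup>2 \<le> 2 * (x i + (if i < n then x (i + 1) else 0))" if i: "1 \<le> i" "i \<le> n" for i
  proof -
    have "cmod (ip f (hat n i)) \<le> \<phi> i + (if i < n then \<phi> (i + 1) else 0)"
    proof -
      have "cmod (integral (cell n i) (\<lambda>z. f z * of_real (n * z - (real i - 1)))) \<le> \<phi> i" unfolding \<phi>_def
        by (intro weighted_cell_integral_le fc i continuous_intros cell_weights(1)[OF n i(1)])
      moreover have "cmod (integral (cell n (i + 1)) (\<lambda>z. f z * of_real (real (i + 1) - n * z))) \<le> \<phi> (i + 1)" if "i < n"
        unfolding \<phi>_def by (intro weighted_cell_integral_le fc continuous_intros cell_weights(2)[OF n]) (use that in auto)
      ultimately show ?thesis
        unfolding ip_hat[OF L2_absolutely_integrable[OF f]] hat_integral[OF n L2_absolutely_integrable[OF f] i]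
        by (intro order_trans[OF norm_triangle_ineq add_mono]) auto
    qed
    then have "(cmod (ip f (hat n i)))\<^sup>2 \<le> (\<phi> i + (if i < n then \<phi> (i + 1) else 0))\<^sup>2" by (intro power_mono) auto
    also have "\<dots> \<le> 2 * (\<phi> i)\<^sup>2 + 2 * (if i < n then \<phi> (i + 1) else 0)\<^sup>2"
      using sum_squares_bound[of "\<phi> i" "if i < n then \<phi> (i + 1) else 0"] by (simp add: power2_sum)
    also have "\<dots> = 2 * (x i + (if i < n then x (i + 1) else 0))" using i by (simp add: x_def)
    finally show ?thesis .
  qed
  then have "(\<Sum>i=1..n. (cmod (ip f (hat n i)))\<^sup>2) \<le> (\<Sum>i=1..n. 2 * (x i + (if i < n then x (i + 1) else 0)))"
    by (intro sum_mono) auto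
  also have "\<dots> = 2 * (\<Sum>i=1..n. x i) + 2 * (\<Sum>i=1..n. if i < n then x (i + 1) else 0)"
    by (simp add: sum.distrib sum_distrib_left)
  also have "\<dots> \<le> 4 * (\<Sum>i=1..n. x i)" using sum_shift_le[of x n] by (simp add: x_def)
  also have "(\<Sum>i=1..n. x i) \<le> (\<Sum>i=1..n. E i / n)" by (intro sum_mono) (auto simp: x_def intro!: \<phi>E)
  also have "(\<Sum>i=1..n. E i / n) = F\<^sup>2 / n"
    using cells_absolutely_integrable(2)[OF n f2c] by (simp add: sum_divide_distrib E_def F(2))
  finally have "(\<Sum>i=1..n. (cmod (ip f (hat n i)))\<^sup>2) \<le> 4 * (F\<^sup>2 / n)" by simp
  then have "(\<Sum>i=1..n. (cmod (ip f (hat n i)))\<^sup>2) / (real n)\<^sup>2 \<le> 4 * (F\<^sup>2 / n) / (real n)\<^sup>2"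
    by (rule divide_right_mono) simp
  also have "\<dots> = (2 * (1 / n * sqrt (1 / n) * F))\<^sup>2"
    unfolding power_mult_distrib by (simp add: power_divide)
  finally have "sq n (\<lambda>i. ip f (hat n i) / of_nat n) \<le> (2 * (1 / n * sqrt (1 / n) * F))\<^sup>2"
    by (simp add: sq_def norm_divide power_divide sum_divide_distrib)
  then show ?thesis using F(1) by (intro real_le_lsqrt) (auto simp: sq_nonneg)
qed

section \<open>The residual of the nodal interpolant\<close>

definition "mm n j = m (node n (j - 1)) (node n j)"

lemma mm_nonneg: "mm n j \<ge> 0" by (simp add: mm_def m_nonneg)

lemma sum_mm: "n > 0 \<Longrightarrow> (\<Sum>j=1..n. mm n j) \<le> 3 * k * F"
proof -
  assume n: "n > 0"
  have "(\<lambda>z. cmod (q z)) absolutely_integrable_on cell n j" if "1 \<le> j" "j \<le> n" for j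
    by (intro absolutely_integrable_norm[unfolded o_def] q_ai) (use cell_bounds[OF n that] in auto)
  from cells_absolutely_integrable(2)[OF n this] q_L1 show ?thesis by (simp add: mm_def m_def)
qed

lemma sum_mm_square: "n > 0 \<Longrightarrow> (\<Sum>j=1..n. (mm n j)\<^sup>2) \<le> 10 * k\<^sup>2 * F\<^sup>2 / n"
proof -
  assume n: "n > 0"
  have q2: "(\<lambda>z. (cmod (q z))\<^sup>2) absolutely_integrable_on cell n j" if "1 \<le> j" "j \<le> n" for j
    by (rule absolutely_integrable_sub[OF L2_square_integrable[OF q]]) (use cell_bounds[OF n that] in auto)
  have "(\<Sum>j=1..n. (mm n j)\<^sup>2) \<le> (\<Sum>j=1..n. integral (cell n j) (\<lambda>z. (cmod (q z))\<^sup>2) / n)"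
  proof (rule sum_mono)
    fix j assume "j \<in> {1..n}"
    then have j: "1 \<le> j" "j \<le> n" by auto
    show "(mm n j)\<^sup>2 \<le> integral (cell n j) (\<lambda>z. (cmod (q z))\<^sup>2) / n"
      using m_square[of "node n (j - 1)" "node n j"] cell_bounds[OF n j]
      unfolding node_simps(5)[OF n j(1)] by (simp add: mm_def)
  qed
  also have "\<dots> = integral {0..1} (\<lambda>z. (cmod (q z))\<^sup>2) / n"
    using cells_absolutely_integrable(2)[OF n q2] by (simp add: sum_divide_distrib)
  also have "\<dots> \<le> 10 * k\<^sup>2 * F\<^sup>2 / n" by (intro divide_right_mono q_L2) simp
  finally show ?thesis .
qed

lemma cell_approx:
  assumes n: "n > 0" and j: "1 \<le> j" "j \<le> n" and z: "z \<in> cell n j"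
  shows "cmod (u z - (u (node n (j - 1)) + (u (node n j) - u (node n (j - 1))) * of_real (n * z - (real j - 1)))) \<le> mm n j / n"
    and "cmod (v z - of_nat n * (u (node n j) - u (node n (j - 1)))) \<le> mm n j"
proof -
  have cb: "0 \<le> node n (j - 1)" "node n (j - 1) < node n j" "node n j \<le> 1" using cell_bounds[OF n j] by auto
  have l: "node n j - node n (j - 1) = 1 / n" by (rule node_simps(5)[OF n j(1)])
  have s: "n * z - (real j - 1) = n * (z - node n (j - 1))" using node_simps(3)[OF n j(1)] by (simp add: right_diff_distrib)
  show "cmod (v z - of_nat n * (u (node n j) - u (node n (j - 1)))) \<le> mm n j"
    using cell_slope[OF cb z] unfolding l by (simp add: mm_def mult.commute)
  show "cmod (u z - (u (node n (j - 1)) + (u (node n j) - u (node n (j - 1))) * of_real (n * z - (real j - 1)))) \<le> mm n j / n"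
    using cell_interpolation[OF cb z] unfolding l s by (simp add: mm_def mult.commute mult.left_commute)
qed

lemma cell_load_u:
  assumes n: "n > 0" and j: "1 \<le> j" "j \<le> n"
  defines "a \<equiv> u (node n (j - 1))" and "b \<equiv> u (node n j)"
  shows "cmod (integral (cell n j) (\<lambda>z. u z * of_real (n * z - (real j - 1))) - (a / 6 + b / 3) / of_nat n) \<le> mm n j / n / n"
    and "cmod (integral (cell n j) (\<lambda>z. u z * of_real (real j - n * z)) - (a / 3 + b / 6) / of_nat n) \<le> mm n j / n / n"
proof -
  have cb: "0 \<le> node n (j - 1)" "node n (j - 1) < node n j" "node n j \<le> 1" using cell_bounds[OF n j] by auto
  have uc: "continuous_on (cell n j) u" using u_cont cb by (auto elim: continuous_on_subset)
  have key: "cmod (integral (cell n j) (\<lambda>z. u z * of_real (p z)) - I) \<le> mm n j / n / n"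
    if p: "continuous_on (cell n j) p" "\<And>z. z \<in> cell n j \<Longrightarrow> \<bar>p z\<bar> \<le> 1"
    and I: "((\<lambda>z. (a + (b - a) * of_real (n * z - (real j - 1))) * of_real (p z)) has_integral I) (cell n j)" for p I
  proof -
    have "(\<lambda>z. u z * of_real (p z)) integrable_on cell n j"
      by (intro integrable_continuous_real continuous_intros uc p)
    then have D: "((\<lambda>z. u z * of_real (p z) - (a + (b - a) * of_real (n * z - (real j - 1))) * of_real (p z)) has_integral
       integral (cell n j) (\<lambda>z. u z * of_real (p z)) - I) (cell n j)"
      by (intro has_integral_diff I integrable_integral)
    have "cmod (integral (cell n j) (\<lambda>z. u z * of_real (p z)) - I) \<le> mm n j / n * measure lborel (cell n j)"
    proof (rule has_integral_bound_real[OF _ finite.emptyI D])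
      show "0 \<le> mm n j / n" by (simp add: mm_nonneg)
      fix z assume "z \<in> cell n j - {}"
      then have z: "z \<in> cell n j" by simp
      have "cmod (u z * of_real (p z) - (a + (b - a) * of_real (n * z - (real j - 1))) * of_real (p z))
         = cmod (u z - (a + (b - a) * of_real (n * z - (real j - 1)))) * \<bar>p z\<bar>"
        unfolding left_diff_distrib[symmetric] norm_mult norm_of_real ..
      also have "\<dots> \<le> mm n j / n * 1"
        using cell_approx(1)[OF n j z] p(2)[OF z] unfolding a_def b_def by (intro mult_mono) (auto simp: mm_nonneg)
      finally show "cmod (u z * of_real (p z) - (a + (b - a) * of_real (n * z - (real j - 1))) * of_real (p z)) \<le> mm n j / n"
        by simp
    qed
    also have "measure lborel (cell n j) = 1 / n"
      using cb node_simps(5)[OF n j(1)] by simp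
    finally show ?thesis by simp
  qed
  show "cmod (integral (cell n j) (\<lambda>z. u z * of_real (n * z - (real j - 1))) - (a / 6 + b / 3) / of_nat n) \<le> mm n j / n / n"
  proof (rule key)
    have "a / 6 + b / 3 = a * 0 + (a * 1 + (b - a) * 0) / 2 + (b - a) * 1 / 3" by (simp add: field_simps)
    then show "((\<lambda>z. (a + (b - a) * of_real (n * z - (real j - 1))) * of_real (n * z - (real j - 1))) has_integral (a / 6 + b / 3) / of_nat n) (cell n j)"
      using linear_product_integral[OF n j(1), of a "b - a" 0 1] by simp
  qed (auto intro!: continuous_intros cell_weights(1)[OF n j(1)] simp del: of_real_diff)
  show "cmod (integral (cell n j) (\<lambda>z. u z * of_real (real j - n * z)) - (a / 3 + b / 6) / of_nat n) \<le> mm n j / n / n"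
  proof (rule key)
    have "a / 3 + b / 6 = a * 1 + (a * (-1) + (b - a) * 1) / 2 + (b - a) * (-1) / 3" by (simp add: field_simps)
    moreover have "complex_of_real (real j - n * z) = 1 + (-1) * of_real (n * z - (real j - 1))" for z :: real by simp
    ultimately show "((\<lambda>z. (a + (b - a) * of_real (n * z - (real j - 1))) * of_real (real j - n * z)) has_integral (a / 3 + b / 6) / of_nat n) (cell n j)"
      using linear_product_integral[OF n j(1), of a "b - a" 1 "-1"] by (simp only:)
  qed (auto intro!: continuous_intros cell_weights(2)[OF n j(1)] simp del: of_real_diff)
qed

text \<open>Integration by parts against the two halves of a hat function. Their slopes are
  constant, so the remaining integral of \<open>v\<close> is exactly a nodal difference of
  \<open>u\<close>; the boundary values of \<open>v\<close> cancel between neighbouring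
  cells.\<close>

lemma cell_load_q:
  assumes n: "n > 0" and j: "1 \<le> j" "j \<le> n"
  defines "a \<equiv> u (node n (j - 1))" and "b \<equiv> u (node n j)"
  shows "integral (cell n j) (\<lambda>z. q z * of_real (n * z - (real j - 1))) = v (node n j) - of_nat n * (b - a)"
    and "integral (cell n j) (\<lambda>z. q z * of_real (real j - n * z)) = - v (node n (j - 1)) + of_nat n * (b - a)"
proof -
  have cb: "0 \<le> node n (j - 1)" "node n (j - 1) < node n j" "node n j \<le> 1" using cell_bounds[OF n j] by auto
  have e: "of_nat n * complex_of_real (node n j) = of_nat j" "of_nat n * complex_of_real (node n (j - 1)) = of_nat j - 1"
  proof -
    have "complex_of_real (n * node n j) = of_real j" "complex_of_real (n * node n (j - 1)) = of_real (real j - 1)"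
      using node_simps(3)[OF n j(1)] node_simps(4)[OF n] by (simp_all only:)
    then show "of_nat n * complex_of_real (node n j) = of_nat j" "of_nat n * complex_of_real (node n (j - 1)) = of_nat j - 1"
      by simp_all
  qed
  have "((\<lambda>z. q z * (- (of_nat j - 1) + of_nat n * of_real z)) has_integral v (node n j) - (b - a) * of_nat n) (cell n j)"
    using cell_by_parts[OF cb, of "- (of_nat j - 1)" "of_nat n"] unfolding e by (simp add: a_def b_def)
  then show "integral (cell n j) (\<lambda>z. q z * of_real (n * z - (real j - 1))) = v (node n j) - of_nat n * (b - a)"
    by (intro integral_unique) (simp add: algebra_simps)
  have "((\<lambda>z. q z * (of_nat j + - of_nat n * of_real z)) has_integral - v (node n (j - 1)) + (b - a) * of_nat n) (cell n j)"
    using cell_by_parts[OF cb, of "of_nat j" "- of_nat n"] unfolding mult_minus_left e by (simp add: a_def b_def)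
  then show "integral (cell n j) (\<lambda>z. q z * of_real (real j - n * z)) = - v (node n (j - 1)) + of_nat n * (b - a)"
    by (intro integral_unique) (simp add: algebra_simps)
qed

definition "ut n j = u (node n j)"

definition "res n j = stiffness n (k / n) (ut n) j - (of_real (k / n))\<^sup>2 * mass n (ut n) j - ip f (hat n j) / of_nat n"

text \<open>In one dimension the nodal interpolant reproduces the stiffness term exactly, so only the mass term
  contributes to the residual.\<close>

lemma res_bound:
  assumes n: "n > 0" and i: "1 \<le> i" "i \<le> n"
  shows "cmod (res n i) \<le> k\<^sup>2 / n^3 * (mm n i + (if i < n then mm n (i + 1) else 0))"
proof -
  define Xq Xu where "Xq = integral {0..1} (\<lambda>z. q z * hat n i z)" and "Xu = integral {0..1} (\<lambda>z. u z * hat n i z)"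
  have qa: "q absolutely_integrable_on {0..1}" by (rule L2_absolutely_integrable[OF q])
  have ua: "u absolutely_integrable_on {0..1}" by (rule absolutely_integrable_continuous_real[OF u_cont])
  have "ip f (hat n i) = integral {0..1} (\<lambda>z. f z * hat n i z)" by (rule ip_hat[OF L2_absolutely_integrable[OF f]])
  also have "\<dots> = integral {0..1} (\<lambda>z. - (q z * hat n i z) - (of_real k)\<^sup>2 * (u z * hat n i z))"
    by (rule integral_spike[OF S]) (auto simp: ode algebra_simps)
  also have "\<dots> = - Xq - (of_real k)\<^sup>2 * Xu"
  proof (rule integral_unique)
    have "((\<lambda>z. q z * hat n i z) has_integral Xq) {0..1}" "((\<lambda>z. u z * hat n i z) has_integral Xu) {0..1}"
      unfolding Xq_def Xu_def
      using absolutely_integrable_mult_continuous[OF qa hat_continuous] absolutely_integrable_mult_continuous[OF ua hat_continuous]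
      by (auto simp: absolutely_integrable_on_def intro!: integrable_integral)
    then show "((\<lambda>z. - (q z * hat n i z) - (of_real k)\<^sup>2 * (u z * hat n i z)) has_integral - Xq - (of_real k)\<^sup>2 * Xu) {0..1}"
      by (intro has_integral_diff has_integral_neg has_integral_mult_right)
  qed
  finally have ipf: "ip f (hat n i) = - Xq - (of_real k)\<^sup>2 * Xu" .
  have Xq: "- Xq = of_nat n * stiffness n (k / n) (ut n) i"
  proof (cases "i < n")
    case True
    have "Xq = (v (node n i) - of_nat n * (u (node n i) - u (node n (i - 1)))) + (- v (node n i) + of_nat n * (u (node n (i + 1)) - u (node n i)))"
      unfolding Xq_def hat_integral[OF n qa i] using cell_load_q(1)[OF n i] cell_load_q(2)[OF n, of "i + 1"] True i by simp
    then show ?thesis using True i by (simp add: stiffness_def ut_def algebra_simps)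
  next
    case False
    then have i_n: "i = n" using i by simp
    have "Xq = v (node n n) - of_nat n * (u (node n n) - u (node n (n - 1)))"
      unfolding Xq_def hat_integral[OF n qa i] using cell_load_q(1)[OF n i] i_n by simp
    also have "v (node n n) = \<i> * of_real k * u (node n n)" using bc node_simps(2)[OF n] by simp
    finally show ?thesis using n i_n by (simp add: stiffness_def ut_def algebra_simps)
  qed
  have Xu: "cmod (Xu - mass n (ut n) i / of_nat n) \<le> (mm n i + (if i < n then mm n (i + 1) else 0)) / n / n"
  proof (cases "i < n")
    case True
    define A B where "A = integral (cell n i) (\<lambda>z. u z * of_real (n * z - (real i - 1)))"
      and "B = integral (cell n (i + 1)) (\<lambda>z. u z * of_real (real (i + 1) - n * z))"
    have "Xu = A + B" unfolding Xu_def hat_integral[OF n ua i] A_def B_def using True by simp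
    moreover have "mass n (ut n) i / of_nat n = (u (node n (i - 1)) / 6 + u (node n i) / 3) / of_nat n + (u (node n i) / 3 + u (node n (i + 1)) / 6) / of_nat n"
      using True by (simp add: mass_def ut_def add_divide_distrib)
    ultimately have "Xu - mass n (ut n) i / of_nat n = (A - (u (node n (i - 1)) / 6 + u (node n i) / 3) / of_nat n) + (B - (u (node n i) / 3 + u (node n (i + 1)) / 6) / of_nat n)"
      by simp
    also have "cmod \<dots> \<le> mm n i / n / n + mm n (i + 1) / n / n"
      using cell_load_u(1)[OF n i] cell_load_u(2)[OF n, of "i + 1"] True unfolding A_def B_def
      by (intro order_trans[OF norm_triangle_ineq add_mono]) auto
    finally show ?thesis using True by (simp add: add_divide_distrib)
  next
    case False
    then have i_n: "i = n" using i by simp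
    have eq: "mass n (ut n) i = u (node n (i - 1)) / 6 + u (node n i) / 3"
      using i_n by (simp add: mass_def ut_def add_divide_distrib)
    show ?thesis using cell_load_u(1)[OF n i] False unfolding Xu_def hat_integral[OF n ua i] eq by simp
  qed
  have "res n i = (of_real k)\<^sup>2 / of_nat n * (Xu - mass n (ut n) i / of_nat n)"
    unfolding res_def ipf Xq using n by (simp add: field_simps power2_eq_square)
  then have "cmod (res n i) = k\<^sup>2 / n * cmod (Xu - mass n (ut n) i / of_nat n)"
    by (simp add: norm_mult norm_divide norm_power)
  also have "\<dots> \<le> k\<^sup>2 / n * ((mm n i + (if i < n then mm n (i + 1) else 0)) / n / n)"
    by (intro mult_left_mono Xu) simp
  also have "\<dots> = k\<^sup>2 / n^3 * (mm n i + (if i < n then mm n (i + 1) else 0))" by (simp add: power3_eq_cube)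
  finally show ?thesis .
qed

lemma sum_res:
  assumes n: "n > 0"
  shows "(\<Sum>j=1..n. cmod (res n j)) \<le> 6 * ((k / n)^3 * F)"
proof -
  have "(\<Sum>j=1..n. cmod (res n j)) \<le> (\<Sum>j=1..n. k\<^sup>2 / n^3 * (mm n j + (if j < n then mm n (j + 1) else 0)))"
    by (intro sum_mono res_bound n) auto
  also have "\<dots> = k\<^sup>2 / n^3 * ((\<Sum>j=1..n. mm n j) + (\<Sum>j=1..n. if j < n then mm n (j + 1) else 0))"
    by (simp only: sum_distrib_left[symmetric] sum.distrib)
  also have "\<dots> \<le> k\<^sup>2 / n^3 * (3 * k * F + 3 * k * F)"
    using sum_mm[OF n] sum_shift_le[of "mm n" n] mm_nonneg by (intro mult_left_mono add_mono) auto
  also have "\<dots> = 6 * ((k / n)^3 * F)" by (simp add: power_divide power2_eq_square power3_eq_cube)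
  finally show ?thesis .
qed

end

section \<open>Error estimates\<close>

lemma sum_shifted_squares:
  assumes "e 0 = (0::complex)"
  shows "(\<Sum>j=1..n. (cmod (e (j - 1)))\<^sup>2) \<le> sq n e"
proof -
  have "(\<Sum>j=1..n. (cmod (e (j - 1)))\<^sup>2) + (cmod (e n))\<^sup>2 = sq n e" for n
    by (induction n) (auto simp: sq_def assms)
  then show ?thesis by (metis add_increasing2 order_refl zero_le_power2)
qed

lemma square_sum3: "(a + b + c)\<^sup>2 \<le> 3 * (a\<^sup>2 + b\<^sup>2 + c\<^sup>2)" for a b c :: real
  using sum_squares_bound[of a b] sum_squares_bound[of a c] sum_squares_bound[of b c]
  by (simp add: power2_eq_square algebra_simps)

lemma square_sum2: "(a + b)\<^sup>2 \<le> 2 * (a\<^sup>2 + b\<^sup>2)" for a b :: real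
  using sum_squares_bound[of a b] by (simp add: power2_eq_square algebra_simps)

lemma sqrt_le_sum:
  assumes "x \<le> a\<^sup>2 + b\<^sup>2" "a \<ge> 0" "b \<ge> 0"
  shows "sqrt x \<le> a + b"
proof (rule real_le_lsqrt)
  have "a\<^sup>2 + b\<^sup>2 \<le> (a + b)\<^sup>2" using assms by (simp add: power2_sum)
  then show "x \<le> (a + b)\<^sup>2" using assms(1) by simp
qed (use assms in simp)

context helmholtz_solution begin

lemma D_error:
  assumes n: "n > 0" and w: "w \<in> Vh n" and j: "1 \<le> j" "j \<le> n" and x: "x \<in> {node n (j - 1)<..<node n j}"
  shows "D (\<lambda>x. u x - w x) x = v x - of_nat n * (w (node n j) - w (node n (j - 1)))"
proof -
  have x01: "x \<in> {0<..<1}" using x cell_bounds[OF n j] by auto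
  then have "(u has_vector_derivative v x) (at x within {0..1})" by (intro u_deriv) auto
  moreover have "at x within {0..1} = at x"
    by (rule at_within_interior) (use x01 in \<open>simp add: interior_atLeastAtMost_real\<close>)
  ultimately have "(u has_vector_derivative v x) (at x)" by simp
  from has_vector_derivative_diff[OF this Vh_deriv[OF n w j x]]
  show ?thesis unfolding D_def by (rule vector_derivative_at)
qed

lemma ut0: "n > 0 \<Longrightarrow> ut n 0 = 0" by (simp add: ut_def node_simps u0)

lemma ut_le:
  assumes "n > 0" "j \<le> n"
  shows "cmod (ut n j) \<le> 2 * F / k"
  using stability(2)[of "node n j"] node_bounds[OF assms] k by (simp add: ut_def field_simps)

lemma convex_norm:
  assumes "0 \<le> s" "s \<le> 1"
  shows "cmod (a + (b - a) * of_real s) \<le> cmod a + cmod b"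
proof -
  have "a + (b - a) * of_real s = of_real (1 - s) * a + of_real s * b" by (simp add: algebra_simps)
  also have "cmod \<dots> \<le> (1 - s) * cmod a + s * cmod b"
    using assms by (intro order_trans[OF norm_triangle_ineq]) (simp add: norm_mult del: of_real_diff)
  also have "\<dots> \<le> 1 * cmod a + 1 * cmod b" using assms by (intro add_mono mult_right_mono) auto
  finally show ?thesis by simp
qed

lemma cell_coordinate:
  assumes "n > 0" "1 \<le> j" "x \<in> {node n (j - 1)<..<node n j}"
  shows "0 \<le> n * x - (real j - 1)" "n * x - (real j - 1) \<le> 1" "x \<in> cell n j"
proof -
  show x: "x \<in> cell n j" using assms by simp
  have "n * node n (j - 1) \<le> n * x" using x by (auto intro!: mult_left_mono)
  then show "0 \<le> n * x - (real j - 1)" using node_simps(3)[OF assms(1,2)] by simp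
  show "n * x - (real j - 1) \<le> 1" using cell_weights(1)[OF assms(1,2) x] by simp
qed

text \<open>On each cell the error is the interpolation error, bounded by \<open>mm\<close>, plus
  the nodal error of the locale \<open>fine_cip_system\<close>. The factor \<open>1 + g\<close> is
  at most \<open>2 (g + 1 / g)\<close>.\<close>

lemma fine_estimate:
  assumes n: "n > 0" and g: "g > 0" and sol: "cip_solution n k (- \<i> * of_real g) f w"
    and fine: "(k / n)^3 \<le> 1 / n"
  shows "L2norm (\<lambda>x. of_real k * (u x - w x)) \<le> 10^12 * (g + 1 / g) * (k * (k / n)\<^sup>2) * F"
    and "L2norm (D (\<lambda>x. u x - w x)) \<le> 10^12 * (g + 1 / g) * (k / n + k * (k / n)\<^sup>2) * F"
proof -
  define W b where "W j = w (node n j)" and "b i = ip f (hat n i) / of_nat n" for i j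
  define t h where "t = k / n" and "h = 1 / real n"
  have w: "w \<in> Vh n" using sol by (simp add: cip_solution_def)
  have k0: "k > 0" using k by simp
  have sys: "cip_system n t g W b"
    using cip_solution_imp_system[OF n k0 g sol] by (simp add: W_def[abs_def] b_def[abs_def] t_def)
  have th: "t = k * h" "h > 0" "t > 0" using k n by (auto simp: t_def h_def)
  have Rle: "sqrt (sq n b) \<le> 2 * (h * sqrt h * F)" unfolding b_def h_def by (rule load_bound[OF n])
  interpret c: cip_system n t g W b by (rule sys)
  interpret fc: fine_cip_system n t g W b k h F "ut n" "res n"
  proof
    show "c.R \<le> 2 * (h * sqrt h * F)" unfolding c.R_def by (rule Rle)
    show "t^3 \<le> h" using fine by (simp add: t_def h_def)
    show "(\<Sum>j=1..n. cmod (res n j)) \<le> 6 * (t^3 * F)" unfolding t_def by (rule sum_res[OF n])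
    show "stiffness n t (ut n) j - (of_real t)\<^sup>2 * mass n (ut n) j = b j + res n j" for j
      by (simp add: res_def t_def b_def)
  qed (use k th F(1) ut0[OF n] ut_le[OF n] in \<open>auto simp: h_def\<close>)
  define e where "e j = ut n j - W j" for j
  have e0: "e 0 = 0" using ut0[OF n] c.w0 by (simp add: e_def)
  define M G where "M = (1 + g) * t\<^sup>2 * F" and "G = g + 1 / g"
  have M: "fc.M = M" "M \<ge> 0" using g F(1) by (simp_all add: fc.M_def M_def)
  have "G \<ge> 1" "g \<le> G" using c.G(1,2) unfolding c.G_def G_def .
  then have G: "G \<ge> 1" "1 + g \<le> 2 * G" "g \<le> G" by auto
  have s2: "(sqrt h)\<^sup>2 = h" using th by simp
  have err: "h * sq n e \<le> (10^11 * M)\<^sup>2"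
  proof -
    have "(sqrt h * sqrt (sq n e))\<^sup>2 \<le> (10^11 * M)\<^sup>2"
      using fc.nodal_error unfolding fc.s_def M e_def by (intro power_mono) (use th sq_nonneg in auto)
    then show ?thesis using th by (simp add: power_mult_distrib sq_nonneg)
  qed
  have gerr: "n * dsq n e \<le> (10^10 * (k * M + g * t * F))\<^sup>2"
  proof -
    have "(sqrt (dsq n e))\<^sup>2 \<le> (sqrt h * (10^10 * (k * M + g * t * F)))\<^sup>2"
      using fc.nodal_grad_error unfolding fc.s_def M e_def by (intro power_mono) (use dsq_nonneg in auto)
    then have "dsq n e \<le> h * (10^10 * (k * M + g * t * F))\<^sup>2"
      using th unfolding power_mult_distrib[of "sqrt h"] s2 by (simp add: dsq_nonneg)
    then have "n * dsq n e \<le> n * (h * (10^10 * (k * M + g * t * F))\<^sup>2)" by (intro mult_left_mono) auto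
    then show ?thesis using n by (simp add: h_def)
  qed
  have mm2: "(\<Sum>j=1..n. (mm n j)\<^sup>2) \<le> 10 * k\<^sup>2 * F\<^sup>2 * h" using sum_mm_square[OF n] by (simp add: h_def)
  have ktF: "k * t\<^sup>2 * F \<ge> 0" "t\<^sup>2 * F \<ge> 0" "t * F \<ge> 0" using k0 th F(1) by auto
  define B where "B j = k * (mm n j * h + cmod (e (j - 1)) + cmod (e j))" for j
  have "L2norm (\<lambda>x. of_real k * (u x - w x)) \<le> sqrt ((\<Sum>j=1..n. (B j)\<^sup>2) / n)"
  proof (rule L2norm_cell_bound[OF n])
    fix j x assume j: "1 \<le> j" "j \<le> n" and x: "x \<in> {node n (j - 1)<..<node n j}"
    note cx = cell_coordinate[OF n j(1) x]
    define I where "I = ut n (j - 1) + (ut n j - ut n (j - 1)) * of_real (n * x - (real j - 1))"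
    have "w x = W (j - 1) + (W j - W (j - 1)) * of_real (n * x - (real j - 1))"
      unfolding W_def by (rule Vh_linear[OF n w j cx(3)])
    then have "I - w x = e (j - 1) + (e j - e (j - 1)) * of_real (n * x - (real j - 1))"
      by (simp add: I_def e_def algebra_simps)
    then have "cmod (I - w x) \<le> cmod (e (j - 1)) + cmod (e j)" using convex_norm[OF cx(1,2)] by simp
    moreover have "cmod (u x - I) \<le> mm n j * h"
      using cell_approx(1)[OF n j cx(3)] by (simp add: I_def ut_def h_def)
    ultimately have "cmod (u x - w x) \<le> mm n j * h + cmod (e (j - 1)) + cmod (e j)"
      using norm_triangle_ineq[of "u x - I" "I - w x"] by simp
    then show "cmod (of_real k * (u x - w x)) \<le> B j" using k0 by (simp add: B_def norm_mult)
  qed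
  also have "\<dots> \<le> 6 * (t\<^sup>2 * F) + 3 * 10^11 * (k * M)"
  proof (rule sqrt_le_sum)
    have "(\<Sum>j=1..n. (B j)\<^sup>2) \<le> (\<Sum>j=1..n. k\<^sup>2 * (3 * ((mm n j * h)\<^sup>2 + (cmod (e (j - 1)))\<^sup>2 + (cmod (e j))\<^sup>2)))"
      unfolding B_def power_mult_distrib[of k] by (intro sum_mono mult_left_mono square_sum3) auto
    also have "\<dots> = k\<^sup>2 * (3 * (h\<^sup>2 * (\<Sum>j=1..n. (mm n j)\<^sup>2) + (\<Sum>j=1..n. (cmod (e (j - 1)))\<^sup>2) + sq n e))"
      by (simp only: sum_distrib_left[symmetric] sum.distrib power_mult_distrib sum_distrib_right[symmetric] sq_def mult.commute[of _ "h\<^sup>2"])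
    also have "\<dots> \<le> k\<^sup>2 * (3 * (h\<^sup>2 * (10 * k\<^sup>2 * F\<^sup>2 * h) + sq n e + sq n e))"
      by (intro mult_left_mono add_mono mm2 sum_shifted_squares e0) auto
    finally have "(\<Sum>j=1..n. (B j)\<^sup>2) * h \<le> k\<^sup>2 * (3 * (h\<^sup>2 * (10 * k\<^sup>2 * F\<^sup>2 * h) + sq n e + sq n e)) * h"
      using th by (intro mult_right_mono) auto
    also have "\<dots> = 30 * (t\<^sup>2 * F)\<^sup>2 + 6 * k\<^sup>2 * (h * sq n e)"
      by (simp add: th(1) algebra_simps power2_eq_square)
    also have "\<dots> \<le> 36 * (t\<^sup>2 * F)\<^sup>2 + 9 * k\<^sup>2 * (10^11 * M)\<^sup>2"
      by (intro add_mono mult_mono err) (use th sq_nonneg in auto)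
    also have "\<dots> = (6 * (t\<^sup>2 * F))\<^sup>2 + (3 * 10^11 * (k * M))\<^sup>2" by (simp add: power_mult_distrib)
    finally show "(\<Sum>j=1..n. (B j)\<^sup>2) / n \<le> (6 * (t\<^sup>2 * F))\<^sup>2 + (3 * 10^11 * (k * M))\<^sup>2" by (simp add: h_def)
  qed (use ktF k0 M in auto)
  also have "\<dots> \<le> 10^12 * G * (k * t\<^sup>2) * F"
  proof -
    have "1 * (t\<^sup>2 * F) \<le> (G * k) * (t\<^sup>2 * F)"
      using ktF G k mult_mono[of 1 G 1 k] by (intro mult_right_mono) auto
    moreover have "k * M \<le> 2 * (G * (k * t\<^sup>2 * F))"
      using mult_right_mono[OF G(2) ktF(1)] by (simp add: M_def mult_ac)
    moreover have "(G * k) * (t\<^sup>2 * F) = G * (k * t\<^sup>2 * F)" "10^12 * G * (k * t\<^sup>2) * F = 10^12 * (G * (k * t\<^sup>2 * F))" by simp_all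
    moreover have "G * (k * t\<^sup>2 * F) \<ge> 0" using G ktF by simp
    moreover have "6 * x + 3 * 10^11 * y \<le> 10^12 * z" if "1 * x \<le> z" "y \<le> 2 * z" "z \<ge> 0" for x y z :: real
      using that by simp
    ultimately show ?thesis by metis
  qed
  finally show "L2norm (\<lambda>x. of_real k * (u x - w x)) \<le> 10^12 * (g + 1 / g) * (k * (k / n)\<^sup>2) * F"
    by (simp only: G_def t_def)
  define B' where "B' j = mm n j + n * cmod (e j - e (j - 1))" for j
  have "L2norm (D (\<lambda>x. u x - w x)) \<le> sqrt ((\<Sum>j=1..n. (B' j)\<^sup>2) / n)"
  proof (rule L2norm_cell_bound[OF n])
    fix j x assume j: "1 \<le> j" "j \<le> n" and x: "x \<in> {node n (j - 1)<..<node n j}"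
    note cx = cell_coordinate[OF n j(1) x]
    have "D (\<lambda>x. u x - w x) x = (v x - of_nat n * (ut n j - ut n (j - 1))) + of_nat n * (e j - e (j - 1))"
      unfolding D_error[OF n w j x] by (simp add: e_def W_def algebra_simps)
    then show "cmod (D (\<lambda>x. u x - w x) x) \<le> B' j"
      unfolding B'_def using cell_approx(2)[OF n j cx(3)]
      by (simp only: ut_def) (intro order_trans[OF norm_triangle_ineq] add_mono, auto simp: norm_mult)
  qed
  also have "\<dots> \<le> 5 * (t * F) + 2 * 10^10 * (k * M + g * t * F)"
  proof (rule sqrt_le_sum)
    have "(\<Sum>j=1..n. (B' j)\<^sup>2) \<le> (\<Sum>j=1..n. 2 * ((mm n j)\<^sup>2 + (n * cmod (e j - e (j - 1)))\<^sup>2))"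
      unfolding B'_def by (intro sum_mono square_sum2)
    also have "\<dots> = 2 * ((\<Sum>j=1..n. (mm n j)\<^sup>2) + (real n)\<^sup>2 * dsq n e)"
      by (simp only: sum_distrib_left[symmetric] sum.distrib power_mult_distrib dsq_def)
    also have "\<dots> \<le> 2 * (10 * k\<^sup>2 * F\<^sup>2 * h + (real n)\<^sup>2 * dsq n e)" by (intro mult_left_mono add_mono mm2) auto
    finally have "(\<Sum>j=1..n. (B' j)\<^sup>2) * h \<le> 2 * (10 * k\<^sup>2 * F\<^sup>2 * h + (real n)\<^sup>2 * dsq n e) * h"
      using th by (intro mult_right_mono) auto
    also have "\<dots> = 20 * (t * F)\<^sup>2 + 2 * (n * dsq n e)"
    proof -
      have "(real n)\<^sup>2 * h = n" using n by (simp add: h_def power2_eq_square)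
      moreover have "2 * (10 * k\<^sup>2 * F\<^sup>2 * h + (real n)\<^sup>2 * dsq n e) * h = 20 * (t * F)\<^sup>2 + 2 * (((real n)\<^sup>2 * h) * dsq n e)"
        by (simp add: th(1) algebra_simps power2_eq_square)
      ultimately show ?thesis by simp
    qed
    also have "\<dots> \<le> 25 * (t * F)\<^sup>2 + 4 * (10^10 * (k * M + g * t * F))\<^sup>2"
      by (intro add_mono mult_mono gerr) (use dsq_nonneg in auto)
    also have "\<dots> = (5 * (t * F))\<^sup>2 + (2 * 10^10 * (k * M + g * t * F))\<^sup>2"
    proof -
      have "25 * x\<^sup>2 + 4 * (c * y)\<^sup>2 = (5 * x)\<^sup>2 + (2 * c * y)\<^sup>2" for x y c :: real
        by (simp add: power_mult_distrib)
      then show ?thesis .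
    qed
    finally show "(\<Sum>j=1..n. (B' j)\<^sup>2) / n \<le> (5 * (t * F))\<^sup>2 + (2 * 10^10 * (k * M + g * t * F))\<^sup>2" by (simp add: h_def)
  qed (use ktF k0 M g th F(1) in auto)
  also have "\<dots> \<le> 10^12 * G * (t + k * t\<^sup>2) * F"
  proof -
    have "1 * (t * F) \<le> G * (t * F)" using ktF G by (intro mult_right_mono) auto
    moreover have "k * M \<le> 2 * (G * (k * t\<^sup>2 * F))"
      using mult_right_mono[OF G(2) ktF(1)] by (simp add: M_def mult_ac)
    moreover have "g * t * F \<le> G * (t * F)" using mult_right_mono[OF G(3) ktF(3)] by (simp add: mult_ac)
    moreover have "10^12 * G * (t + k * t\<^sup>2) * F = 10^12 * (G * (t * F)) + 10^12 * (G * (k * t\<^sup>2 * F))" by (simp add: algebra_simps)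
    moreover have "G * (k * t\<^sup>2 * F) \<ge> 0" "G * (t * F) \<ge> 0" using G ktF by auto
    moreover have "5 * x + 2 * 10^10 * (y + y') \<le> 10^12 * z' + 10^12 * z"
      if "1 * x \<le> z'" "y \<le> 2 * z" "y' \<le> z'" "z \<ge> 0" "z' \<ge> 0" for x y y' z z' :: real
      using that by simp
    ultimately show ?thesis by metis
  qed
  finally show "L2norm (D (\<lambda>x. u x - w x)) \<le> 10^12 * (g + 1 / g) * (k / n + k * (k / n)\<^sup>2) * F"
    by (simp only: G_def t_def)
qed

text \<open>The exact and the discrete solution are bounded separately. The squared load is of order
  \<open>h^3 F^2\<close>, which matches the powers of \<open>h\<close> on the left of
  \<open>coarse_stability\<close>.\<close>

lemma coarse_estimate:
  assumes n: "n > 0" and g: "g > 0" and sol: "cip_solution n k (- \<i> * of_real g) f w"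
    and coarse: "(k / n)^3 \<ge> 1 / n" and tT: "k / n \<le> T" "T \<ge> 1"
  defines "L \<equiv> 64 * (1 + T\<^sup>2)\<^sup>2 * ((200 * (1 + T) * T\<^sup>2)\<^sup>2 * (1 + T))"
  shows "L2norm (\<lambda>x. of_real k * (u x - w x)) \<le> (4 + 5 * L) * (g + 1 / g) * F"
    and "L2norm (D (\<lambda>x. u x - w x)) \<le> (4 + 5 * L) * (g + 1 / g) * F"
proof -
  define W b where "W j = w (node n j)" and "b i = ip f (hat n i) / of_nat n" for i j
  define t h where "t = k / n" and "h = 1 / real n"
  have w: "w \<in> Vh n" using sol by (simp add: cip_solution_def)
  have k0: "k > 0" using k by simp
  have sys: "cip_system n t g W b"
    using cip_solution_imp_system[OF n k0 g sol] by (simp add: W_def[abs_def] b_def[abs_def] t_def)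
  have th: "t = k * h" "h > 0" "t > 0" "h \<le> 1" "n * h = 1" using k n by (auto simp: t_def h_def)
  have ht: "h \<le> t" using mult_right_mono[OF k, of h] th by simp
  interpret c: cip_system n t g W b by (rule sys)
  have R: "c.R \<le> 2 * (h * sqrt h * F)" unfolding c.R_def b_def h_def by (rule load_bound[OF n])
  define G where "G = g + 1 / g"
  have G: "G \<ge> 1" "c.G = G" using c.G unfolding c.G_def G_def by auto
  have L: "L \<ge> 0" using tT by (simp add: L_def)
  have h3: "h \<le> t^3" using coarse by (simp add: t_def h_def)
  note cs = c.coarse_stability[OF tT(1)[folded t_def] tT(2) th(2,4) ht h3, folded L_def, unfolded G(2)]
  have R2: "c.R\<^sup>2 \<le> 4 * (h^3 * F\<^sup>2)"
  proof -
    have "c.R\<^sup>2 \<le> (2 * (h * sqrt h * F))\<^sup>2" using R c.nn by (intro power_mono) auto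
    also have "\<dots> = 4 * (h^3 * F\<^sup>2)" using th by (simp add: power_mult_distrib power3_eq_cube power2_eq_square[of h])
    finally show ?thesis .
  qed
  have N: "k\<^sup>2 * h * sq n W \<le> 4 * (L * G * F)\<^sup>2"
  proof -
    have "(t * h * c.N)\<^sup>2 \<le> (L * G * c.R)\<^sup>2" using cs(1) th c.nn by (intro power_mono) auto
    also have "\<dots> \<le> (L * G)\<^sup>2 * (4 * (h^3 * F\<^sup>2))" unfolding power_mult_distrib[of "L * G"] by (intro mult_left_mono R2) auto
    finally have "h^3 * (k\<^sup>2 * h * sq n W) \<le> h^3 * (4 * (L * G * F)\<^sup>2)"
      unfolding c.N2[symmetric] by (simp add: th(1) power_mult_distrib power2_eq_square power3_eq_cube mult_ac)
    then show ?thesis using th by simp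
  qed
  have A: "n * dsq n W \<le> 8 * (L * G * F)\<^sup>2"
  proof -
    have "h\<^sup>2 * dsq n W \<le> 2 * L\<^sup>2 * G\<^sup>2 * c.R\<^sup>2" using cs(2) unfolding c.Aq_def .
    also have "\<dots> \<le> 2 * L\<^sup>2 * G\<^sup>2 * (4 * (h^3 * F\<^sup>2))" by (intro mult_left_mono R2) auto
    finally have "h\<^sup>2 * dsq n W \<le> h\<^sup>2 * (h * (8 * (L * G * F)\<^sup>2))"
      by (simp add: power_mult_distrib power2_eq_square power3_eq_cube mult_ac)
    then have "dsq n W \<le> h * (8 * (L * G * F)\<^sup>2)" using th by simp
    then have "n * dsq n W \<le> n * (h * (8 * (L * G * F)\<^sup>2))" by (intro mult_left_mono) auto
    also have "\<dots> = 8 * (L * G * F)\<^sup>2" unfolding mult.assoc[symmetric] using th(5) by simp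
    finally show ?thesis .
  qed
  have W0: "W 0 = 0" by (rule c.w0)
  have LGF: "L * G * F \<ge> 0" using L G F(1) by simp
  have fin: "4 * F + 5 * (L * G * F) \<le> (4 + 5 * L) * G * F"
    using mult_right_mono[OF G(1) F(1)] by (simp add: algebra_simps)
  define B where "B j = 2 * F + k * cmod (W (j - 1)) + k * cmod (W j)" for j
  have "L2norm (\<lambda>x. of_real k * (u x - w x)) \<le> sqrt ((\<Sum>j=1..n. (B j)\<^sup>2) / n)"
  proof (rule L2norm_cell_bound[OF n])
    fix j x assume j: "1 \<le> j" "j \<le> n" and x: "x \<in> {node n (j - 1)<..<node n j}"
    note cx = cell_coordinate[OF n j(1) x]
    have "w x = W (j - 1) + (W j - W (j - 1)) * of_real (n * x - (real j - 1))"
      unfolding W_def by (rule Vh_linear[OF n w j cx(3)])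
    then have "cmod (w x) \<le> cmod (W (j - 1)) + cmod (W j)" using convex_norm[OF cx(1,2)] by simp
    then have "k * cmod (w x) \<le> k * (cmod (W (j - 1)) + cmod (W j))" using k0 by (intro mult_left_mono) auto
    moreover have "k * cmod (u x) \<le> 2 * F" using cx(3) cell_bounds[OF n j] by (intro stability) auto
    moreover have "cmod (of_real k * (u x - w x)) \<le> k * cmod (u x) + k * cmod (w x)"
      using mult_left_mono[OF norm_triangle_ineq4[of "u x" "w x"], of k] k0 by (simp add: norm_mult distrib_left)
    ultimately show "cmod (of_real k * (u x - w x)) \<le> B j" by (simp add: B_def distrib_left)
  qed
  also have "\<dots> \<le> 4 * F + 5 * (L * G * F)"
  proof (rule sqrt_le_sum)
    have "(\<Sum>j=1..n. (B j)\<^sup>2) \<le> (\<Sum>j=1..n. 3 * ((2 * F)\<^sup>2 + (k * cmod (W (j - 1)))\<^sup>2 + (k * cmod (W j))\<^sup>2))"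
      unfolding B_def by (intro sum_mono square_sum3)
    also have "\<dots> = 3 * (n * (2 * F)\<^sup>2 + k\<^sup>2 * (\<Sum>j=1..n. (cmod (W (j - 1)))\<^sup>2) + k\<^sup>2 * sq n W)"
      by (simp only: sum_distrib_left[symmetric] sum.distrib power_mult_distrib[of k] sq_def) simp
    also have "\<dots> \<le> 3 * (n * (2 * F)\<^sup>2 + k\<^sup>2 * sq n W + k\<^sup>2 * sq n W)"
      by (intro mult_left_mono add_mono sum_shifted_squares W0) auto
    finally have "(\<Sum>j=1..n. (B j)\<^sup>2) * h \<le> 3 * (n * (2 * F)\<^sup>2 + k\<^sup>2 * sq n W + k\<^sup>2 * sq n W) * h"
      using th by (intro mult_right_mono) auto
    also have "\<dots> = 12 * ((n * h) * F\<^sup>2) + 6 * (k\<^sup>2 * h * sq n W)" by (simp add: algebra_simps power2_eq_square)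
    also have "\<dots> \<le> 12 * F\<^sup>2 + 6 * (4 * (L * G * F)\<^sup>2)" unfolding th(5) mult_1 using N by linarith
    also have "\<dots> \<le> (4 * F)\<^sup>2 + (5 * (L * G * F))\<^sup>2" by (simp add: power_mult_distrib[of 4] power_mult_distrib[of 5])
    finally show "(\<Sum>j=1..n. (B j)\<^sup>2) / n \<le> (4 * F)\<^sup>2 + (5 * (L * G * F))\<^sup>2" by (simp add: h_def)
  qed (use F(1) LGF in auto)
  also note fin
  finally show "L2norm (\<lambda>x. of_real k * (u x - w x)) \<le> (4 + 5 * L) * (g + 1 / g) * F" by (simp only: G_def)
  define B' where "B' j = 2 * F + n * cmod (W j - W (j - 1))" for j
  have "L2norm (D (\<lambda>x. u x - w x)) \<le> sqrt ((\<Sum>j=1..n. (B' j)\<^sup>2) / n)"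
  proof (rule L2norm_cell_bound[OF n])
    fix j x assume j: "1 \<le> j" "j \<le> n" and x: "x \<in> {node n (j - 1)<..<node n j}"
    note cx = cell_coordinate[OF n j(1) x]
    have "cmod (v x) \<le> 2 * F" using cx(3) cell_bounds[OF n j] by (intro stability) auto
    then show "cmod (D (\<lambda>x. u x - w x) x) \<le> B' j"
      unfolding D_error[OF n w j x] B'_def W_def
      by (intro order_trans[OF norm_triangle_ineq4] add_mono) (auto simp: norm_mult)
  qed
  also have "\<dots> \<le> 4 * F + 5 * (L * G * F)"
  proof (rule sqrt_le_sum)
    have "(\<Sum>j=1..n. (B' j)\<^sup>2) \<le> (\<Sum>j=1..n. 2 * ((2 * F)\<^sup>2 + (n * cmod (W j - W (j - 1)))\<^sup>2))"
      unfolding B'_def by (intro sum_mono square_sum2)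
    also have "\<dots> = 2 * (n * (2 * F)\<^sup>2 + (real n)\<^sup>2 * dsq n W)"
      by (simp only: sum_distrib_left[symmetric] sum.distrib power_mult_distrib[of "real n"] dsq_def) simp
    finally have "(\<Sum>j=1..n. (B' j)\<^sup>2) * h \<le> 2 * (n * (2 * F)\<^sup>2 + (real n)\<^sup>2 * dsq n W) * h"
      using th by (intro mult_right_mono) auto
    also have "\<dots> = 8 * ((n * h) * F\<^sup>2) + 2 * ((n * h) * (n * dsq n W))" by (simp add: algebra_simps power2_eq_square)
    also have "\<dots> \<le> 8 * F\<^sup>2 + 2 * (8 * (L * G * F)\<^sup>2)" unfolding th(5) mult_1 using A by linarith
    also have "\<dots> \<le> (4 * F)\<^sup>2 + (5 * (L * G * F))\<^sup>2" by (simp add: power_mult_distrib[of 4] power_mult_distrib[of 5])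
    finally show "(\<Sum>j=1..n. (B' j)\<^sup>2) / n \<le> (4 * F)\<^sup>2 + (5 * (L * G * F))\<^sup>2" by (simp add: h_def)
  qed (use F(1) LGF in auto)
  also note fin
  finally show "L2norm (D (\<lambda>x. u x - w x)) \<le> (4 + 5 * L) * (g + 1 / g) * F" by (simp only: G_def)
qed

end

theorem theorem3p1:
  fixes c\<^sub>0 :: real
  assumes "c\<^sub>0 > 0"
  shows "\<exists>C::real. C > 0 \<and>
    (\<forall>(k::real) (h::real) (n::nat) (\<gamma>::complex) (\<gamma>\<^sub>I\<^sub>m::real)
      (f::real \<Rightarrow> complex) (u::real \<Rightarrow> complex) (u\<^sub>h::real \<Rightarrow> complex).
      k \<ge> 1 \<longrightarrow> n > 0 \<longrightarrow> h = 1 / real n \<longrightarrow> k * h \<le> c\<^sub>0 \<longrightarrow>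
      f \<in> L2 0 1 \<longrightarrow>
      \<gamma> = \<i> * complex_of_real \<gamma>\<^sub>I\<^sub>m \<longrightarrow> \<gamma>\<^sub>I\<^sub>m < 0 \<longrightarrow>
      bvp_solution k f u \<longrightarrow>
      cip_solution n k \<gamma> f u\<^sub>h \<longrightarrow>
        L2norm (\<lambda>x. complex_of_real k * (u x - u\<^sub>h x))
          \<le> C * (cmod \<gamma> + inverse (cmod \<gamma>)) * min 1 (k ^ 3 * h\<^sup>2) * L2norm f \<and>
        L2norm (D (\<lambda>x. u x - u\<^sub>h x))
          \<le> C * (cmod \<gamma> + inverse (cmod \<gamma>)) * (k * h + min 1 (k ^ 3 * h\<^sup>2)) * L2norm f)"
proof -
  \<comment> \<open>The energy estimates are stated for an upper bound of \<open>t\<close> that is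
    at least 1.\<close>
  define T where "T = max c\<^sub>0 1"
  define L where "L = 64 * (1 + T\<^sup>2)\<^sup>2 * ((200 * (1 + T) * T\<^sup>2)\<^sup>2 * (1 + T))"
  define C where "C = 10^12 + (4 + 5 * L)"
  have T: "T \<ge> 1" "c\<^sub>0 \<le> T" by (auto simp: T_def)
  have L: "L \<ge> 0" using T by (simp add: L_def)
  have C: "C > 0" "10^12 \<le> C" "4 + 5 * L \<le> C" using L by (auto simp: C_def)
  show ?thesis
  proof (intro exI[of _ C] conjI C(1) allI impI)
    fix k h :: real and n :: nat and \<gamma> :: complex and gIm :: real and f u w :: "real \<Rightarrow> complex"
    assume k: "k \<ge> 1" and n: "n > 0" and h: "h = 1 / real n" and kh: "k * h \<le> c\<^sub>0" and f: "f \<in> L2 0 1"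
      and \<gamma>: "\<gamma> = \<i> * complex_of_real gIm" and gIm: "gIm < 0" and u: "bvp_solution k f u" and w: "cip_solution n k \<gamma> f w"
    define g where "g = - gIm"
    have g: "g > 0" "\<gamma> = - \<i> * of_real g" "cmod \<gamma> = g" using gIm by (auto simp: g_def \<gamma> norm_mult)
    obtain v q S where "helmholtz_solution k f u v q S"
      using bvp_solution_imp_helmholtz[OF u k f] by blast
    then interpret hs: helmholtz_solution k f u v q S .
    have sol: "cip_solution n k (- \<i> * of_real g) f w" using w unfolding g(2) .
    have F: "hs.F = L2norm f" "L2norm f \<ge> 0" by (simp_all add: hs.F_def L2norm_nonneg)
    define G where "G = g + 1 / g"
    have G: "G > 0" "cmod \<gamma> + inverse (cmod \<gamma>) = G" using g by (simp_all add: G_def g(3) inverse_eq_divide add_pos_pos)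
    have khn: "k * h = k / n" "k^3 * h\<^sup>2 = k * (k / n)\<^sup>2"
      by (simp_all add: h power_divide power2_eq_square power3_eq_cube)
    \<comment> \<open>Multiplying by \<open>n\<close> identifies the case condition
      \<open>(k / n)^3 \<le> 1 / n\<close> with \<open>k^3 h^2 \<le> 1\<close>, which decides the
      minimum.\<close>
    have k3: "n * (k / n)^3 = k * (k / n)\<^sup>2" using n by (simp add: power2_eq_square power3_eq_cube)
    have mono: "c * G * p * L2norm f \<le> C * G * p * L2norm f" if "c \<le> C" "p \<ge> 0" for c p
      using that G F(2) by (intro mult_right_mono) auto
    have "L2norm (\<lambda>x. of_real k * (u x - w x)) \<le> C * G * min 1 (k^3 * h\<^sup>2) * L2norm f \<and>
       L2norm (D (\<lambda>x. u x - w x)) \<le> C * G * (k * h + min 1 (k^3 * h\<^sup>2)) * L2norm f"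
    proof (cases "(k / n)^3 \<le> 1 / n")
      case True
      have "n * (k / n)^3 \<le> n * (1 / n)" using True by (intro mult_left_mono) auto
      then have m: "min 1 (k^3 * h\<^sup>2) = k * (k / n)\<^sup>2" using n unfolding k3 khn by simp
      show ?thesis unfolding m khn(1)
        using hs.fine_estimate[OF n g(1) sol True] mono[OF C(2), of "k * (k / n)\<^sup>2"] mono[OF C(2), of "k / n + k * (k / n)\<^sup>2"] k
        unfolding F(1) G_def[symmetric] by (auto intro: order_trans)
    next
      case False
      then have ge: "(k / n)^3 \<ge> 1 / n" by simp
      have "n * (k / n)^3 \<ge> n * (1 / n)" using ge by (intro mult_left_mono) auto
      then have m: "min 1 (k^3 * h\<^sup>2) = 1" using n unfolding k3 khn by simp
      have tT: "k / n \<le> T" using kh T unfolding khn by simp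
      note ce = hs.coarse_estimate[OF n g(1) sol ge tT T(1), folded L_def, unfolded F(1), folded G_def]
      have "(4 + 5 * L) * G * L2norm f \<le> C * G * 1 * L2norm f" using mono[OF C(3), of 1] by simp
      moreover have "C * G * 1 * L2norm f \<le> C * G * (k / n + 1) * L2norm f"
        using k C G F by (intro mult_right_mono mult_left_mono) auto
      ultimately show ?thesis unfolding m khn(1) using ce by linarith
    qed
    then show "L2norm (\<lambda>x. complex_of_real k * (u x - w x)) \<le> C * (cmod \<gamma> + inverse (cmod \<gamma>)) * min 1 (k^3 * h\<^sup>2) * L2norm f"
      and "L2norm (D (\<lambda>x. u x - w x)) \<le> C * (cmod \<gamma> + inverse (cmod \<gamma>)) * (k * h + min 1 (k^3 * h\<^sup>2)) * L2norm f"
      unfolding G(2) by auto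
  qed
qed

end
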